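(* Let $G$ be a nonbipartite matching covered graph with a nontrivial tight cut. Then $G$ is matching double covered if and only if $G$ is (isomorphic to) one of $T_3$, $T_4$, $T_5$, or $T_6$.
   Context: Graphs are finite, loopless, and may have parallel edges (parallel edges are distinct edges, so perfect matchings differing only by the choice of a parallel edge are different). A connected graph is matching covered if every edge belongs to at least one perfect matching, and matching double covered if every edge belongs to exactly two perfect matchings. For $X\subseteq V(G)$, $\nabla(X)$ is the set of edges with exactly one end in $X$; it is a cut with shores $X$ and $V(G)\setminus X$, and it is trivial if one of its shores is a single vertex. A cut $C=\nabla(X)$ with $|X|$ odd in a matching covered graph is tight if $|C\cap M|=1$ for every perfect matching $M$. Triangle replacement at a vertex $u$ of degree $3$ with incident edges $u_1u,u_2u,u_3u$: delete $u$, add a new triangle $w_1w_2w_3$, and add the edges $u_iw_i$ ($i=1,2,3$). The graphs are: - $T_3$: the $4$-regular graph on vertices $p,u,q,r,s,t$ with edges $pq,pr,ps,pt,uq,ur,us,ut$ (each once), $qr$ (twice), $st$ (twice). - $T_4,T_5,T_6$: obtained from $K_{3,3}$ with bipartition $(A,B)$ by triangle replacement at exactly one, exactly two, or all three vertices of $A$, respectively. *)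

theory Defs
  imports Main
begin

(* Edges are named objects with a set of ends, so distinct edges may be parallel. *)
record ('v, 'e) multigraph =
  verts :: "'v set"
  edges :: "'e set"
  ends :: "'e \<Rightarrow> 'v set"

definition finite_loopless :: "('v, 'e) multigraph \<Rightarrow> bool" where
  "finite_loopless G \<longleftrightarrow> finite (verts G) \<and> finite (edges G) \<and>
     (\<forall>e\<in>edges G. ends G e \<subseteq> verts G \<and> card (ends G e) = 2)"

definition isomorphic :: "('v, 'e) multigraph \<Rightarrow> ('w, 'f) multigraph \<Rightarrow> bool" where
  "isomorphic G H \<longleftrightarrow> (\<exists>f g. bij_betw f (verts G) (verts H) \<and> bij_betw g (edges G) (edges H) \<and>
     (\<forall>e\<in>edges G. ends H (g e) = f ` ends G e))"

definition adjacency :: "('v, 'e) multigraph \<Rightarrow> ('v \<times> 'v) set" where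
  "adjacency G = {(x, y). \<exists>e\<in>edges G. ends G e = {x, y}}"

definition connected_graph :: "('v, 'e) multigraph \<Rightarrow> bool" where
  "connected_graph G \<longleftrightarrow> verts G \<noteq> {} \<and>
     (\<forall>x\<in>verts G. \<forall>y\<in>verts G. (x, y) \<in> (adjacency G)\<^sup>*)"

definition bipartite :: "('v, 'e) multigraph \<Rightarrow> bool" where
  "bipartite G \<longleftrightarrow> (\<exists>A B. A \<union> B = verts G \<and> A \<inter> B = {} \<and>
     (\<forall>e\<in>edges G. \<exists>a\<in>A. \<exists>b\<in>B. ends G e = {a, b}))"

definition perfect_matching :: "('v, 'e) multigraph \<Rightarrow> 'e set \<Rightarrow> bool" where
  "perfect_matching G M \<longleftrightarrow> M \<subseteq> edges G \<and> (\<forall>v\<in>verts G. \<exists>!e. e \<in> M \<and> v \<in> ends G e)"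

definition matching_covered :: "('v, 'e) multigraph \<Rightarrow> bool" where
  "matching_covered G \<longleftrightarrow> connected_graph G \<and>
     (\<forall>e\<in>edges G. \<exists>M. perfect_matching G M \<and> e \<in> M)"

definition matching_double_covered :: "('v, 'e) multigraph \<Rightarrow> bool" where
  "matching_double_covered G \<longleftrightarrow> connected_graph G \<and>
     (\<forall>e\<in>edges G. card {M. perfect_matching G M \<and> e \<in> M} = 2)"

definition cut :: "('v, 'e) multigraph \<Rightarrow> 'v set \<Rightarrow> 'e set" where
  "cut G X = {e \<in> edges G. card (ends G e \<inter> X) = 1}"

definition trivial_cut :: "('v, 'e) multigraph \<Rightarrow> 'e set \<Rightarrow> bool" where
  "trivial_cut G C \<longleftrightarrow> (\<exists>X\<subseteq>verts G. C = cut G X \<and> (card X = 1 \<or> card (verts G - X) = 1))"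

definition tight_cut :: "('v, 'e) multigraph \<Rightarrow> 'e set \<Rightarrow> bool" where
  "tight_cut G C \<longleftrightarrow> (\<exists>X\<subseteq>verts G. odd (card X) \<and> C = cut G X) \<and>
     (\<forall>M. perfect_matching G M \<longrightarrow> card (C \<inter> M) = 1)"

definition incident_edges :: "('v, 'e) multigraph \<Rightarrow> 'v \<Rightarrow> 'e set" where
  "incident_edges G u = {e \<in> edges G. u \<in> ends G e}"

(* Meant for a vertex u of degree 3. The three triangle vertices are named Inr e after the
   edges e at u: the old edge e has its end u moved to Inr e, and the triangle edge joining
   Inr e and Inr f is named Inr {e, f}. *)
definition triangle_replacement ::
    "('v, 'e) multigraph \<Rightarrow> 'v \<Rightarrow> ('v + 'e, 'e + 'e set) multigraph" where
  "triangle_replacement G u =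
     \<lparr>verts = Inl ` (verts G - {u}) \<union> Inr ` incident_edges G u,
      edges = Inl ` edges G \<union>
        Inr ` {{e, f} |e f. e \<in> incident_edges G u \<and> f \<in> incident_edges G u \<and> e \<noteq> f},
      ends = (\<lambda>x. case x of
          Inl e \<Rightarrow> (\<lambda>v. if v = u then Inr e else Inl v) ` ends G e
        | Inr D \<Rightarrow> Inr ` D)\<rparr>"

(* Bipartition A = {0, 1, 2}, B = {3, 4, 5}. *)
definition K33 :: "(nat, nat \<times> nat) multigraph" where
  "K33 = \<lparr>verts = {0, 1, 2} \<union> {3, 4, 5}, edges = {0, 1, 2} \<times> {3, 4, 5},
          ends = (\<lambda>(a, b). {a, b})\<rparr>"

datatype T3_vertex = vp | vu | vq | vr | vs | vt

(* The third component of an edge tells parallel edges apart. *)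
definition T3 :: "(T3_vertex, T3_vertex \<times> T3_vertex \<times> nat) multigraph" where
  "T3 = \<lparr>verts = {vp, vu, vq, vr, vs, vt},
         edges = {(vp, vq, 0), (vp, vr, 0), (vp, vs, 0), (vp, vt, 0),
                  (vu, vq, 0), (vu, vr, 0), (vu, vs, 0), (vu, vt, 0),
                  (vq, vr, 0), (vq, vr, 1), (vs, vt, 0), (vs, vt, 1)},
         ends = (\<lambda>(x, y, i). {x, y})\<rparr>"

definition "T4 = triangle_replacement K33 0"

(* Inl v is the name that an untouched vertex v gets in a triangle replacement. *)
definition "T5 = triangle_replacement T4 (Inl 1)"

definition "T6 = triangle_replacement T5 (Inl (Inl 2))"

end

theory Submission imports Defs begin

text \<open>If G is matching double covered, then it is r-regular with 2r perfect matchings, and a tight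
  cut C has r edges. For an edge f of C, the numbers of perfect matchings through f in the two
  contractions of C multiply to 2, so one contraction has two edges f, f' with just one
  perfect matching each. These two matchings share no edge with any other perfect matching of that
  contraction; by an argument of Bogdanov, they then form a Hamiltonian cycle of length four, all
  further edges are diagonals of it, and r is 3 or 4. If r = 4, the other contraction has the same
  shape, and G is T3.

  If r = 3, one shore of C is a triangle. By tightness no perfect matching uses the three edges
  leaving it, so Tutte's theorem yields a barrier. The odd components of the barrier have tight cuts,
  so they are single vertices or triangles, and contracting the triangles gives a bipartite cubic
  matching double covered graph. Its six perfect matchings include two disjoint ones forming a
  Hamiltonian cycle, their common complement, and one for each of the remaining edges, so
  it has at most six vertices and is K33. Hence G is T4, T5 or T6.\<close>

subsection \<open>Perfect matchings as functions\<close>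

text \<open>Each edge of C has a single perfect matching in one contraction, so with at least three
  edges two of them share that contraction. Single means exclusive: the matching extends in two ways
  through the other contraction, which exhausts the two matchings of G allowed at each of its edges.
  The bound on r is a second count: in the four-vertex contraction every further edge of C lies in r
  - 2 perfect matchings, one per diagonal on the other two vertices, and r - 2 divides 2. For r = 4
  these further edges are the single ones of the other contraction, so the shape repeats there.

  In the cubic case one triangle says nothing about its complement. Putting its three neighbours
  into the barrier, distinct because a cubic contraction has no parallel edges, makes the complement
  of every component larger than a triangle, so the dichotomy classifies all components at once.
  When the bipartite quotient has three vertices on each side, a list of index pairs fixes the
  isomorphism type; the converse is a computation on these lists.\<close>

locale loopless_graph =
  fixes G :: "('v, 'e) multigraph"
  assumes finite_loopless: "finite_loopless G"
begin

abbreviation V where "V \<equiv> verts G"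
abbreviation E where "E \<equiv> edges G"
abbreviation PM where "PM \<equiv> Collect (perfect_matching G)"

definition edge_at :: "'e set \<Rightarrow> 'v \<Rightarrow> 'e" where
  "edge_at M v = (THE e. e \<in> M \<and> v \<in> ends G e)"

definition other_end :: "'e \<Rightarrow> 'v \<Rightarrow> 'v" where
  "other_end e v = (THE u. ends G e = {v, u})"

definition partner :: "'e set \<Rightarrow> 'v \<Rightarrow> 'v" where
  "partner M v = other_end (edge_at M v) v"

lemma finite_V: "finite V" and finite_E: "finite E"
  using finite_loopless by (auto simp: finite_loopless_def)

lemma ends_subset: "e \<in> E \<Longrightarrow> ends G e \<subseteq> V"
  using finite_loopless by (auto simp: finite_loopless_def)

lemma card_ends: "e \<in> E \<Longrightarrow> card (ends G e) = 2"
  using finite_loopless by (auto simp: finite_loopless_def)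

lemma ends_other_end:
  assumes "e \<in> E" "v \<in> ends G e"
  shows "ends G e = {v, other_end e v}" "other_end e v \<noteq> v" "other_end e v \<in> V"
proof -
  obtain x y where xy: "ends G e = {x, y}" "x \<noteq> y"
    using card_ends[OF assms(1)] by (auto simp: card_2_iff)
  have "\<exists>!u. ends G e = {v, u}"
    using xy assms(2) by (auto simp: doubleton_eq_iff)
  from theI'[OF this] show 1: "ends G e = {v, other_end e v}"
    by (simp add: other_end_def)
  show "other_end e v \<noteq> v"
    using 1 xy by (auto simp: doubleton_eq_iff)
  show "other_end e v \<in> V"
    using 1 ends_subset[OF assms(1)] by blast
qed

lemma other_end_eqI: "ends G e = {v, u} \<Longrightarrow> other_end e v = u"
  unfolding other_end_def by (auto simp: doubleton_eq_iff)

lemma pm_subset: "perfect_matching G M \<Longrightarrow> M \<subseteq> E"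
  by (simp add: perfect_matching_def)

lemma edge_at:
  assumes "perfect_matching G M" "v \<in> V"
  shows "edge_at M v \<in> M" "v \<in> ends G (edge_at M v)"
proof -
  have "\<exists>!e. e \<in> M \<and> v \<in> ends G e"
    using assms by (simp add: perfect_matching_def)
  from theI'[OF this] show "edge_at M v \<in> M" "v \<in> ends G (edge_at M v)"
    by (simp_all add: edge_at_def)
qed

lemma edge_at_edge: "perfect_matching G M \<Longrightarrow> v \<in> V \<Longrightarrow> edge_at M v \<in> E"
  using edge_at pm_subset by blast

lemma edge_at_eqI:
  assumes "perfect_matching G M" "e \<in> M" "v \<in> ends G e"
  shows "edge_at M v = e"
proof -
  have v: "v \<in> V"
    using assms pm_subset ends_subset by blast
  then have "\<exists>!e. e \<in> M \<and> v \<in> ends G e"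
    using assms by (simp add: perfect_matching_def)
  then show ?thesis
    using edge_at[OF assms(1) v] assms by blast
qed

lemma pm_eq_image: "perfect_matching G M \<Longrightarrow> M = edge_at M ` V"
proof (intro equalityI subsetI)
  fix e assume M: "perfect_matching G M" and e: "e \<in> M"
  then have "ends G e \<noteq> {}" "ends G e \<subseteq> V"
    using pm_subset card_ends ends_subset by fastforce+
  then show "e \<in> edge_at M ` V"
    using edge_at_eqI[OF M e] by force
qed (auto simp: edge_at)

lemma pm_ext:
  assumes "perfect_matching G M" "perfect_matching G N"
    "\<And>v. v \<in> V \<Longrightarrow> edge_at M v = edge_at N v"
  shows "M = N"
  by (subst pm_eq_image[OF assms(1)], subst pm_eq_image[OF assms(2)])
    (rule image_cong[OF refl assms(3)])

lemma edge_at_mem_iff: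
  assumes "perfect_matching G M" "e \<in> E" "v \<in> ends G e"
  shows "e \<in> M \<longleftrightarrow> edge_at M v = e"
proof -
  have "v \<in> V"
    using assms ends_subset by blast
  then show ?thesis
    using edge_at(1)[OF assms(1)] edge_at_eqI[OF assms(1) _ assms(3)] by metis
qed

text \<open>A perfect matching is the same thing as a choice of an edge at every vertex that is
  constant on the ends of the chosen edges.\<close>

lemma pm_of_fun:
  assumes "\<And>v. v \<in> V \<Longrightarrow> m v \<in> E" "\<And>v. v \<in> V \<Longrightarrow> v \<in> ends G (m v)"
    "\<And>v u. v \<in> V \<Longrightarrow> u \<in> ends G (m v) \<Longrightarrow> m u = m v"
  shows "perfect_matching G (m ` V)" "\<And>v. v \<in> V \<Longrightarrow> edge_at (m ` V) v = m v"
proof -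
  show 1: "perfect_matching G (m ` V)"
    unfolding perfect_matching_def
  proof (intro conjI ballI)
    show "m ` V \<subseteq> E" using assms(1) by auto
    fix v assume v: "v \<in> V"
    show "\<exists>!e. e \<in> m ` V \<and> v \<in> ends G e"
    proof (rule ex1I[of _ "m v"])
      show "m v \<in> m ` V \<and> v \<in> ends G (m v)" using v assms(2) by auto
      show "e = m v" if "e \<in> m ` V \<and> v \<in> ends G e" for e
        using that assms(3) by (metis imageE)
    qed
  qed
  show "\<And>v. v \<in> V \<Longrightarrow> edge_at (m ` V) v = m v"
    by (rule edge_at_eqI[OF 1 imageI assms(2)])
qed

lemma partner:
  assumes "perfect_matching G M" "v \<in> V"
  shows "ends G (edge_at M v) = {v, partner M v}" "partner M v \<noteq> v" "partner M v \<in> V"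
    "edge_at M (partner M v) = edge_at M v" "partner M (partner M v) = v"
proof -
  note e = edge_at[OF assms] edge_at_edge[OF assms]
  show 1: "ends G (edge_at M v) = {v, partner M v}" "partner M v \<noteq> v" "partner M v \<in> V"
    unfolding partner_def by (rule ends_other_end[OF e(3,2)])+
  show 2: "edge_at M (partner M v) = edge_at M v"
    by (rule edge_at_eqI[OF assms(1) e(1)]) (simp add: 1)
  show "partner M (partner M v) = v"
    unfolding partner_def[of M "partner M v"] 2
    by (rule other_end_eqI) (simp add: 1 insert_commute)
qed

lemma partner_eqI:
  assumes "perfect_matching G M" "e \<in> M" "ends G e = {v, u}"
  shows "partner M v = u"
proof -
  have "edge_at M v = e"
    by (rule edge_at_eqI[OF assms(1,2)]) (simp add: assms(3))
  then show ?thesis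
    by (simp add: partner_def other_end_eqI[OF assms(3)])
qed

lemma finite_PM: "finite PM"
proof (rule finite_subset[of _ "Pow E"])
  show "PM \<subseteq> Pow E"
    using pm_subset by blast
qed (simp add: finite_E)

lemma finite_PM_sub: "finite {M. perfect_matching G M \<and> Q M}"
  by (rule finite_subset[OF _ finite_PM]) blast

text \<open>Double counting of the pairs of a perfect matching and its edge in \<open>F\<close>. The
  edges at a vertex and the edges of a tight cut are both such sets, which makes all these sets
  equally large in a double covered graph.\<close>

lemma card_PM_of_transversal:
  assumes "F \<subseteq> E" "\<And>e. e \<in> F \<Longrightarrow> card {M. perfect_matching G M \<and> e \<in> M} = k"
    "\<And>M. perfect_matching G M \<Longrightarrow> \<exists>!e. e \<in> M \<and> e \<in> F"
  shows "card PM = k * card F"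
proof -
  have eq: "PM = (\<Union>e\<in>F. {M. perfect_matching G M \<and> e \<in> M})"
    using assms(3) by blast
  have "card PM = (\<Sum>e\<in>F. card {M. perfect_matching G M \<and> e \<in> M})"
    unfolding eq
    by (rule card_UN_disjoint)
      (use assms(3) finite_subset[OF assms(1) finite_E] in \<open>auto simp: finite_PM_sub\<close>)
  then show ?thesis
    using assms(2) by (simp add: mult.commute)
qed

lemma card_PM_degree:
  assumes "\<And>e. e \<in> E \<Longrightarrow> card {M. perfect_matching G M \<and> e \<in> M} = k" "v \<in> V"
  shows "card PM = k * card (incident_edges G v)"
proof (rule card_PM_of_transversal)
  show "incident_edges G v \<subseteq> E" by (auto simp: incident_edges_def)
  show "\<exists>!e. e \<in> M \<and> e \<in> incident_edges G v" if M: "perfect_matching G M" for M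
  proof -
    have "\<exists>!e. e \<in> M \<and> v \<in> ends G e"
      using that assms(2) by (simp add: perfect_matching_def)
    then show ?thesis
      using pm_subset[OF M] by (auto simp: incident_edges_def)
  qed
qed (use assms in \<open>auto simp: incident_edges_def\<close>)

text \<open>The pairs of \<open>v\<close> and \<open>f v\<close> partition \<open>W\<close>. With
  \<open>f\<close> the partner function this yields the parity of \<open>V\<close>, and it shows
  that an odd component cannot be matched within itself.\<close>

lemma even_card_closed:
  assumes "finite W" "\<And>v. v \<in> W \<Longrightarrow> f v \<in> W" "\<And>v. v \<in> W \<Longrightarrow> f v \<noteq> v"
    "\<And>v. v \<in> W \<Longrightarrow> f (f v) = v"
  shows "even (card W)"
  using assms
proof (induction "card W" arbitrary: W rule: less_induct)
  case less
  show ?case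
  proof (cases "W = {}")
    case False
    then obtain v where v: "v \<in> W" by blast
    let ?U = "W - {v, f v}"
    have vf: "v \<noteq> f v" "f v \<in> W" using less.prems v by metis+
    have c: "card W = card ?U + 2"
      using vf v less.prems(1) card_Diff_subset[of "{v, f v}" W]
        card_mono[of W "{v, f v}"] by simp
    have "even (card ?U)"
    proof (rule less.hyps)
      show "card ?U < card W" using c by simp
      show "finite ?U" using less.prems by simp
    next
      fix u assume u: "u \<in> ?U"
      then have "f u \<noteq> v" "f u \<noteq> f v"
        using less.prems(4)[of u] less.prems(4)[OF v] by auto
      then show "f u \<in> ?U" using u less.prems(2) by auto
    qed (use less.prems in auto)
    then show ?thesis using c by simp
  qed simp
qed

end

subsection \<open>Alternating walks\<close>

primrec alt :: "('a \<Rightarrow> 'a) \<Rightarrow> ('a \<Rightarrow> 'a) \<Rightarrow> 'a \<Rightarrow> nat \<Rightarrow> 'a" where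
  "alt f g v 0 = v"
| "alt f g v (Suc i) = (if even i then f else g) (alt f g v i)"

text \<open>Partner functions of two perfect matchings, detached from any graph: the same walks
  serve two edge sets of a multigraph and the two relational matchings in the proof of Tutte's
  theorem.\<close>

locale two_involutions =
  fixes V :: "'a set" and f g :: "'a \<Rightarrow> 'a"
  assumes fin: "finite V"
    and f_closed: "v \<in> V \<Longrightarrow> f v \<in> V" and g_closed: "v \<in> V \<Longrightarrow> g v \<in> V"
    and f_neq: "v \<in> V \<Longrightarrow> f v \<noteq> v" and g_neq: "v \<in> V \<Longrightarrow> g v \<noteq> v"
    and f_invol: "v \<in> V \<Longrightarrow> f (f v) = v" and g_invol: "v \<in> V \<Longrightarrow> g (g v) = v"
begin

lemma alt_in: "v \<in> V \<Longrightarrow> alt f g v i \<in> V"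
  by (induction i) (auto simp: f_closed g_closed)

lemma alt_f: "v \<in> V \<Longrightarrow> f (alt f g v i) = (if even i then alt f g v (Suc i) else alt f g v (i - 1))"
  using alt_in[of v "i - 1"] by (cases i) (auto simp: f_invol)

text \<open>Position 0 is excluded: the walk leaves \<open>v\<close> by \<open>f\<close>, so
  \<open>g v\<close> is known to lie on it only once the walk has closed up.\<close>

lemma alt_g:
  "v \<in> V \<Longrightarrow> odd i \<or> i > 0 \<Longrightarrow>
    g (alt f g v i) = (if odd i then alt f g v (Suc i) else alt f g v (i - 1))"
  using alt_in[of v "i - 1"] by (cases i) (auto simp: g_invol)

text \<open>For even \<open>d\<close> both positions are reached by the same involution, so the two
  walks can be traced back in step until one of them is at the start.\<close>

lemma alt_shift_back:
  assumes "v \<in> V" "even d" "alt f g v (i + d) = alt f g v i"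
  shows "alt f g v d = v"
  using assms(3)
proof (induction i)
  case (Suc i)
  then have *: "(if even i then f else g) (alt f g v (i + d)) = (if even i then f else g) (alt f g v i)"
    using assms(2) by simp
  note i = alt_in[OF assms(1), of i] and id = alt_in[OF assms(1), of "i + d"]
  have "alt f g v (i + d) = alt f g v i"
  proof (cases "even i")
    case True
    with * have "f (f (alt f g v (i + d))) = f (f (alt f g v i))" by simp
    then show ?thesis by (simp only: f_invol[OF i] f_invol[OF id])
  next
    case False
    with * have "g (g (alt f g v (i + d))) = g (g (alt f g v i))" by simp
    then show ?thesis by (simp only: g_invol[OF i] g_invol[OF id])
  qed
  then show ?case by (rule Suc.IH)
qed simp

text \<open>At odd distance, the step forward from \<open>i\<close> and the step backward from the
  later position use the same involution. If the vertices agreed, the gap would shrink by two down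
  to two consecutive positions, hence to a fixed point.\<close>

lemma alt_odd_neq: "v \<in> V \<Longrightarrow> alt f g v (i + Suc (2 * k)) \<noteq> alt f g v i"
proof (induction k arbitrary: i)
  case 0
  then show ?case using alt_in[of v i] f_neq g_neq by auto
next
  case (Suc k)
  show ?case
  proof
    let ?j = "i + Suc (2 * Suc k)"
    let ?h = "if even i then f else g"
    assume eq: "alt f g v ?j = alt f g v i"
    have "alt f g v (Suc i) = ?h (alt f g v i)" by simp
    also have "\<dots> = ?h (alt f g v ?j)" using eq by simp
    also have "\<dots> = alt f g v (?j - 1)"
      using alt_f[OF Suc.prems, of ?j] alt_g[OF Suc.prems, of ?j] by auto
    also have "?j - 1 = Suc i + Suc (2 * k)" by simp
    finally show False using Suc.IH[OF Suc.prems, of "Suc i"] by simp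
  qed
qed

lemma alt_eq_parity:
  assumes "v \<in> V" "alt f g v i = alt f g v j"
  shows "even i = even j"
  using assms(2)
proof (induction i j rule: linorder_wlog)
  case (le i j)
  show ?case
  proof (rule ccontr)
    assume "even i \<noteq> even j"
    then have "odd (j - i)" using le(1) by auto
    then obtain k where "j - i = Suc (2 * k)" by (metis oddE Suc_eq_plus1)
    then have "j = i + Suc (2 * k)" using le(1) by simp
    then show False using alt_odd_neq[OF assms(1), of i k] le(2) by simp
  qed
qed auto

text \<open>Any repetition has even distance and shifts back to a return to \<open>v\<close>. Taking
  the first return as \<open>n\<close> gives injectivity, and its evenness means that the closing
  step is a \<open>g\<close>-step.\<close>

lemma alt_cycle:
  assumes v: "v \<in> V"
  obtains n where "0 < n" "even n" "alt f g v n = v" "inj_on (alt f g v) {..<n}"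
    "g v = alt f g v (n - 1)"
    "\<And>w. w \<in> alt f g v ` {..<n} \<Longrightarrow> f w \<in> alt f g v ` {..<n}"
    "\<And>w. w \<in> alt f g v ` {..<n} \<Longrightarrow> g w \<in> alt f g v ` {..<n}"
    "alt f g v ` {..<n} \<subseteq> V"
proof -
  let ?a = "alt f g v"
  have "\<not> inj ?a"
  proof
    assume "inj ?a"
    moreover have "finite (range ?a)"
      using alt_in[OF v] fin by (auto intro: finite_subset)
    ultimately show False using finite_imageD by blast
  qed
  then obtain i j where ij: "?a i = ?a j" "i \<noteq> j"
    by (auto simp: inj_def)
  define i' j' where "i' = min i j" and "j' = max i j"
  have ij_less: "?a i' = ?a j'" "i' < j'"
    using ij by (auto simp: i'_def j'_def min_def max_def)
  have ret: "?a (y - x) = v" if "?a x = ?a y" "x < y" for x y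
  proof -
    have "even (y - x)" using alt_eq_parity[OF v that(1)] by auto
    then show ?thesis using alt_shift_back[OF v, of "y - x" x] that by simp
  qed
  define n where "n = (LEAST n. 0 < n \<and> ?a n = v)"
  have "0 < j' - i' \<and> ?a (j' - i') = v" using ret[OF ij_less] ij_less by simp
  then have n: "0 < n" "?a n = v"
    unfolding n_def by (metis (mono_tags, lifting) LeastI)+
  have least: "\<And>k. 0 < k \<Longrightarrow> ?a k = v \<Longrightarrow> n \<le> k"
    unfolding n_def by (simp add: Least_le)
  have ev: "even n" using alt_eq_parity[OF v, of n 0] n by simp
  have inj: "inj_on ?a {..<n}"
  proof (rule inj_onI)
    fix x y assume xy: "x \<in> {..<n}" "y \<in> {..<n}" "?a x = ?a y"
    show "x = y"
    proof (rule ccontr)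
      assume "x \<noteq> y"
      then consider "x < y" | "y < x" by linarith
      then show False
        using ret[of x y] ret[of y x] least[of "y - x"] least[of "x - y"] xy by cases auto
    qed
  qed
  have gv: "g v = ?a (n - 1)"
    using alt_g[OF v, of n] n ev by simp
  show thesis
  proof (rule that[OF n(1) ev n(2) inj gv])
    fix w assume "w \<in> ?a ` {..<n}"
    then obtain k where k: "k < n" "w = ?a k" by auto
    have "even k \<Longrightarrow> Suc k < n" using k ev by (metis Suc_lessI even_Suc)
    then show "f w \<in> ?a ` {..<n}"
      using alt_f[OF v, of k] k by (auto simp del: alt.simps)
    show "g w \<in> ?a ` {..<n}"
    proof (cases "k = 0")
      case True
      then show ?thesis using gv k n by auto
    next
      case False
      have "odd k \<Longrightarrow> Suc k = n \<or> Suc k < n" using k by auto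
      moreover have "v = ?a 0" by simp
      ultimately show ?thesis
        using alt_g[OF v, of k] k False n by (auto simp del: alt.simps)
    qed
  qed (use alt_in[OF v] in auto)
qed

end

subsection \<open>Hamiltonian unions of two perfect matchings\<close>

text \<open>The two perfect matchings of the cycle on the positions 0, ..., n - 1 (n even), as
  involutions on positions. A perfect matching that uses chords on an even set K of positions and
  cycle edges elsewhere switches between the two whenever it passes a position in K; it exists if
  parity of position and parity of rank agree along K.\<close>

definition mate0 :: "nat \<Rightarrow> nat" where
  "mate0 i = (if even i then i + 1 else i - 1)"

definition mate1 :: "nat \<Rightarrow> nat \<Rightarrow> nat" where
  "mate1 n i = (if odd i then (if i + 1 = n then 0 else i + 1) else if i = 0 then n - 1 else i - 1)"

definition rank :: "nat set \<Rightarrow> nat \<Rightarrow> nat" where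
  "rank K x = card {q \<in> K. q < x}"

lemma rank_0 [simp]: "rank K 0 = 0"
  by (simp add: rank_def)

lemma rank_Suc: "rank K (Suc x) = (if x \<in> K then Suc (rank K x) else rank K x)"
proof -
  have "{q \<in> K. q < Suc x} = (if x \<in> K then insert x {q \<in> K. q < x} else {q \<in> K. q < x})"
    by (auto simp: less_Suc_eq)
  then show ?thesis by (simp add: rank_def)
qed

lemma rank_bound: "K \<subseteq> {..<n} \<Longrightarrow> rank K n = card K"
  unfolding rank_def by (rule arg_cong[of _ _ card]) auto

text \<open>The truth value of \<open>c = even (rank K x)\<close> is the phase: it tells which
  matching of the cycle is in use at \<open>x\<close>, and it flips at each member of
  \<open>K\<close>. The parity condition says that before the flip \<open>p\<close> would be paired
  forward and after it backward, so no remaining position is paired with a member of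
  \<open>K\<close>. Evenness of \<open>card K\<close> makes the phases fit where the cycle closes
  between \<open>n - 1\<close> and 0.\<close>

lemma mate_switch:
  assumes "even n" "x < n" "x \<notin> K" "K \<subseteq> {..<n}" "even (card K)"
    and alternating: "\<And>p. p \<in> K \<Longrightarrow> even p = (c = even (rank K p))"
  shows "c = even (rank K x) \<Longrightarrow> mate0 x \<notin> K \<and> c = even (rank K (mate0 x))"
    and "\<not> c = even (rank K x) \<Longrightarrow> mate1 n x \<notin> K \<and> \<not> c = even (rank K (mate1 n x))"
proof -
  note up = rank_Suc[of K x] and down = rank_Suc[of K "x - 1"] and top = rank_Suc[of K "n - 1"]
  assume "c = even (rank K x)"
  then show "mate0 x \<notin> K \<and> c = even (rank K (mate0 x))"
    using up down alternating[of "Suc x"] alternating[of "x - 1"] assms(3)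
    by (cases "x = 0") (auto simp: mate0_def split: if_splits)
next
  note up = rank_Suc[of K x] and down = rank_Suc[of K "x - 1"] and top = rank_Suc[of K "n - 1"]
    and n = rank_bound[OF assms(4)]
  have n0: "0 < n" "odd (n - 1)" using assms(1,2) by auto
  assume h: "\<not> c = even (rank K x)"
  consider "x = 0" | "0 < x" "even x" | "odd x" "Suc x = n" | "odd x" "Suc x \<noteq> n" by auto
  then show "mate1 n x \<notin> K \<and> \<not> c = even (rank K (mate1 n x))"
  proof cases
    case 1
    then show ?thesis
      using h top n n0 assms(5) alternating[of "n - 1"]
      by (auto simp: mate1_def split: if_splits)
  next
    case 2
    then show ?thesis
      using h down alternating[of "x - 1"] assms(3)
      by (auto simp: mate1_def split: if_splits)
  next
    case 3
    then show ?thesis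
      using h up n assms(3,5) alternating[of 0]
      by (auto simp: mate1_def split: if_splits)
  next
    case 4
    then show ?thesis
      using h up assms(3) alternating[of "Suc x"]
      by (auto simp: mate1_def split: if_splits)
  qed
qed

lemma rank_2: "a < b \<Longrightarrow> rank {a, b} a = 0 \<and> rank {a, b} b = 1"
proof -
  assume "a < b"
  then have "{q \<in> {a, b}. q < a} = {}" "{q \<in> {a, b}. q < b} = {a}" by auto
  then show ?thesis by (simp add: rank_def)
qed

lemma rank_4:
  assumes "a < b" "b < c" "c < d"
  shows "rank {a, b, c, d} a = 0" "rank {a, b, c, d} b = 1"
    "rank {a, b, c, d} c = 2" "rank {a, b, c, d} d = 3"
proof -
  have "{q \<in> {a, b, c, d}. q < a} = {}" "{q \<in> {a, b, c, d}. q < b} = {a}"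
    "{q \<in> {a, b, c, d}. q < c} = {a, b}" "{q \<in> {a, b, c, d}. q < d} = {a, b, c}"
    using assms by auto
  then show "rank {a, b, c, d} a = 0" "rank {a, b, c, d} b = 1"
    "rank {a, b, c, d} c = 2" "rank {a, b, c, d} d = 3"
    using assms by (simp_all add: rank_def)
qed

section \<open>Switching between two perfect matchings\<close>

context loopless_graph begin

lemma two_involutions_partners:
  "perfect_matching G M \<Longrightarrow> perfect_matching G N \<Longrightarrow>
    two_involutions V (partner M) (partner N)"
  by unfold_locales (simp_all add: finite_V partner)

text \<open>\<open>W\<close> is closed under both partner functions, so no edge of either matching
  leaves it.\<close>

lemma pm_patch:
  assumes M: "perfect_matching G M" and N: "perfect_matching G N"
    and W: "partner M ` W \<subseteq> W" "partner N ` W \<subseteq> W"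
  shows "perfect_matching G ((\<lambda>x. if x \<in> W then edge_at M x else edge_at N x) ` V)" (is "?P (?m ` V)")
    and "\<And>x. x \<in> V \<Longrightarrow> edge_at ((\<lambda>x. if x \<in> W then edge_at M x else edge_at N x) ` V) x =
      (if x \<in> W then edge_at M x else edge_at N x)"
proof -
  have 1: "?m v \<in> E" "v \<in> ends G (?m v)" if "v \<in> V" for v
    using that edge_at(2)[OF M that] edge_at(2)[OF N that] edge_at_edge[OF M that]
      edge_at_edge[OF N that] by simp_all
  have 2: "?m u = ?m v" if v: "v \<in> V" and u: "u \<in> ends G (?m v)" for v u
  proof (cases "v \<in> W")
    case True
    then have "u = v \<or> u = partner M v"
      using u partner(1)[OF M v] by auto
    then show ?thesis
      using True W(1) partner(4)[OF M v] by auto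
  next
    case False
    then have "u = v \<or> u = partner N v"
      using u partner(1)[OF N v] by auto
    moreover have "partner N v \<notin> W"
      using False W(2) partner(5)[OF N v] by force
    ultimately show ?thesis
      using False partner(4)[OF N v] by auto
  qed
  show "?P (?m ` V)"
    using pm_of_fun(1)[of ?m] 1 2 by blast
  show "\<And>x. x \<in> V \<Longrightarrow> edge_at (?m ` V) x = ?m x"
    using pm_of_fun(2)[of ?m] 1 2 by blast
qed

text \<open>\<open>K\<close> holds the positions of chord ends and \<open>s\<close> assigns their
  chords; \<open>par\<close> is the phase before the first of them, with \<open>M\<close> in use
  when it is true. By \<open>mate_switch\<close> the remaining positions stay matched among
  themselves along the cycle.\<close>

lemma hamiltonian_switch:
  assumes M: "perfect_matching G M" and N: "perfect_matching G N" and v: "v \<in> V"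
    and a: "a = alt (partner M) (partner N) v"
    and n: "0 < n" "even n" "a n = v" "inj_on a {..<n}" "partner N v = a (n - 1)"
    and V_eq: "a ` {..<n} = V"
    and K: "K \<subseteq> {..<n}" and even: "even (card K)"
    and alternating: "\<And>p. p \<in> K \<Longrightarrow> even p = (par = even (rank K p))"
    and spec: "\<And>i. i \<in> K \<Longrightarrow> s i \<in> E \<and> (\<exists>j\<in>K. ends G (s i) = {a i, a j} \<and> s j = s i)"
  obtains Q where "perfect_matching G Q"
    "\<And>i. i < n \<Longrightarrow> edge_at Q (a i) = (if i \<in> K then s i
      else if par = even (rank K i) then edge_at M (a i) else edge_at N (a i))"
proof -
  interpret two_involutions V "partner M" "partner N"
    by (rule two_involutions_partners[OF M N])
  have a0: "a 0 = v" by (simp add: a)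
  have aV: "i < n \<Longrightarrow> a i \<in> V" for i using V_eq by blast
  have nbM: "partner M (a i) = a (mate0 i)" "mate0 i < n" if "i < n" for i
  proof -
    show "partner M (a i) = a (mate0 i)"
      using alt_f[OF v, of i] by (simp add: a mate0_def del: alt.simps)
    show "mate0 i < n"
      using that n(2) by (auto simp: mate0_def) presburger
  qed
  have nbN: "partner N (a i) = a (mate1 n i)" "mate1 n i < n" if "i < n" for i
  proof -
    show "partner N (a i) = a (mate1 n i)"
    proof (cases "i = 0")
      case True
      then show ?thesis using a0 n(5) by (simp add: mate1_def)
    next
      case False
      then have "partner N (a i) = (if odd i then a (Suc i) else a (i - 1))"
        using alt_g[OF v, of i] unfolding a by blast
      then show ?thesis
        using False n(3) a0 by (auto simp: mate1_def)
    qed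
    show "mate1 n i < n"
      using that n(1) by (auto simp: mate1_def)
  qed
  define b where "b x \<longleftrightarrow> (par = even (rank K x))" for x
  have nonspec: "b i \<Longrightarrow> mate0 i \<notin> K \<and> b (mate0 i)"
      "\<not> b i \<Longrightarrow> mate1 n i \<notin> K \<and> \<not> b (mate1 n i)" if "i < n" "i \<notin> K" for i
    using mate_switch[OF n(2) that K even alternating] unfolding b_def by blast+
  define c where "c i = (if i \<in> K then s i else if b i then edge_at M (a i) else edge_at N (a i))" for i
  define m where "m x = c (inv_into {..<n} a x)" for x
  have ma: "m (a i) = c i" if "i < n" for i
    using that n(4) by (simp add: m_def)
  have c1: "c i \<in> E" "\<exists>j<n. ends G (c i) = {a i, a j} \<and> c j = c i" if i: "i < n" for i
  proof -
    show "c i \<in> E"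
      using spec[of i] edge_at_edge[OF M aV[OF i]] edge_at_edge[OF N aV[OF i]]
      by (auto simp: c_def)
    consider "i \<in> K" | "i \<notin> K" "b i" | "i \<notin> K" "\<not> b i" by blast
    then show "\<exists>j<n. ends G (c i) = {a i, a j} \<and> c j = c i"
    proof cases
      case 1
      then obtain j where "j \<in> K" "ends G (s i) = {a i, a j}" "s j = s i"
        using spec by blast
      then show ?thesis using 1 K by (intro exI[of _ j]) (auto simp: c_def)
    next
      case 2
      then show ?thesis
        using nonspec(1)[OF i 2(1)] partner(1,4)[OF M aV[OF i]] nbM[OF i]
        by (intro exI[of _ "mate0 i"]) (auto simp: c_def)
    next
      case 3
      then show ?thesis
        using nonspec(2)[OF i 3(1)] partner(1,4)[OF N aV[OF i]] nbN[OF i]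
        by (intro exI[of _ "mate1 n i"]) (auto simp: c_def)
    qed
  qed
  have m1: "m x \<in> E" "x \<in> ends G (m x)" if x: "x \<in> V" for x
  proof -
    obtain i where i: "i < n" "x = a i" using x V_eq by blast
    show "m x \<in> E" using c1(1)[OF i(1)] ma[OF i(1)] i by simp
    show "x \<in> ends G (m x)" using c1(2)[OF i(1)] ma[OF i(1)] i by auto
  qed
  have m2: "m u = m x" if x: "x \<in> V" and u: "u \<in> ends G (m x)" for x u
  proof -
    obtain i where i: "i < n" "x = a i" using x V_eq by blast
    obtain j where j: "j < n" "ends G (c i) = {a i, a j}" "c j = c i"
      using c1(2)[OF i(1)] by blast
    have "u = a i \<or> u = a j" using u ma[OF i(1)] i j by auto
    then show ?thesis using ma[OF i(1)] ma[OF j(1)] j(3) i(2) by auto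
  qed
  let ?Q = "m ` V"
  have Q: "perfect_matching G ?Q"
    by (rule pm_of_fun(1)[OF m1(1) m1(2) m2])
  show thesis
  proof (rule that[OF Q])
    fix i assume i: "i < n"
    have "edge_at ?Q (a i) = m (a i)"
      by (rule pm_of_fun(2)[OF m1(1) m1(2) m2 aV[OF i]])
    then show "edge_at ?Q (a i) = (if i \<in> K then s i
      else if par = even (rank K i) then edge_at M (a i) else edge_at N (a i))"
      unfolding ma[OF i] c_def b_def .
  qed
qed

text \<open>Two exclusive perfect matchings form a Hamiltonian cycle, and every further edge is a
  chord at even distance, since a chord at odd distance completes to a matching that reuses
  edges of the cycle. Two crossing chords of opposite parity likewise complete to such a matching
  unless the cycle has length four; a shortest chord of a third perfect matching is crossed.\<close>

lemma exclusive_pair: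
  assumes M: "perfect_matching G M" and N: "perfect_matching G N" and MN: "M \<noteq> N"
    and exclM: "\<forall>P. perfect_matching G P \<longrightarrow> P \<inter> M \<noteq> {} \<longrightarrow> P = M"
    and exclN: "\<forall>P. perfect_matching G P \<longrightarrow> P \<inter> N \<noteq> {} \<longrightarrow> P = N"
    and R: "perfect_matching G R" "R \<noteq> M" "R \<noteq> N"
    and v: "v \<in> V" and big: "card V > 2"
  obtains v1 v2 v3 e01 e12 e23 e30 where "distinct [v, v1, v2, v3]" "V = {v, v1, v2, v3}"
    "M = {e01, e23}" "N = {e12, e30}"
    "ends G e01 = {v, v1}" "ends G e12 = {v1, v2}" "ends G e23 = {v2, v3}" "ends G e30 = {v3, v}"
    "\<And>e. e \<in> E - M - N \<Longrightarrow> ends G e = {v, v2} \<or> ends G e = {v1, v3}"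
proof -
  interpret two_involutions V "partner M" "partner N"
    by (rule two_involutions_partners[OF M N])
  note exM = exclM[rule_format] and exN = exclN[rule_format]
  define a where "a = alt (partner M) (partner N) v"
  obtain n where n: "0 < n" "even n" "a n = v" "inj_on a {..<n}" "partner N v = a (n - 1)"
    "\<And>w. w \<in> a ` {..<n} \<Longrightarrow> partner M w \<in> a ` {..<n}"
    "\<And>w. w \<in> a ` {..<n} \<Longrightarrow> partner N w \<in> a ` {..<n}" "a ` {..<n} \<subseteq> V"
    using alt_cycle[OF v] unfolding a_def by blast
  have a0: "a 0 = v" by (simp add: a_def)
  \<comment> \<open>On a cycle that misses a vertex, taking \<open>M\<close> inside and
    \<open>N\<close> outside gives a perfect matching that meets both, so exclusiveness equates it
    with both.\<close>
  have V_eq: "a ` {..<n} = V"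
  proof (rule ccontr)
    let ?W = "a ` {..<n}"
    let ?Q = "(\<lambda>x. if x \<in> ?W then edge_at M x else edge_at N x) ` V"
    assume "?W \<noteq> V"
    then obtain x where x: "x \<in> V" "x \<notin> ?W" using n(8) by blast
    have "partner M ` ?W \<subseteq> ?W" "partner N ` ?W \<subseteq> ?W" using n(6,7) by blast+
    note Q = pm_patch[OF M N this]
    have vW: "v \<in> ?W" using a0 n(1) by (metis imageI lessThan_iff)
    have "edge_at ?Q v \<in> M" "edge_at ?Q x \<in> N"
      unfolding Q(2)[OF v] Q(2)[OF x(1)] using vW x edge_at(1)[OF M v] edge_at(1)[OF N x(1)]
      by simp_all
    then have "?Q = M" "?Q = N"
      using exM[OF Q(1)] exN[OF Q(1)] edge_at(1)[OF Q(1)] v x(1) by blast+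
    then show False using MN by simp
  qed
  have aV: "i < n \<Longrightarrow> a i \<in> V" for i using V_eq by blast
  have a_inj: "i < n \<Longrightarrow> j < n \<Longrightarrow> a i = a j \<longleftrightarrow> i = j" for i j
    using n(4) by (auto simp: inj_on_def)
  have nbM: "partner M (a i) = a (mate0 i)" "mate0 i < n" if "i < n" for i
  proof -
    show "partner M (a i) = a (mate0 i)"
      using alt_f[OF v, of i] by (simp add: a_def mate0_def del: alt.simps)
    show "mate0 i < n"
      using that n(2) by (auto simp: mate0_def) presburger
  qed
  have nbN: "partner N (a i) = a (mate1 n i)" "mate1 n i < n" if "i < n" for i
  proof -
    show "partner N (a i) = a (mate1 n i)"
    proof (cases "i = 0")
      case True
      then show ?thesis using a0 n(5) by (simp add: mate1_def)
    next
      case False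
      then have "partner N (a i) = (if odd i then a (Suc i) else a (i - 1))"
        using alt_g[OF v, of i] unfolding a_def by blast
      then show ?thesis
        using False n(3) a0 by (auto simp: mate1_def)
    qed
    show "mate1 n i < n"
      using that n(1) by (auto simp: mate1_def)
  qed
  \<comment> \<open>A switched matching with a chord outside \<open>M\<close> and \<open>N\<close>
    is neither of them, so it may not contain a single edge of the cycle: all positions are chord
    ends.\<close>
  have key: "{..<n} \<subseteq> K"
    if K: "K \<subseteq> {..<n}"
      and even: "even (card K)"
      and alternating: "\<And>p. p \<in> K \<Longrightarrow> even p = (par = even (rank K p))"
      and spec: "\<And>i. i \<in> K \<Longrightarrow> s i \<in> E \<and> (\<exists>j\<in>K. ends G (s i) = {a i, a j} \<and> s j = s i)"
      and z: "z \<in> K" "s z \<notin> M" "s z \<notin> N"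
    for K and par :: bool and s z
  proof (rule ccontr)
    assume "\<not> {..<n} \<subseteq> K"
    then obtain i1 where i1: "i1 < n" "i1 \<notin> K" by auto
    obtain Q where Q: "perfect_matching G Q"
      and eQ: "\<And>i. i < n \<Longrightarrow> edge_at Q (a i) = (if i \<in> K then s i
        else if par = even (rank K i) then edge_at M (a i) else edge_at N (a i))"
      using hamiltonian_switch[OF M N v a_def n(1-5) V_eq K even alternating spec] by blast
    have c_Q: "edge_at Q (a i) \<in> Q" if "i < n" for i
      by (rule edge_at(1)[OF Q aV[OF that]])
    have "edge_at Q (a i1) \<in> M \<or> edge_at Q (a i1) \<in> N"
      using eQ[OF i1(1)] i1 edge_at(1)[OF M aV[OF i1(1)]] edge_at(1)[OF N aV[OF i1(1)]] by auto
    then have "Q = M \<or> Q = N"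
      using exM[OF Q] exN[OF Q] c_Q[OF i1(1)] by blast
    moreover have "z < n" using z(1) K by auto
    then have "s z \<in> Q" using c_Q[of z] eQ[of z] z(1) by simp
    ultimately show False using z by blast
  qed
  have n3: "n > 2"
    using big V_eq card_image[OF n(4)] by simp
  have chord_even: "even i = even k"
    if e: "e \<in> E" "e \<notin> M" "e \<notin> N" "ends G e = {a i, a k}" and ik: "i < k" "k < n" for e i k
  proof (rule ccontr)
    assume odd: "even i \<noteq> even k"
    have "{..<n} \<subseteq> {i, k}"
    proof (rule key[where s = "\<lambda>_. e" and par = "even i" and z = i])
      show "even p = (even i = even (rank {i, k} p))" if "p \<in> {i, k}" for p
        using that rank_2[OF ik(1)] odd by auto
    qed (use e ik in auto)
    then have "card {..<n} \<le> card {i, k}" by (intro card_mono) auto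
    also have "\<dots> \<le> 2" by (simp add: card_insert_if)
    finally show False using n3 by simp
  qed
  have R_disj: "R \<inter> M = {}" "R \<inter> N = {}"
    using exM[OF R(1)] exN[OF R(1)] R by blast+
  define r where "r i = inv_into {..<n} a (partner R (a i))" for i
  have r: "r i < n" "a (r i) = partner R (a i)" "r i \<noteq> i" "r (r i) = i" "even (r i) = even i"
    "edge_at R (a (r i)) = edge_at R (a i)" "ends G (edge_at R (a i)) = {a i, a (r i)}"
    if i: "i < n" for i
  proof -
    have "partner R (a i) \<in> a ` {..<n}"
      using partner(3)[OF R(1) aV[OF i]] V_eq by simp
    then show 1: "r i < n" "a (r i) = partner R (a i)"
      using inv_into_into[of "partner R (a i)" a "{..<n}"] f_inv_into_f[of "partner R (a i)" a "{..<n}"]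
      by (simp_all add: r_def)
    show 2: "r i \<noteq> i" using 1 partner(2)[OF R(1) aV[OF i]] by auto
    show "r (r i) = i"
      unfolding r_def[of "r i"] 1(2) partner(5)[OF R(1) aV[OF i]] using n(4) i by simp
    show 3: "edge_at R (a (r i)) = edge_at R (a i)" "ends G (edge_at R (a i)) = {a i, a (r i)}"
      using 1 partner[OF R(1) aV[OF i]] by simp_all
    have e: "edge_at R (a i) \<in> E" "edge_at R (a i) \<notin> M" "edge_at R (a i) \<notin> N"
      using edge_at(1)[OF R(1) aV[OF i]] edge_at_edge[OF R(1) aV[OF i]] R_disj by auto
    show "even (r i) = even i"
      using chord_even[OF e 3(2) _ 1(1)] chord_even[OF e, of "r i" i] 3(2) 2 i
      by (metis insert_commute linorder_neqE_nat)
  qed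
  define D where "D = {d. \<exists>i. i < r i \<and> i < n \<and> d = r i - i}"
  have "D \<noteq> {}"
  proof -
    have "0 < r 0" "0 < n" using r(3)[of 0] n(1) by auto
    then show ?thesis unfolding D_def by blast
  qed
  then have "(LEAST d. d \<in> D) \<in> D" by (meson LeastI ex_in_conv)
  then obtain i where i: "i < r i" "i < n" "(LEAST d. d \<in> D) = r i - i"
    unfolding D_def by blast
  have i_least: "r i - i \<le> r k - k" if "k < r k" "k < n" for k
    using that i(3)[symmetric] unfolding D_def by (auto intro: Least_le)
  \<comment> \<open>The chord from \<open>i\<close> to \<open>j\<close> is a shortest one of
    \<open>R\<close>. Its ends have equal parity, so \<open>i + 1\<close> lies strictly inside, and
    the chord there has to leave the interval by minimality.\<close>
  define j l where "j = r i" and "l = r (i + 1)"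
  have j: "j < n" "i + 2 \<le> j" "even j = even i"
    using r[OF i(2)] i unfolding j_def by presburger+
  then have i1: "i + 1 < n" by simp
  have l: "l < n" "even l \<noteq> even i" "l \<noteq> i + 1" "l \<noteq> i" "l \<noteq> j"
    using r[OF i1] j unfolding l_def by auto
  have l_out: "\<not> (i + 1 < l \<and> l < j)"
    using i_least[of "i + 1"] i1 l_def j_def by auto
  let ?K = "{i, i + 1, j, l}"
  have rK: "r i = j" "r j = i" "r (i + 1) = l" "r l = i + 1"
    using r(4)[OF i(2)] r(4)[OF i1] j_def l_def by simp_all
  have sK: "edge_at R (a x) \<in> E \<and>
      (\<exists>y\<in>?K. ends G (edge_at R (a x)) = {a x, a y} \<and> edge_at R (a y) = edge_at R (a x))"
    if x: "x \<in> ?K" for x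
  proof -
    have xn: "x < n" using x i j i1 l by auto
    have "r x \<in> ?K" using x rK by auto
    then show ?thesis using r(6,7)[OF xn] edge_at_edge[OF R(1) aV[OF xn]] by blast
  qed
  have eiM: "edge_at R (a i) \<notin> M" "edge_at R (a i) \<notin> N"
    using edge_at(1)[OF R(1) aV[OF i(2)]] R_disj by auto
  have card_K: "even (card ?K)" "?K \<subseteq> {..<n}"
    using i j i1 l by auto
  \<comment> \<open>In increasing order the four ends alternate in parity either way:
    \<open>i\<close>, \<open>i + 1\<close>, \<open>j\<close>, \<open>l\<close> or \<open>l\<close>,
    \<open>i\<close>, \<open>i + 1\<close>, \<open>j\<close>. Hence \<open>key\<close> applies, and
    the two chords cover the whole cycle.\<close>
  have "{..<n} \<subseteq> ?K"
  proof (cases "l > j")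
    case True
    have *: "i < i + 1" "i + 1 < j" using j by auto
    show ?thesis
    proof (rule key[where s = "\<lambda>x. edge_at R (a x)" and par = "even i" and z = i])
      show "even p = (even i = even (rank ?K p))" if "p \<in> ?K" for p
        using that rank_4[OF * True] j(3) l(2) by auto
    qed (use sK eiM card_K in auto)
  next
    case False
    then have "l < i" using l l_out by linarith
    have *: "i < i + 1" "i + 1 < j" using j by auto
    have K: "?K = {l, i, i + 1, j}" by auto
    show ?thesis
    proof (rule key[where s = "\<lambda>x. edge_at R (a x)" and z = i and par = "even l"])
      show "even p = (even l = even (rank ?K p))" if "p \<in> ?K" for p
        unfolding K using that rank_4[OF \<open>l < i\<close> *] j(3) l(2) by auto
    qed (use sK eiM card_K in auto)
  qed
  then have "card {..<n} \<le> card ?K" by (intro card_mono) auto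
  also have "\<dots> \<le> 4" by (simp add: card_insert_if)
  finally have n4: "n = 4" using n3 n(2) by (simp, presburger)
  have set4: "{..<n} = {0, 1, 2, 3}" unfolding n4 by auto
  have V4: "V = {a 0, a 1, a 2, a 3}" using V_eq unfolding set4 by auto
  have d: "distinct [a 0, a 1, a 2, a 3]"
    using a_inj unfolding n4 by simp
  have mates: "mate0 0 = 1" "mate0 2 = 3" "mate1 4 1 = 2" "mate1 4 3 = 0"
    by (simp_all add: mate0_def mate1_def)
  have pM: "partner M (a 0) = a 1" "partner M (a 2) = a 3"
    "partner N (a 1) = a 2" "partner N (a 3) = a 0"
    using nbM(1)[of 0] nbM(1)[of 2] nbN(1)[of 1] nbN(1)[of 3]
    unfolding n4 mates by simp_all
  have V': "a 0 \<in> V" "a 1 \<in> V" "a 2 \<in> V" "a 3 \<in> V" using V4 by auto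
  have eqs: "edge_at M (a 1) = edge_at M (a 0)" "edge_at M (a 3) = edge_at M (a 2)"
    "edge_at N (a 2) = edge_at N (a 1)" "edge_at N (a 0) = edge_at N (a 3)"
    using partner(4)[OF M V'(1)] partner(4)[OF M V'(3)] partner(4)[OF N V'(2)] partner(4)[OF N V'(4)]
    unfolding pM by simp_all
  have ME: "M = {edge_at M (a 0), edge_at M (a 2)}"
    using pm_eq_image[OF M] eqs unfolding V4 by auto
  have NE: "N = {edge_at N (a 1), edge_at N (a 3)}"
    using pm_eq_image[OF N] eqs unfolding V4 by auto
  show thesis
  proof (rule that[OF d[unfolded a0] V4[unfolded a0] ME NE])
    fix e assume e: "e \<in> E - M - N"
    obtain x y where xy: "ends G e = {x, y}" "x \<noteq> y" "x \<in> V" "y \<in> V"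
      using e card_ends[of e] ends_subset[of e] by (auto simp: card_2_iff)
    then obtain x' y' where xy': "x = a x'" "y = a y'" "x' < n" "y' < n"
      using V_eq by blast
    have ne: "x' \<noteq> y'" using xy xy' by auto
    have ev: "even x' = even y'"
      using chord_even[of e x' y'] chord_even[of e y' x'] e xy xy' ne
      by (metis DiffE insert_commute linorder_neqE_nat)
    have "x' \<in> {..<n}" "y' \<in> {..<n}" using xy'(3,4) by simp_all
    then have "(x', y') \<in> {(0, 2), (2, 0), (1, 3), (3, 1)}"
      unfolding set4 using ev ne by auto
    then show "ends G e = {v, a 2} \<or> ends G e = {a 1, a 3}"
      unfolding xy(1) xy'(1,2) a0[symmetric] by (auto simp: insert_commute)
  qed (use partner(1)[OF M V'(1)] partner(1)[OF M V'(3)] partner(1)[OF N V'(2)] partner(1)[OF N V'(4)]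
      pM a0 in simp_all)
qed

end

subsection \<open>Contractions and tight cuts\<close>

text \<open>Edges keep their names, so that edges and matchings of \<open>G\<close> and of its
  quotients can be compared as sets; edges with merged ends disappear. This covers the contraction
  of a shore as well as that of several triangles at once.\<close>

definition quotient_graph :: "('v \<Rightarrow> 'w) \<Rightarrow> ('v, 'e) multigraph \<Rightarrow> ('w, 'e) multigraph" where
  "quotient_graph p G = \<lparr>verts = p ` verts G, edges = {e \<in> edges G. card (p ` ends G e) = 2},
     ends = (\<lambda>e. p ` ends G e)\<rparr>"

text \<open>The complement of X is contracted to z, which is chosen outside X.\<close>

definition side :: "('v, 'e) multigraph \<Rightarrow> 'v set \<Rightarrow> 'v \<Rightarrow> ('v, 'e) multigraph" where
  "side G X z = quotient_graph (\<lambda>v. if v \<in> X then v else z) G"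

lemma nat_mult_eq_2:
  fixes a b :: nat
  assumes "a * b = 2"
  shows "a = 1 \<and> b = 2 \<or> a = 2 \<and> b = 1"
proof -
  have "a \<le> 2"
    by (rule dvd_imp_le) (use dvd_triv_left[of a b] assms in simp_all)
  then have "a = 0 \<or> a = 1 \<or> a = 2" by linarith
  then show ?thesis using assms by auto
qed

context loopless_graph begin

lemma ends_pair:
  assumes "e \<in> E"
  obtains x y where "ends G e = {x, y}" "x \<noteq> y" "x \<in> V" "y \<in> V"
proof -
  obtain x y where "ends G e = {x, y}" "x \<noteq> y"
    using card_ends[OF assms] unfolding card_2_iff by blast
  then show thesis using that ends_subset[OF assms] by simp
qed

lemma loopless_quotient: "loopless_graph (quotient_graph p G)"
  by unfold_locales
    (use finite_loopless in \<open>auto simp: finite_loopless_def quotient_graph_def\<close>)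

lemma cut_iff: "e \<in> cut G X \<longleftrightarrow> e \<in> E \<and> ends G e \<inter> X \<noteq> {} \<and> \<not> ends G e \<subseteq> X"
proof (cases "e \<in> E")
  case True
  then obtain x y where xy: "ends G e = {x, y}" "x \<noteq> y" "x \<in> V" "y \<in> V"
    by (rule ends_pair)
  have "ends G e \<inter> X = (if x \<in> X then if y \<in> X then {x, y} else {x} else if y \<in> X then {y} else {})"
    using xy by auto
  then show ?thesis using True xy by (auto simp: cut_def split: if_splits)
qed (simp add: cut_def)

lemma cut_compl: "cut G (V - X) = cut G X"
proof (rule set_eqI)
  fix e show "e \<in> cut G (V - X) \<longleftrightarrow> e \<in> cut G X"
    unfolding cut_iff using ends_subset[of e] by auto
qed

context
  fixes X z
  assumes X: "X \<subseteq> V" and z: "z \<in> V - X"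
begin

lemma loopless_side: "loopless_graph (side G X z)"
  unfolding side_def by (rule loopless_quotient)

lemma verts_side: "verts (side G X z) = insert z X"
  using X z by (auto simp: side_def quotient_graph_def)

lemma edges_side: "edges (side G X z) = {e \<in> E. ends G e \<inter> X \<noteq> {}}"
proof -
  have "card ((\<lambda>v. if v \<in> X then v else z) ` ends G e) = 2 \<longleftrightarrow> ends G e \<inter> X \<noteq> {}" if e: "e \<in> E" for e
  proof -
    obtain x y where xy: "ends G e = {x, y}" "x \<noteq> y" "x \<in> V" "y \<in> V"
      by (rule ends_pair[OF e])
    have "x \<in> X \<Longrightarrow> x \<noteq> z" "y \<in> X \<Longrightarrow> y \<noteq> z" using z by blast+
    then show ?thesis using xy(2) unfolding xy(1) by (cases "x \<in> X"; cases "y \<in> X"; simp)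
  qed
  then show ?thesis by (auto simp: side_def quotient_graph_def)
qed

lemma mem_ends_side: "v \<in> X \<Longrightarrow> v \<in> ends (side G X z) e \<longleftrightarrow> v \<in> ends G e"
  using z by (auto simp: side_def quotient_graph_def)

lemma mem_ends_side_z: "z \<in> ends (side G X z) e \<longleftrightarrow> \<not> ends G e \<subseteq> X"
  using z by (auto simp: side_def quotient_graph_def)

lemma ends_side_inner: "ends G e \<subseteq> X \<Longrightarrow> ends (side G X z) e = ends G e"
  by (auto simp: side_def quotient_graph_def)

lemma cut_in_side: "cut G X = incident_edges (side G X z) z"
  by (auto simp: cut_iff incident_edges_def edges_side mem_ends_side_z)

lemma cut_subset_side: "cut G X \<subseteq> edges (side G X z)"
  by (auto simp: cut_iff edges_side)

lemma pm_side:
  assumes M: "perfect_matching G M" and C: "card (cut G X \<inter> M) = 1"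
  shows "perfect_matching (side G X z) (M \<inter> edges (side G X z))"
  unfolding perfect_matching_def
proof (intro conjI ballI)
  fix v assume "v \<in> verts (side G X z)"
  then consider "v \<in> X" | "v = z" by (auto simp: verts_side)
  then show "\<exists>!e. e \<in> M \<inter> edges (side G X z) \<and> v \<in> ends (side G X z) e"
  proof cases
    case 1
    then have "v \<in> V" using X by blast
    then have ex: "\<exists>!e. e \<in> M \<and> v \<in> ends G e"
      using M by (simp add: perfect_matching_def)
    have "e \<in> M \<inter> edges (side G X z) \<and> v \<in> ends (side G X z) e \<longleftrightarrow> e \<in> M \<and> v \<in> ends G e" for e
      using pm_subset[OF M] 1 by (auto simp: mem_ends_side edges_side)
    then show ?thesis using ex by simp
  next
    case 2
    obtain f where "cut G X \<inter> M = {f}" using C by (auto simp: card_1_singleton_iff)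
    then have "e \<in> M \<and> e \<in> cut G X \<longleftrightarrow> e = f" for e by (auto simp: set_eq_iff)
    then have "\<exists>!e. e \<in> M \<and> e \<in> cut G X" by simp
    then show ?thesis
      using 2 pm_subset[OF M] by (auto simp: mem_ends_side_z edges_side cut_iff)
  qed
qed simp

lemma side_pm_cut:
  assumes "perfect_matching (side G X z) N"
  obtains f where "f \<in> cut G X" "f \<in> N" "\<And>g. g \<in> cut G X \<Longrightarrow> g \<in> N \<Longrightarrow> g = f"
proof -
  have "\<exists>!e. e \<in> N \<and> z \<in> ends (side G X z) e" "N \<subseteq> edges (side G X z)"
    using assms by (auto simp: perfect_matching_def verts_side)
  then show thesis
    using that unfolding cut_in_side by (auto simp: incident_edges_def)
qed

end

text \<open>Each of the two matchings has exactly one edge in the cut, the one at its contracted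
  vertex. As both have \<open>f\<close> there, they do not collide, and each vertex of
  \<open>G\<close> sees only the matching of its own side.\<close>

lemma pm_union_sides:
  assumes X: "X \<subseteq> V" "x \<in> X" "y \<in> V - X"
    and N: "perfect_matching (side G X y) N" and L: "perfect_matching (side G (V - X) x) L"
    and f: "f \<in> cut G X" "f \<in> N" "f \<in> L"
  shows "perfect_matching G (N \<union> L)" "(N \<union> L) \<inter> edges (side G X y) = N"
    "(N \<union> L) \<inter> edges (side G (V - X) x) = L"
proof -
  have x: "x \<in> V - (V - X)" "V - X \<subseteq> V" using X by auto
  have sub: "N \<subseteq> edges (side G X y)" "L \<subseteq> edges (side G (V - X) x)"
    using N L by (auto simp: perfect_matching_def)
  have Nf: "g = f" if "g \<in> cut G X" "g \<in> N" for g
    using side_pm_cut[OF X(1,3) N] that f by metis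
  have Lf: "g = f" if "g \<in> cut G X" "g \<in> L" for g
    using side_pm_cut[OF x(2,1) L] that f unfolding cut_compl by metis
  note es = edges_side[OF X(1,3)] edges_side[OF x(2,1)]
  have NX: "e \<in> N" if "e \<in> N \<union> L" "ends G e \<inter> X \<noteq> {}" for e
  proof (cases "e \<in> N")
    case False
    then have "e \<in> L" using that by blast
    then have "e \<in> cut G X" using that sub es ends_subset[of e] by (auto simp: cut_iff)
    then show ?thesis using Lf[of e] \<open>e \<in> L\<close> f by auto
  qed
  have LX: "e \<in> L" if "e \<in> N \<union> L" "ends G e \<inter> (V - X) \<noteq> {}" for e
  proof (cases "e \<in> L")
    case False
    then have "e \<in> N" using that by blast
    then have "e \<in> cut G X" using that sub es ends_subset[of e] by (auto simp: cut_iff)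
    then show ?thesis using Nf[of e] \<open>e \<in> N\<close> f by auto
  qed
  show "(N \<union> L) \<inter> edges (side G X y) = N" "(N \<union> L) \<inter> edges (side G (V - X) x) = L"
    using NX LX sub unfolding es by blast+
  show "perfect_matching G (N \<union> L)"
    unfolding perfect_matching_def
  proof (intro conjI ballI)
    show "N \<union> L \<subseteq> E" using sub unfolding es by blast
    fix v assume v: "v \<in> V"
    show "\<exists>!e. e \<in> N \<union> L \<and> v \<in> ends G e"
    proof (cases "v \<in> X")
      case True
      then have "\<exists>!e. e \<in> N \<and> v \<in> ends (side G X y) e"
        using N verts_side[OF X(1,3)] by (simp add: perfect_matching_def)
      then have ex: "\<exists>!e. e \<in> N \<and> v \<in> ends G e"
        unfolding mem_ends_side[OF X(1,3) True] .
      have "e \<in> N \<union> L \<and> v \<in> ends G e \<longleftrightarrow> e \<in> N \<and> v \<in> ends G e" for e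
        using NX[of e] True by blast
      then show ?thesis using ex by simp
    next
      case False
      then have "v \<in> V - X" using v by blast
      then have "\<exists>!e. e \<in> L \<and> v \<in> ends (side G (V - X) x) e"
        using L verts_side[OF x(2,1)] by (simp add: perfect_matching_def)
      then have ex: "\<exists>!e. e \<in> L \<and> v \<in> ends G e"
        unfolding mem_ends_side[OF x(2,1) \<open>v \<in> V - X\<close>] .
      have "e \<in> N \<union> L \<and> v \<in> ends G e \<longleftrightarrow> e \<in> L \<and> v \<in> ends G e" for e
        using LX[of e] \<open>v \<in> V - X\<close> by blast
      then show ?thesis using ex by simp
    qed
  qed
qed

definition tight :: "'v set \<Rightarrow> bool" where
  "tight X \<longleftrightarrow> (\<forall>M. perfect_matching G M \<longrightarrow> card (cut G X \<inter> M) = 1)"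

lemma tight_compl: "tight (V - X) = tight X"
  by (simp add: tight_def cut_compl)

definition through :: "'v set \<Rightarrow> 'v \<Rightarrow> 'e \<Rightarrow> 'e set set" where
  "through X z f = {N. perfect_matching (side G X z) N \<and> f \<in> N}"

text \<open>Restricting to the two contractions and forming unions are inverse to each other;
  tightness ensures that the restrictions are perfect matchings.\<close>

lemma card_through_product:
  assumes X: "X \<subseteq> V" "x \<in> X" "y \<in> V - X" and t: "tight X" and f: "f \<in> cut G X"
  shows "card {M. perfect_matching G M \<and> f \<in> M} = card (through X y f) * card (through (V - X) x f)"
proof -
  let ?EX = "edges (side G X y)" and ?EY = "edges (side G (V - X) x)"
  have x: "x \<in> V - (V - X)" "V - X \<subseteq> V" using X by auto
  have fe: "f \<in> ?EX" "f \<in> ?EY"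
    using f cut_subset_side[OF X(1,3)] cut_subset_side[OF x(2,1)] by (auto simp: cut_compl)
  have E: "?EX \<union> ?EY = E"
  proof -
    have "ends G e \<inter> X \<noteq> {} \<or> ends G e \<inter> (V - X) \<noteq> {}" if "e \<in> E" for e
    proof -
      have "ends G e \<noteq> {}" using card_ends[OF that] by auto
      then show ?thesis using ends_subset[OF that] by blast
    qed
    then show ?thesis
      unfolding edges_side[OF X(1,3)] edges_side[OF x(2,1)] by blast
  qed
  have "bij_betw (\<lambda>M. (M \<inter> ?EX, M \<inter> ?EY)) {M. perfect_matching G M \<and> f \<in> M}
    (through X y f \<times> through (V - X) x f)"
  proof (rule bij_betw_byWitness[where f' = "\<lambda>(N, L). N \<union> L"])
    show "\<forall>M\<in>{M. perfect_matching G M \<and> f \<in> M}. (case (M \<inter> ?EX, M \<inter> ?EY) of (N, L) \<Rightarrow> N \<union> L) = M"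
      using E pm_subset by auto
    show "\<forall>NL\<in>through X y f \<times> through (V - X) x f.
        (((case NL of (N, L) \<Rightarrow> N \<union> L) \<inter> ?EX), ((case NL of (N, L) \<Rightarrow> N \<union> L) \<inter> ?EY)) = NL"
      using pm_union_sides(2,3)[OF X _ _ f] by (auto simp: through_def)
    show "(\<lambda>M. (M \<inter> ?EX, M \<inter> ?EY)) ` {M. perfect_matching G M \<and> f \<in> M}
        \<subseteq> through X y f \<times> through (V - X) x f"
      using pm_side[OF X(1,3)] pm_side[OF x(2,1)] t fe
      by (auto simp: through_def tight_def cut_compl)
    show "(\<lambda>(N, L). N \<union> L) ` (through X y f \<times> through (V - X) x f)
        \<subseteq> {M. perfect_matching G M \<and> f \<in> M}"
      using pm_union_sides(1)[OF X _ _ f] by (auto simp: through_def)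
  qed
  from bij_betw_same_card[OF this] show ?thesis
    by (simp only: card_cartesian_product)
qed

end

section \<open>Double covered graphs and the contractions of a tight cut\<close>

locale double_covered_graph = loopless_graph +
  assumes double: "e \<in> E \<Longrightarrow> card {M. perfect_matching G M \<and> e \<in> M} = 2"
begin

lemma three_pms:
  assumes "e \<in> E" "perfect_matching G A" "perfect_matching G B" "perfect_matching G D"
    "e \<in> A" "e \<in> B" "e \<in> D"
  shows "A = B \<or> A = D \<or> B = D"
proof (rule ccontr)
  assume *: "\<not> (A = B \<or> A = D \<or> B = D)"
  have "card {A, B, D} \<le> card {M. perfect_matching G M \<and> e \<in> M}"
    by (rule card_mono) (use assms finite_PM_sub in auto)
  then show False using double[OF assms(1)] * by simp
qed

lemma pm_through:
  assumes "e \<in> E"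
  obtains A B where "A \<noteq> B" "perfect_matching G A" "perfect_matching G B" "e \<in> A" "e \<in> B"
proof -
  obtain A B where "{M. perfect_matching G M \<and> e \<in> M} = {A, B}" "A \<noteq> B"
    using double[OF assms] by (auto simp: card_2_iff)
  then show thesis using that by blast
qed

context
  fixes X x y
  assumes X: "X \<subseteq> V" "x \<in> X" "y \<in> V - X" and t: "tight X"
begin

lemma through_cases:
  assumes f: "f \<in> cut G X"
  shows "card (through X y f) = 1 \<and> card (through (V - X) x f) = 2 \<or>
    card (through X y f) = 2 \<and> card (through (V - X) x f) = 1"
proof -
  have "card (through X y f) * card (through (V - X) x f) = 2"
    using card_through_product[OF X t f] double[of f] f by (simp add: cut_def)
  then show ?thesis by (rule nat_mult_eq_2)
qed

text \<open>Through the other contraction, \<open>N\<close> extends by \<open>A\<close> and by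
  \<open>B\<close> to two perfect matchings of \<open>G\<close>, which are all that its edges can
  have. A matching \<open>P\<close> sharing an edge with \<open>N\<close> extends as well, and this
  would be a third one at that edge.\<close>

lemma exclusive_side:
  assumes f: "f \<in> cut G X" "through X y f = {N}" and P: "perfect_matching (side G X y) P" "P \<inter> N \<noteq> {}"
  shows "P = N"
proof (rule ccontr)
  assume PN: "P \<noteq> N"
  obtain e where e: "e \<in> P" "e \<in> N" using P by blast
  have N: "perfect_matching (side G X y) N" "f \<in> N" using f by (auto simp: through_def)
  have eE: "e \<in> E" using e P(1) edges_side[OF X(1,3)] by (auto simp: perfect_matching_def)
  have "card (through (V - X) x f) = 2" using through_cases[OF f(1)] f(2) by auto
  then obtain A B where AB: "through (V - X) x f = {A, B}" "A \<noteq> B" by (auto simp: card_2_iff)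
  then have A: "perfect_matching (side G (V - X) x) A" "f \<in> A"
    and B: "perfect_matching (side G (V - X) x) B" "f \<in> B"
    by (auto simp: through_def set_eq_iff)
  obtain g where g: "g \<in> cut G X" "g \<in> P"
    using side_pm_cut[OF X(1,3) P(1)] by blast
  have "card (through (V - X) x g) > 0" using through_cases[OF g(1)] by auto
  then obtain D where D: "perfect_matching (side G (V - X) x) D" "g \<in> D"
    by (auto simp: card_gt_0_iff through_def)
  note 1 = pm_union_sides[OF X N(1) A(1) f(1) N(2) A(2)]
  note 2 = pm_union_sides[OF X N(1) B(1) f(1) N(2) B(2)]
  note 3 = pm_union_sides[OF X P(1) D(1) g D(2)]
  have "N \<union> A = N \<union> B \<or> N \<union> A = P \<union> D \<or> N \<union> B = P \<union> D"
    by (rule three_pms[OF eE 1(1) 2(1) 3(1)]) (use e in auto)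
  then show False using 1(2,3) 2(2,3) 3(2) AB(2) PN by metis
qed

end

end

context double_covered_graph begin

lemma card_PM_incident: "v \<in> V \<Longrightarrow> card PM = 2 * card (incident_edges G v)"
  by (rule card_PM_degree[OF double])

lemma card_PM_cut:
  assumes "tight X"
  shows "card PM = 2 * card (cut G X)"
proof (rule card_PM_of_transversal)
  show "cut G X \<subseteq> E" by (auto simp: cut_def)
  show "\<exists>!e. e \<in> M \<and> e \<in> cut G X" if "perfect_matching G M" for M
  proof -
    have "card (cut G X \<inter> M) = 1"
      using assms that by (simp add: tight_def)
    then obtain f where "cut G X \<inter> M = {f}"
      by (rule card_1_singletonE)
    then have "e \<in> M \<and> e \<in> cut G X \<longleftrightarrow> e = f" for e by (auto simp: set_eq_iff)
    then show ?thesis by simp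
  qed
qed (use double in \<open>auto simp: cut_def\<close>)

lemma card_cut_incident: "tight X \<Longrightarrow> v \<in> V \<Longrightarrow> card (cut G X) = card (incident_edges G v)"
  using card_PM_cut[of X] card_PM_incident[of v] by simp

text \<open>The contraction contains the four-cycle \<open>y\<close>, \<open>v1\<close>,
  \<open>v2\<close>, \<open>v3\<close> given by \<open>exclusive_pair\<close>, with \<open>f\<close>
  and \<open>f'\<close> as its edges at \<open>y\<close>. The other cut edges become diagonals from
  \<open>y\<close> to \<open>v2\<close>, so the degree of \<open>v1\<close> is made up by edges to
  \<open>v3\<close>, and each of these completes each of those diagonals.\<close>

lemma side_shape:
  assumes X: "X \<subseteq> V" "x \<in> X" "y \<in> V - X" and t: "tight X"
    and big: "card X > 1" "card (cut G X) > 2"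
    and f: "f \<in> cut G X" "card (through X y f) = 1"
    and f': "f' \<in> cut G X" "card (through X y f') = 1" and ff': "f \<noteq> f'"
  obtains v1 v2 v3 e12 e23 where "distinct [v1, v2, v3]" "X = {v1, v2, v3}"
    "v1 \<in> ends G f" "v3 \<in> ends G f'" "e12 \<in> E" "ends G e12 = {v1, v2}"
    "e23 \<in> E" "ends G e23 = {v2, v3}"
    "{e \<in> E. ends G e \<subseteq> X} = {e12, e23} \<union> {e \<in> E. ends G e = {v1, v3}}"
    "card {e \<in> E. ends G e = {v1, v3}} = card (cut G X) - 2"
    "\<And>g. g \<in> cut G X - {f, f'} \<Longrightarrow> v2 \<in> ends G g"
    "\<And>g. g \<in> cut G X - {f, f'} \<Longrightarrow> card (through X y g) = card (cut G X) - 2"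
proof -
  let ?S = "side G X y"
  interpret S: loopless_graph ?S by (rule loopless_side[OF X(1,3)])
  have yX: "y \<notin> X" using X by blast
  obtain M where M: "through X y f = {M}" using f(2) by (auto simp: card_1_singleton_iff)
  obtain N where N: "through X y f' = {N}" using f'(2) by (auto simp: card_1_singleton_iff)
  have M': "perfect_matching ?S M" "f \<in> M" and N': "perfect_matching ?S N" "f' \<in> N"
    using M N by (auto simp: through_def)
  have "cut G X - {f, f'} \<noteq> {}"
  proof
    assume "cut G X - {f, f'} = {}"
    then have "card (cut G X) \<le> card {f, f'}" by (intro card_mono) auto
    then show False using big(2) by (simp add: card_insert_if split: if_splits)
  qed
  then obtain g where g: "g \<in> cut G X" "g \<noteq> f" "g \<noteq> f'" by blast
  have "card (through X y g) > 0" using through_cases[OF X t g(1)] by auto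
  then obtain R where R: "perfect_matching ?S R" "g \<in> R"
    by (auto simp: card_gt_0_iff through_def)
  have one: "a = b" if "perfect_matching ?S P" "a \<in> P" "b \<in> P" "a \<in> cut G X" "b \<in> cut G X" for P a b
    using side_pm_cut[OF X(1,3) that(1)] that(2-) by metis
  have neq: "M \<noteq> N" "R \<noteq> M" "R \<noteq> N"
    using one[OF M'(1,2)] one[OF N'(1,2)] M' N' R g f f' ff' by blast+
  note vS = verts_side[OF X(1,3)] and eS = edges_side[OF X(1,3)]
  have cS: "card (verts ?S) > 2"
    unfolding vS using big(1) yX finite_subset[OF X(1) finite_V] by simp
  have yS: "y \<in> verts ?S" unfolding vS by simp
  have exM: "\<forall>P. perfect_matching ?S P \<longrightarrow> P \<inter> M \<noteq> {} \<longrightarrow> P = M"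
    using exclusive_side[OF X t f(1) M] by blast
  have exN: "\<forall>P. perfect_matching ?S P \<longrightarrow> P \<inter> N \<noteq> {} \<longrightarrow> P = N"
    using exclusive_side[OF X t f'(1) N] by blast
  obtain v1 v2 v3 e01 e12 e23 e30 where w: "distinct [y, v1, v2, v3]" "verts ?S = {y, v1, v2, v3}"
    "M = {e01, e23}" "N = {e12, e30}"
    "ends ?S e01 = {y, v1}" "ends ?S e12 = {v1, v2}" "ends ?S e23 = {v2, v3}" "ends ?S e30 = {v3, y}"
    and rest: "\<And>e. e \<in> edges ?S - M - N \<Longrightarrow> ends ?S e = {y, v2} \<or> ends ?S e = {v1, v3}"
    by (rule S.exclusive_pair[OF M'(1) N'(1) neq(1) exM exN R(1) neq(2,3) yS cS], rule that)
  have dist: "distinct [v1, v2, v3]" "y \<noteq> v1" "y \<noteq> v2" "y \<noteq> v3" using w(1) by auto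
  have "X = insert y X - {y}" using yX by simp
  also have "\<dots> = {v1, v2, v3}" using w(2) dist(2-) unfolding vS by simp
  finally have Xv: "X = {v1, v2, v3}" .
  note zS = mem_ends_side_z[OF X(1,3)] and mS = mem_ends_side[OF X(1,3)]
  have C: "e \<in> cut G X \<longleftrightarrow> e \<in> edges ?S \<and> y \<in> ends ?S e" for e
    unfolding cut_in_side[OF X(1,3)] by (simp add: incident_edges_def)
  have "y \<in> ends ?S f" "y \<in> ends ?S f'" using f f' C by auto
  then have "f \<noteq> e23" "f' \<noteq> e12" using w dist by auto
  then have fe: "f = e01" "f' = e30" using M' N' w(3,4) by auto
  have eE: "e12 \<in> edges ?S" "e23 \<in> edges ?S"
    using S.pm_subset[OF M'(1)] S.pm_subset[OF N'(1)] w(3,4) by auto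
  have inner: "ends G e = ends ?S e" if "y \<notin> ends ?S e" for e
    using that zS ends_side_inner[OF X(1,3)] by blast
  have e12: "ends G e12 = {v1, v2}" using inner[of e12] w(6) dist by simp
  have e23: "ends G e23 = {v2, v3}" using inner[of e23] w(7) dist by simp
  have EE: "e12 \<in> E" "e23 \<in> E" using eE eS by auto
  let ?D = "{e \<in> E. ends G e = {v1, v3}}"
  have D_S: "d \<in> edges ?S" "ends ?S d = {v1, v3}" if "d \<in> ?D" for d
  proof -
    have "ends G d \<subseteq> X" using that Xv by auto
    then show "ends ?S d = {v1, v3}" using ends_side_inner[OF X(1,3), of d] that by simp
    have "v1 \<in> X" using Xv by simp
    then show "d \<in> edges ?S" using that unfolding eS by auto
  qed
  have rest': "g \<in> cut G X \<and> ends ?S g = {y, v2} \<or> g \<in> ?D"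
    if "g \<in> edges ?S" "g \<notin> {f, f', e12, e23}" for g
  proof -
    have "g \<in> edges ?S - M - N" using that fe w(3,4) by auto
    from rest[OF this] show ?thesis
    proof
      assume "ends ?S g = {y, v2}"
      then show ?thesis using C that(1) by auto
    next
      assume "ends ?S g = {v1, v3}"
      then show ?thesis using inner[of g] dist that(1) eS by auto
    qed
  qed
  have cutD: "ends ?S g = {y, v2}" if "g \<in> cut G X - {f, f'}" for g
  proof -
    have "g \<in> edges ?S" "y \<in> ends ?S g" using that C by auto
    moreover have "y \<notin> ends ?S e12" "y \<notin> ends ?S e23" using w dist by auto
    moreover have "g \<notin> ?D" using D_S(2)[of g] dist calculation(2) by auto
    ultimately show ?thesis using rest'[of g] that by auto
  qed
  \<comment> \<open>\<open>v1\<close> has two edges of the cycle and the diagonals to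
    \<open>v3\<close>; its degree equals the size of the cut, which gives the number of these
    diagonals.\<close>
  have inc: "incident_edges G v1 = {f, e12} \<union> ?D"
  proof
    show "incident_edges G v1 \<subseteq> {f, e12} \<union> ?D"
    proof
      fix e assume e: "e \<in> incident_edges G v1"
      then have e1: "e \<in> edges ?S" "v1 \<in> ends ?S e"
        using mS[of v1 e] Xv unfolding eS by (auto simp: incident_edges_def)
      have "e \<noteq> f'" "e \<noteq> e23" using e1 w dist fe by auto
      then show "e \<in> {f, e12} \<union> ?D" using rest'[OF e1(1)] e1(2) dist by auto
    qed
    have "v1 \<in> ends G f" using w(5) fe mS[of v1 f] Xv by auto
    then show "{f, e12} \<union> ?D \<subseteq> incident_edges G v1"
      using e12 EE f(1) by (auto simp: incident_edges_def cut_def)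
  qed
  have finD: "finite ?D" by (rule finite_subset[OF _ finite_E]) auto
  have "f \<noteq> e12" using \<open>y \<in> ends ?S f\<close> w dist by auto
  moreover have "f \<notin> ?D" "e12 \<notin> ?D"
    using D_S(2)[of f] \<open>y \<in> ends ?S f\<close> dist e12 by (auto simp: doubleton_eq_iff)
  ultimately have "card (incident_edges G v1) = card ?D + 2"
    unfolding inc using finD by simp
  moreover have "card (cut G X) = card (incident_edges G v1)"
    by (rule card_cut_incident[OF t]) (use Xv X in auto)
  ultimately have cardD: "card ?D = card (cut G X) - 2" by simp
  have thr: "card (through X y g) = card ?D" if g: "g \<in> cut G X - {f, f'}" for g
  proof -
    have gy: "ends ?S g = {y, v2}" by (rule cutD[OF g])
    have gS: "g \<in> edges ?S" using C g by auto
    have gD: "g \<notin> ?D" using D_S(2)[of g] gy dist by auto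
    \<comment> \<open>A matching through \<open>g\<close> covers \<open>y\<close> and
      \<open>v2\<close> by it, so what remains is one edge between \<open>v1\<close> and
      \<open>v3\<close>, chosen freely.\<close>
    have "through X y g = (\<lambda>d. {g, d}) ` ?D"
    proof (intro equalityI subsetI)
      fix P assume "P \<in> through X y g"
      then have P: "perfect_matching ?S P" "g \<in> P" by (auto simp: through_def)
      have v1S: "v1 \<in> verts ?S" using w(2) by simp
      let ?d = "S.edge_at P v1"
      have d: "?d \<in> P" "v1 \<in> ends ?S ?d" by (rule S.edge_at[OF P(1) v1S])+
      have dS: "?d \<in> edges ?S" by (rule S.edge_at_edge[OF P(1) v1S])
      have "?d \<noteq> g" using d gy dist by auto
      have "?d \<noteq> f" using one[OF P(1) d(1) P(2)] g f by auto
      moreover have "?d \<noteq> e12"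
      proof
        assume de: "?d = e12"
        then have "e12 \<in> P" using d(1) by simp
        then have "S.edge_at P v2 = e12"
          by (rule S.edge_at_eqI[OF P(1)]) (simp add: w(6))
        moreover have "S.edge_at P v2 = g"
          by (rule S.edge_at_eqI[OF P(1,2)]) (simp add: gy)
        ultimately show False using de \<open>?d \<noteq> g\<close> by simp
      qed
      moreover have "?d \<noteq> f'" "?d \<noteq> e23" using d w dist fe by auto
      ultimately have dD: "?d \<in> ?D" using rest'[OF dS] d(2) dist by auto
      have "P = {g, ?d}"
      proof (intro equalityI subsetI)
        fix e assume e: "e \<in> P"
        then have "ends ?S e \<noteq> {}" "ends ?S e \<subseteq> {y, v1, v2, v3}"
          using S.card_ends[of e] S.ends_subset[of e] S.pm_subset[OF P(1)] w(2) by auto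
        then obtain v where v: "v \<in> ends ?S e" "v \<in> {y, v1, v2, v3}" by blast
        then have "v \<in> ends ?S g \<or> v \<in> ends ?S ?d" using gy D_S(2)[OF dD] by auto
        then have "S.edge_at P v = g \<or> S.edge_at P v = ?d"
          using S.edge_at_eqI[OF P(1) P(2), of v] S.edge_at_eqI[OF P(1) d(1), of v] by blast
        moreover have "S.edge_at P v = e" by (rule S.edge_at_eqI[OF P(1) e v(1)])
        ultimately show "e \<in> {g, ?d}" by auto
      qed (use P d in auto)
      then show "P \<in> (\<lambda>d. {g, d}) ` ?D" using dD by blast
    next
      fix P assume "P \<in> (\<lambda>d. {g, d}) ` ?D"
      then obtain d where d: "d \<in> ?D" "P = {g, d}" by blast
      have "perfect_matching ?S P"
        unfolding perfect_matching_def d(2) w(2)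
      proof (intro conjI ballI)
        show "{g, d} \<subseteq> edges ?S" using gS D_S(1)[OF d(1)] by simp
        fix v assume v: "v \<in> {y, v1, v2, v3}"
        have "v \<in> {y, v2} \<and> v \<notin> {v1, v3} \<or> v \<notin> {y, v2} \<and> v \<in> {v1, v3}" using v w(1) by auto
        then show "\<exists>!e. e \<in> {g, d} \<and> v \<in> ends ?S e"
          using gy D_S(2)[OF d(1)] by auto
      qed
      then show "P \<in> through X y g" using d by (simp add: through_def)
    qed
    moreover have "inj_on (\<lambda>d. {g, d}) ?D"
      using gD by (auto simp: inj_on_def doubleton_eq_iff)
    ultimately show ?thesis by (simp add: card_image)
  qed
  have innerE: "{e \<in> E. ends G e \<subseteq> X} = {e12, e23} \<union> ?D"
  proof (intro equalityI subsetI)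
    fix e assume e: "e \<in> {e \<in> E. ends G e \<subseteq> X}"
    then have "ends G e \<noteq> {}" using card_ends[of e] by auto
    then have eS': "e \<in> edges ?S" using e unfolding eS by blast
    have nc: "e \<notin> cut G X" using e by (auto simp: cut_iff)
    then have "e \<noteq> f" "e \<noteq> f'" using f f' by auto
    then show "e \<in> {e12, e23} \<union> ?D" using rest'[OF eS'] nc by auto
  next
    fix e assume "e \<in> {e12, e23} \<union> ?D"
    then show "e \<in> {e \<in> E. ends G e \<subseteq> X}" using EE e12 e23 Xv by auto
  qed
  have vf: "v1 \<in> ends G f" "v3 \<in> ends G f'"
    using w(5,8) fe mS[of v1 f] mS[of v3 f'] Xv by auto
  have "v2 \<in> ends G g" if "g \<in> cut G X - {f, f'}" for g
    using cutD[OF that] mS[of v2 g] Xv by auto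
  then show thesis
    by (rule that[OF dist(1) Xv vf EE(1) e12 EE(2) e23 innerE cardD _ thr[unfolded cardD]])
qed

end

subsection \<open>Presentations by incidence lists\<close>

text \<open>An isomorphism type with all names removed: positions stand for vertices, and parallel
  edges are repeated entries of \<open>ds\<close>. Two graphs presented by the same list on equally
  many vertices are isomorphic, and counting matchings becomes a computation on numbers.\<close>

definition presents :: "('v, 'e) multigraph \<Rightarrow> 'v list \<Rightarrow> 'e list \<Rightarrow> (nat \<times> nat) list \<Rightarrow> bool" where
  "presents G ws es ds \<longleftrightarrow> distinct ws \<and> set ws = verts G \<and> distinct es \<and> set es = edges G \<and>
     list_all2 (\<lambda>e (i, j). i < length ws \<and> j < length ws \<and> ends G e = {ws ! i, ws ! j}) es ds"

lemma presents_nth: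
  assumes "presents G ws es ds" "k < length ds"
  shows "fst (ds ! k) < length ws" "snd (ds ! k) < length ws"
    "ends G (es ! k) = {ws ! fst (ds ! k), ws ! snd (ds ! k)}"
  using assms unfolding presents_def by (auto simp: list_all2_conv_all_nth case_prod_beta)

lemma presents_isomorphic:
  assumes G: "presents G ws es ds" and H: "presents H ws' es' ds" and len: "length ws = length ws'"
  shows "isomorphic G H"
proof -
  define f where "f v = ws' ! inv_into {..<length ws} ((!) ws) v" for v
  define g where "g e = es' ! inv_into {..<length es} ((!) es) e" for e
  have le: "length es = length ds" "length es' = length ds"
    using G H by (auto simp: presents_def dest: list_all2_lengthD)
  have bij: "bij_betw (\<lambda>v. ys ! inv_into {..<length xs} ((!) xs) v) (set xs) (set ys)"
    if "distinct xs" "distinct ys" "length xs = length ys" for xs :: "'x list" and ys :: "'y list"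
  proof -
    have "bij_betw ((!) xs) {..<length xs} (set xs)"
      by (rule bij_betw_nth[OF that(1) refl refl])
    from bij_betw_trans[OF bij_betw_inv_into[OF this], of "(!) ys" "set ys"]
    show ?thesis using bij_betw_nth[OF that(2), of "{..<length xs}" "set ys"] that(3)
      by (simp add: comp_def)
  qed
  have nth: "inv_into {..<length xs} ((!) xs) (xs ! i) = i" if "distinct xs" "i < length xs"
    for xs :: "'x list" and i
    using that inj_on_nth[of xs "{..<length xs}"] by (intro inv_into_f_f) auto
  have "bij_betw f (verts G) (verts H)" "bij_betw g (edges G) (edges H)"
    using bij[of ws ws'] bij[of es es'] G H len le unfolding presents_def f_def g_def by simp_all
  moreover have "ends H (g e) = f ` ends G e" if "e \<in> edges G" for e
  proof -
    have "e \<in> set es" using G that by (simp add: presents_def)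
    then obtain k where k: "k < length es" "e = es ! k" by (auto simp: in_set_conv_nth)
    have "g e = es' ! k"
      using G k nth[of es k] by (simp add: g_def presents_def)
    moreover have "f (ws ! i) = ws' ! i" if "i < length ws" for i
      using G that nth[of ws i] by (simp add: f_def presents_def)
    ultimately show ?thesis
      using presents_nth[OF G, of k] presents_nth[OF H, of k] k le by simp
  qed
  ultimately show ?thesis unfolding isomorphic_def by blast
qed

text \<open>With the presentation pulled back, the computed counts apply to \<open>G\<close> itself,
  instead of matchings being transported along the isomorphism.\<close>

lemma presents_pullback:
  assumes "isomorphic G H" and fl: "finite_loopless G" and H: "presents H ws es ds"
  obtains ws' es' where "presents G ws' es' ds" "length ws' = length ws"
proof -
  obtain f g where f: "bij_betw f (verts G) (verts H)" and g: "bij_betw g (edges G) (edges H)"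
    and fg: "\<And>e. e \<in> edges G \<Longrightarrow> ends H (g e) = f ` ends G e"
    using assms(1) unfolding isomorphic_def by blast
  define f' g' where "f' = inv_into (verts G) f" and "g' = inv_into (edges G) g"
  have f': "bij_betw f' (verts H) (verts G)" and g': "bij_betw g' (edges H) (edges G)"
    using f g by (simp_all add: f'_def g'_def bij_betw_inv_into)
  have ends: "ends G (g' e) = f' ` ends H e" if "e \<in> edges H" for e
  proof -
    have e: "g' e \<in> edges G" "g (g' e) = e"
      using that g' g by (auto simp: bij_betw_def g'_def f_inv_into_f)
    have sub: "ends G (g' e) \<subseteq> verts G" using fl e by (auto simp: finite_loopless_def)
    have "f' ` ends H e = f' ` f ` ends G (g' e)" using fg[OF e(1)] e(2) by simp
    also have "\<dots> = ends G (g' e)"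
      unfolding f'_def by (rule inv_into_image_cancel) (use f sub in \<open>auto simp: bij_betw_def\<close>)
    finally show ?thesis by simp
  qed
  have "presents G (map f' ws) (map g' es) ds"
    unfolding presents_def
  proof (intro conjI)
    show "distinct (map f' ws)" "set (map f' ws) = verts G" "distinct (map g' es)"
      "set (map g' es) = edges G"
      using H f' g' by (auto simp: presents_def distinct_map bij_betw_def)
    have es: "set es = edges H" "length es = length ds"
      using H by (auto simp: presents_def dest: list_all2_lengthD)
    show "list_all2 (\<lambda>e (i, j). i < length (map f' ws) \<and> j < length (map f' ws) \<and>
        ends G e = {map f' ws ! i, map f' ws ! j}) (map g' es) ds"
      unfolding list_all2_conv_all_nth
    proof (intro conjI allI impI)
      fix k assume k: "k < length (map g' es)"
      then have e: "es ! k \<in> edges H" unfolding es(1)[symmetric] by simp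
      have k': "k < length ds" using k es by simp
      show "case ds ! k of (i, j) \<Rightarrow> i < length (map f' ws) \<and> j < length (map f' ws) \<and>
          ends G (map g' es ! k) = {map f' ws ! i, map f' ws ! j}"
        using presents_nth[OF H k'] ends[OF e] k by (simp add: case_prod_beta)
    qed (use es in simp)
  qed
  then show thesis by (rule that) simp
qed

text \<open>Perfect matchings as sets of edge positions: match the first uncovered vertex in all
  possible ways and recurse.\<close>

fun incident_pair :: "nat \<Rightarrow> nat \<times> nat \<Rightarrow> bool" where
  "incident_pair v (i, j) \<longleftrightarrow> v = i \<or> v = j"

function pm_lists :: "(nat \<times> nat) list \<Rightarrow> nat list \<Rightarrow> nat list list" where
  "pm_lists ds [] = [[]]"
| "pm_lists ds (v # ws) = concat (map (\<lambda>k. map (Cons k)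
     (pm_lists ds (filter (\<lambda>w. \<not> incident_pair w (ds ! k)) ws)))
     (filter (\<lambda>k. incident_pair v (ds ! k) \<and> fst (ds ! k) \<in> set (v # ws) \<and> snd (ds ! k) \<in> set (v # ws))
       [0..<length ds]))"
  by pat_completeness auto
termination
  by (relation "measure (\<lambda>(ds, ws). length ws)") (auto simp: less_Suc_eq_le)

definition index_matching :: "(nat \<times> nat) list \<Rightarrow> nat set \<Rightarrow> nat set \<Rightarrow> bool" where
  "index_matching ds U I \<longleftrightarrow> I \<subseteq> {..<length ds} \<and>
     (\<forall>k\<in>I. fst (ds ! k) \<in> U \<and> snd (ds ! k) \<in> U) \<and> (\<forall>v\<in>U. \<exists>!k. k \<in> I \<and> incident_pair v (ds ! k))"

lemma incident_pair_iff: "incident_pair v p \<longleftrightarrow> v = fst p \<or> v = snd p"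
  by (cases p) simp

lemma pm_lists_matching:
  "distinct ws \<Longrightarrow> {I. index_matching ds (set ws) I} = set ` set (pm_lists ds ws)"
proof (induction ds ws rule: pm_lists.induct)
  case (1 ds)
  then show ?case by (auto simp: index_matching_def)
next
  case (2 ds v ws)
  let ?U = "set (v # ws)"
  let ?rest = "\<lambda>k. filter (\<lambda>w. \<not> incident_pair w (ds ! k)) ws"
  let ?ks = "filter (\<lambda>k. incident_pair v (ds ! k) \<and> fst (ds ! k) \<in> ?U \<and> snd (ds ! k) \<in> ?U) [0..<length ds]"
  have IH: "{I. index_matching ds (set (?rest k)) I} = set ` set (pm_lists ds (?rest k))" if "k \<in> set ?ks" for k
    by (rule "2.IH"[OF that]) (use "2.prems" in simp)
  \<comment> \<open>The edge \<open>k\<close> that covers \<open>v\<close> is unique, and removing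
    it leaves a matching of the vertices that \<open>k\<close> does not cover.\<close>
  have step: "index_matching ds ?U I \<longleftrightarrow>
    (\<exists>k\<in>set ?ks. \<exists>J. index_matching ds (set (?rest k)) J \<and> I = insert k J)" for I
  proof
    assume I: "index_matching ds ?U I"
    then obtain k where k: "k \<in> I" "incident_pair v (ds ! k)" by (auto simp: index_matching_def)
    have uniq: "k' = k''" if "k' \<in> I" "k'' \<in> I" "w \<in> ?U" "incident_pair w (ds ! k')" "incident_pair w (ds ! k'')" for k' k'' w
      using I that unfolding index_matching_def by blast
    have kk: "k \<in> set ?ks" using I k by (auto simp: index_matching_def)
    have inU: "fst (ds ! k') \<in> ?U" "snd (ds ! k') \<in> ?U" if "k' \<in> I" for k'
      using I that by (auto simp: index_matching_def)
    have "index_matching ds (set (?rest k)) (I - {k})"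
      unfolding index_matching_def
    proof (intro conjI ballI)
      show "I - {k} \<subseteq> {..<length ds}" using I by (auto simp: index_matching_def)
    next
      fix k' assume k': "k' \<in> I - {k}"
      have "\<not> incident_pair w (ds ! k) \<and> w \<in> set ws" if w: "incident_pair w (ds ! k')" for w
      proof -
        have wU: "w \<in> ?U" using w inU[of k'] k' by (auto simp: incident_pair_iff)
        have "\<not> incident_pair w (ds ! k)" using uniq[of k' k w] w wU k' k by blast
        moreover have "w \<noteq> v" using calculation k(2) by auto
        ultimately show ?thesis using wU by auto
      qed
      then show "fst (ds ! k') \<in> set (?rest k)" "snd (ds ! k') \<in> set (?rest k)"
        by (auto simp: incident_pair_iff)
    next
      fix w assume "w \<in> set (?rest k)"
      then have w: "w \<in> ?U" "\<not> incident_pair w (ds ! k)" by auto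
      then have "\<exists>!k'. k' \<in> I \<and> incident_pair w (ds ! k')"
        using I unfolding index_matching_def by blast
      moreover have "k' \<in> I - {k} \<and> incident_pair w (ds ! k') \<longleftrightarrow> k' \<in> I \<and> incident_pair w (ds ! k')" for k'
        using w(2) by auto
      ultimately show "\<exists>!k'. k' \<in> I - {k} \<and> incident_pair w (ds ! k')" by simp
    qed
    moreover have "I = insert k (I - {k})" using k by blast
    ultimately show "\<exists>k\<in>set ?ks. \<exists>J. index_matching ds (set (?rest k)) J \<and> I = insert k J"
      using kk by blast
  next
    assume "\<exists>k\<in>set ?ks. \<exists>J. index_matching ds (set (?rest k)) J \<and> I = insert k J"
    then obtain k J where k: "k \<in> set ?ks" and J: "index_matching ds (set (?rest k)) J" and I: "I = insert k J"
      by blast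
    have J1: "\<And>k'. k' \<in> J \<Longrightarrow> incident_pair w (ds ! k') \<Longrightarrow> w \<in> set (?rest k)" for w
      using J unfolding index_matching_def incident_pair_iff by metis
    show "index_matching ds ?U I"
      unfolding index_matching_def
    proof (intro conjI ballI)
      show "I \<subseteq> {..<length ds}" using I J k by (auto simp: index_matching_def)
    next
      fix k' assume "k' \<in> I"
      then show "fst (ds ! k') \<in> ?U" "snd (ds ! k') \<in> ?U"
        using I J k by (auto simp: index_matching_def)
    next
      fix w assume w: "w \<in> ?U"
      show "\<exists>!k'. k' \<in> I \<and> incident_pair w (ds ! k')"
      proof (cases "incident_pair w (ds ! k)")
        case True
        then have "k' \<in> I \<and> incident_pair w (ds ! k') \<longleftrightarrow> k' = k" for k'
          using J1[of k' w] I by auto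
        then show ?thesis by simp
      next
        case False
        then have "w \<in> set (?rest k)" using w k by auto
        then have "\<exists>!k'. k' \<in> J \<and> incident_pair w (ds ! k')"
          using J unfolding index_matching_def by blast
        moreover have "k' \<in> I \<and> incident_pair w (ds ! k') \<longleftrightarrow> k' \<in> J \<and> incident_pair w (ds ! k')" for k'
          using False I by auto
        ultimately show ?thesis by simp
      qed
    qed
  qed
  have gen: "{I. \<exists>k\<in>A. \<exists>J. P k J \<and> I = insert k J} = (\<Union>k\<in>A. insert k ` {J. P k J})"
    for A :: "nat set" and P by blast
  have "{I. index_matching ds ?U I} = (\<Union>k\<in>set ?ks. insert k ` {J. index_matching ds (set (?rest k)) J})"
    unfolding step by (rule gen)
  also have "\<dots> = (\<Union>k\<in>set ?ks. insert k ` set ` set (pm_lists ds (?rest k)))"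
    by (rule SUP_cong[OF refl]) (simp only: IH)
  also have "\<dots> = set ` set (pm_lists ds (v # ws))"
    by (simp only: pm_lists.simps set_concat set_map image_UN image_image list.set)
  finally show ?case .
qed

lemma ex1_image_iff:
  assumes "inj_on f I"
  shows "(\<exists>!e. e \<in> f ` I \<and> Q e) \<longleftrightarrow> (\<exists>!i. i \<in> I \<and> Q (f i))"
proof
  assume ex: "\<exists>!e. e \<in> f ` I \<and> Q e"
  then obtain i where i: "i \<in> I" "Q (f i)" by blast
  show "\<exists>!i. i \<in> I \<and> Q (f i)"
  proof (rule ex1I[of _ i])
    fix j assume "j \<in> I \<and> Q (f j)"
    then have "f j = f i" using ex i by blast
    then show "j = i" using assms i \<open>j \<in> I \<and> Q (f j)\<close> by (simp add: inj_on_eq_iff)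
  qed (use i in simp)
next
  assume ex: "\<exists>!i. i \<in> I \<and> Q (f i)"
  then obtain i where "i \<in> I" "Q (f i)" by blast
  then show "\<exists>!e. e \<in> f ` I \<and> Q e"
    using ex by (intro ex1I[of _ "f i"]) blast+
qed

lemma presents_card_pm:
  assumes G: "presents G ws es ds" and fl: "finite_loopless G" and k: "k < length ds"
  shows "card {M. perfect_matching G M \<and> es ! k \<in> M} =
    card {I. index_matching ds {..<length ws} I \<and> k \<in> I}"
proof -
  have ls: "length es = length ds" using G by (auto simp: presents_def dest: list_all2_lengthD)
  have inj: "inj_on ((!) es) {..<length ds}" "inj_on ((!) ws) {..<length ws}"
    using G ls by (auto simp: presents_def inj_on_nth)
  have E: "edges G = (!) es ` {..<length ds}" and V: "verts G = (!) ws ` {..<length ws}"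
    using G ls by (auto simp: presents_def set_conv_nth)
  have pm: "perfect_matching G ((!) es ` I) \<longleftrightarrow> index_matching ds {..<length ws} I"
    if I: "I \<subseteq> {..<length ds}" for I
  proof -
    have inc: "ws ! v \<in> ends G (es ! i) \<longleftrightarrow> incident_pair v (ds ! i)" if "v < length ws" "i < length ds" for v i
      using presents_nth[OF G that(2)] inj(2) that(1) by (auto simp: incident_pair_iff inj_on_def)
    have "(\<exists>!e. e \<in> (!) es ` I \<and> ws ! v \<in> ends G e) \<longleftrightarrow> (\<exists>!i. i \<in> I \<and> incident_pair v (ds ! i))"
      if v: "v < length ws" for v
    proof -
      have "i \<in> I \<and> ws ! v \<in> ends G (es ! i) \<longleftrightarrow> i \<in> I \<and> incident_pair v (ds ! i)" for i
        using inc[OF v, of i] I by auto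
      then show ?thesis
        unfolding ex1_image_iff[OF inj_on_subset[OF inj(1) I]] by simp
    qed
    then have A: "(\<forall>v\<in>verts G. \<exists>!e. e \<in> (!) es ` I \<and> v \<in> ends G e) \<longleftrightarrow>
        (\<forall>v\<in>{..<length ws}. \<exists>!i. i \<in> I \<and> incident_pair v (ds ! i))"
      unfolding V by (simp del: image_iff)
    have B: "\<forall>k\<in>I. fst (ds ! k) \<in> {..<length ws} \<and> snd (ds ! k) \<in> {..<length ws}"
      using presents_nth(1,2)[OF G] I by blast
    have C: "(!) es ` I \<subseteq> edges G" unfolding E using I by blast
    show ?thesis
      unfolding perfect_matching_def index_matching_def A using B C I by blast
  qed
  have "bij_betw (\<lambda>I. (!) es ` I) {I. index_matching ds {..<length ws} I \<and> k \<in> I}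
      {M. perfect_matching G M \<and> es ! k \<in> M}"
    unfolding bij_betw_def
  proof
    show "inj_on (\<lambda>I. (!) es ` I) {I. index_matching ds {..<length ws} I \<and> k \<in> I}"
      by (rule inj_on_subset[OF inj_on_image_Pow[OF inj(1)]]) (auto simp: index_matching_def)
    show "(\<lambda>I. (!) es ` I) ` {I. index_matching ds {..<length ws} I \<and> k \<in> I} =
        {M. perfect_matching G M \<and> es ! k \<in> M}"
    proof (intro equalityI subsetI)
      fix M assume "M \<in> (\<lambda>I. (!) es ` I) ` {I. index_matching ds {..<length ws} I \<and> k \<in> I}"
      then obtain I where "index_matching ds {..<length ws} I" "k \<in> I" "M = (!) es ` I" by blast
      then show "M \<in> {M. perfect_matching G M \<and> es ! k \<in> M}"
        using pm[of I] by (auto simp: index_matching_def)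
    next
      fix M assume M: "M \<in> {M. perfect_matching G M \<and> es ! k \<in> M}"
      then have "M \<subseteq> (!) es ` {..<length ds}" using E by (auto simp: perfect_matching_def)
      then obtain I where I: "I \<subseteq> {..<length ds}" "M = (!) es ` I" by (meson subset_image_iff)
      have "k \<in> I" using M I k inj(1) by (auto simp: inj_on_def)
      then show "M \<in> (\<lambda>I. (!) es ` I) ` {I. index_matching ds {..<length ws} I \<and> k \<in> I}"
        using M I pm[OF I(1)] by auto
    qed
  qed
  from bij_betw_same_card[OF this] show ?thesis by simp
qed

text \<open>Converting to sets and removing duplicates makes the length a cardinality, without any
  claim that the recursion lists each matching only once.\<close>

definition double_covered_list :: "(nat \<times> nat) list \<Rightarrow> nat \<Rightarrow> bool" where
  "double_covered_list ds n \<longleftrightarrow> (let L = pm_lists ds [0..<n] in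
     \<forall>k\<in>set [0..<length ds]. length (remdups (map set (filter (\<lambda>l. k \<in> set l) L))) = 2)"

lemma presents_double_covered:
  assumes G: "presents G ws es ds" and fl: "finite_loopless G"
    and D: "double_covered_list ds (length ws)" and e: "e \<in> edges G"
  shows "card {M. perfect_matching G M \<and> e \<in> M} = 2"
proof -
  have ls: "length es = length ds" "set es = edges G"
    using G by (auto simp: presents_def dest: list_all2_lengthD)
  then obtain k where k: "k < length ds" "e = es ! k"
    using e by (metis in_set_conv_nth)
  let ?L = "pm_lists ds [0..<length ws]"
  have U: "{..<length ws} = set [0..<length ws]" by auto
  have "{I. index_matching ds {..<length ws} I \<and> k \<in> I} = {I. index_matching ds {..<length ws} I} \<inter> {I. k \<in> I}"
    by blast
  also have "\<dots> = set ` set ?L \<inter> {I. k \<in> I}"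
    unfolding U pm_lists_matching[OF distinct_upt] ..
  also have "\<dots> = set (map set (filter (\<lambda>l. k \<in> set l) ?L))" by auto
  also have "card \<dots> = 2"
    using D k(1) unfolding double_covered_list_def Let_def card_set by auto
  finally show ?thesis
    using presents_card_pm[OF G fl k(1)] k(2) by simp
qed

text \<open>Incidence lists. For T4, T5, T6 the vertices 0, 1, 2 form B; then come the vertices
  that replace the members of A, and the triangle edges are last, opposite to the triangle
  vertices in their order.\<close>

definition T3_list :: "(nat \<times> nat) list" where
  "T3_list = [(0, 2), (0, 3), (0, 4), (0, 5), (1, 2), (1, 3), (1, 4), (1, 5),
     (2, 3), (2, 3), (4, 5), (4, 5)]"

definition T4_list :: "(nat \<times> nat) list" where
  "T4_list = [(3, 0), (4, 1), (5, 2), (6, 0), (6, 1), (6, 2), (7, 0), (7, 1), (7, 2),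
     (4, 5), (3, 5), (3, 4)]"

definition T5_list :: "(nat \<times> nat) list" where
  "T5_list = [(3, 0), (4, 1), (5, 2), (6, 0), (7, 1), (8, 2), (9, 0), (9, 1), (9, 2),
     (4, 5), (3, 5), (3, 4), (7, 8), (6, 8), (6, 7)]"

definition T6_list :: "(nat \<times> nat) list" where
  "T6_list = [(3, 0), (4, 1), (5, 2), (6, 0), (7, 1), (8, 2), (9, 0), (10, 1), (11, 2),
     (4, 5), (3, 5), (3, 4), (7, 8), (6, 8), (6, 7), (10, 11), (9, 11), (9, 10)]"

section \<open>Computed counts and presentations for T3, T4, T5 and T6\<close>

lemma double_covered_T3: "double_covered_list T3_list 6" by code_simp
lemma double_covered_T4: "double_covered_list T4_list 8" by code_simp
lemma double_covered_T5: "double_covered_list T5_list 10" by code_simp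
lemma double_covered_T6: "double_covered_list T6_list 12" by code_simp

lemma presents_T3: "\<exists>es. presents T3 [vp, vu, vq, vr, vs, vt] es T3_list"
proof
  show "presents T3 [vp, vu, vq, vr, vs, vt]
     [(vp, vq, 0), (vp, vr, 0), (vp, vs, 0), (vp, vt, 0),
      (vu, vq, 0), (vu, vr, 0), (vu, vs, 0), (vu, vt, 0),
      (vq, vr, 0), (vq, vr, 1), (vs, vt, 0), (vs, vt, 1)] T3_list"
    by (simp add: presents_def T3_def T3_list_def)
qed

lemma triangle_replacement_sel:
  assumes "incident_edges G u = {a, b, c}" "a \<noteq> b" "a \<noteq> c" "b \<noteq> c"
  shows "verts (triangle_replacement G u) = Inl ` (verts G - {u}) \<union> {Inr a, Inr b, Inr c}"
    "edges (triangle_replacement G u) = Inl ` edges G \<union> {Inr {b, c}, Inr {a, c}, Inr {a, b}}"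
    "ends (triangle_replacement G u) (Inl e) = (\<lambda>v. if v = u then Inr e else Inl v) ` ends G e"
    "ends (triangle_replacement G u) (Inr D) = Inr ` D"
proof -
  have "{{e, f} |e f. e \<in> {a, b, c} \<and> f \<in> {a, b, c} \<and> e \<noteq> f} = {{b, c}, {a, c}, {a, b}}"
    using assms(2-) by (auto simp: insert_commute)
  then show "edges (triangle_replacement G u) = Inl ` edges G \<union> {Inr {b, c}, Inr {a, c}, Inr {a, b}}"
    unfolding triangle_replacement_def assms(1) by simp
qed (simp_all add: triangle_replacement_def assms(1))

lemma K33_sel: "verts K33 = {0, 1, 2, 3, 4, 5}"
  "edges K33 = {(0, 3), (0, 4), (0, 5), (1, 3), (1, 4), (1, 5), (2, 3), (2, 4), (2, 5)}"
  "ends K33 (i, j) = {i, j}"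
  by (auto simp: K33_def)

lemma incident_K33: "incident_edges K33 0 = {(0, 3), (0, 4), (0, 5)}"
  unfolding incident_edges_def K33_sel(2) by (auto simp: K33_sel(3))

lemma T4_sel: "verts T4 = Inl ` {1, 2, 3, 4, 5} \<union> {Inr (0, 3), Inr (0, 4), Inr (0, 5)}"
  "edges T4 = Inl ` {(0, 3), (0, 4), (0, 5), (1, 3), (1, 4), (1, 5), (2, 3), (2, 4), (2, 5)} \<union>
    {Inr {(0, 4), (0, 5)}, Inr {(0, 3), (0, 5)}, Inr {(0, 3), (0, 4)}}"
  "ends T4 (Inl (i, j)) = (\<lambda>v. if v = 0 then Inr (i, j) else Inl v) ` {i, j}"
  "ends T4 (Inr D) = Inr ` D"
  unfolding T4_def triangle_replacement_sel[OF incident_K33, simplified] K33_sel by auto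

lemma incident_T4: "incident_edges T4 (Inl 1) = {Inl (1, 3), Inl (1, 4), Inl (1, 5)}"
  unfolding incident_edges_def T4_sel(2) by (auto simp: T4_sel(3,4))

lemma T5_sel: "verts T5 = Inl ` (Inl ` {2, 3, 4, 5} \<union> {Inr (0, 3), Inr (0, 4), Inr (0, 5)}) \<union>
    {Inr (Inl (1, 3)), Inr (Inl (1, 4)), Inr (Inl (1, 5))}"
  "edges T5 = Inl ` edges T4 \<union>
    {Inr {Inl (1, 4), Inl (1, 5)}, Inr {Inl (1, 3), Inl (1, 5)}, Inr {Inl (1, 3), Inl (1, 4)}}"
  "ends T5 (Inl e) = (\<lambda>v. if v = Inl 1 then Inr e else Inl v) ` ends T4 e"
  "ends T5 (Inr D) = Inr ` D"
  unfolding T5_def triangle_replacement_sel[OF incident_T4, simplified, folded One_nat_def] T4_sel(1) by auto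

lemma incident_T5:
  "incident_edges T5 (Inl (Inl 2)) = {Inl (Inl (2, 3)), Inl (Inl (2, 4)), Inl (Inl (2, 5))}"
  unfolding incident_edges_def T5_sel(2) T4_sel(2) by (auto simp: T5_sel(3,4) T4_sel(3,4))

lemma T6_sel: "verts T6 = Inl ` (Inl ` (Inl ` {3, 4, 5} \<union> {Inr (0, 3), Inr (0, 4), Inr (0, 5)}) \<union>
    {Inr (Inl (1, 3)), Inr (Inl (1, 4)), Inr (Inl (1, 5))}) \<union>
    {Inr (Inl (Inl (2, 3))), Inr (Inl (Inl (2, 4))), Inr (Inl (Inl (2, 5)))}"
  "edges T6 = Inl ` edges T5 \<union>
    {Inr {Inl (Inl (2, 4)), Inl (Inl (2, 5))}, Inr {Inl (Inl (2, 3)), Inl (Inl (2, 5))},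
     Inr {Inl (Inl (2, 3)), Inl (Inl (2, 4))}}"
  "ends T6 (Inl e) = (\<lambda>v. if v = Inl (Inl 2) then Inr e else Inl v) ` ends T5 e"
  "ends T6 (Inr D) = Inr ` D"
  unfolding T6_def triangle_replacement_sel[OF incident_T5, simplified, folded One_nat_def] T5_sel(1) by auto

lemma presents_T4: "\<exists>ws es. length ws = 8 \<and> presents T4 ws es T4_list"
proof (intro exI conjI)
  show "presents T4
     [Inl 3, Inl 4, Inl 5, Inr (0, 3), Inr (0, 4), Inr (0, 5), Inl 1, Inl 2]
     (map Inl [(0, 3), (0, 4), (0, 5), (1, 3), (1, 4), (1, 5), (2, 3), (2, 4), (2, 5)] @
      map Inr [{(0, 4), (0, 5)}, {(0, 3), (0, 5)}, {(0, 3), (0, 4)}]) T4_list"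
    by (auto simp: presents_def T4_list_def T4_sel doubleton_eq_iff)
qed simp

lemma presents_T5: "\<exists>ws es. length ws = 10 \<and> presents T5 ws es T5_list"
proof (intro exI conjI)
  show "presents T5
     (map Inl [Inl 3, Inl 4, Inl 5, Inr (0, 3), Inr (0, 4), Inr (0, 5)] @
      [Inr (Inl (1, 3)), Inr (Inl (1, 4)), Inr (Inl (1, 5)), Inl (Inl 2)])
     (map Inl (map Inl [(0, 3), (0, 4), (0, 5), (1, 3), (1, 4), (1, 5), (2, 3), (2, 4), (2, 5)] @
      map Inr [{(0, 4), (0, 5)}, {(0, 3), (0, 5)}, {(0, 3), (0, 4)}]) @
      map Inr [{Inl (1, 4), Inl (1, 5)}, {Inl (1, 3), Inl (1, 5)}, {Inl (1, 3), Inl (1, 4)}]) T5_list"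
    by (auto simp: presents_def T5_list_def T5_sel T4_sel(2-) doubleton_eq_iff)
qed simp

lemma presents_T6: "\<exists>ws es. length ws = 12 \<and> presents T6 ws es T6_list"
proof (intro exI conjI)
  show "presents T6
     (map Inl (map Inl [Inl 3, Inl 4, Inl 5, Inr (0, 3), Inr (0, 4), Inr (0, 5)] @
      [Inr (Inl (1, 3)), Inr (Inl (1, 4)), Inr (Inl (1, 5))]) @
      [Inr (Inl (Inl (2, 3))), Inr (Inl (Inl (2, 4))), Inr (Inl (Inl (2, 5)))])
     (map Inl (map Inl (map Inl [(0, 3), (0, 4), (0, 5), (1, 3), (1, 4), (1, 5), (2, 3), (2, 4), (2, 5)] @
      map Inr [{(0, 4), (0, 5)}, {(0, 3), (0, 5)}, {(0, 3), (0, 4)}]) @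
      map Inr [{Inl (1, 4), Inl (1, 5)}, {Inl (1, 3), Inl (1, 5)}, {Inl (1, 3), Inl (1, 4)}]) @
      map Inr [{Inl (Inl (2, 4)), Inl (Inl (2, 5))}, {Inl (Inl (2, 3)), Inl (Inl (2, 5))},
        {Inl (Inl (2, 3)), Inl (Inl (2, 4))}]) T6_list"
    by (auto simp: presents_def T6_list_def T6_sel T5_sel(2-) T4_sel(2-) doubleton_eq_iff)
qed simp

subsection \<open>The triangle dichotomy\<close>

lemma card_2_obtain:
  assumes "card S = 2"
  obtains a b where "S = {a, b}" "a \<noteq> b"
  using assms unfolding card_2_iff by blast

context loopless_graph begin

lemma connected_closed:
  assumes "connected_graph G" "w \<in> W" "w \<in> V"
    and "\<And>e v. e \<in> E \<Longrightarrow> v \<in> W \<Longrightarrow> v \<in> ends G e \<Longrightarrow> ends G e \<subseteq> W"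
  shows "V \<subseteq> W"
proof
  fix u assume "u \<in> V"
  then have "(w, u) \<in> (adjacency G)\<^sup>*" using assms(1,3) by (auto simp: connected_graph_def)
  then show "u \<in> W"
  proof (induction rule: rtrancl_induct)
    case (step y z)
    then obtain e where "e \<in> E" "ends G e = {y, z}" by (auto simp: adjacency_def)
    then show ?case using assms(4)[of e y] step.IH by auto
  qed (rule assms(2))
qed

text \<open>A tight cut with a shore consisting of three vertices that span a triangle; the edges c1,
  c2, c3 leave at v1, v2, v3, and d1, d2, d3 are the opposite sides.\<close>

definition triangle :: "'v set \<Rightarrow> bool" where
  "triangle X \<longleftrightarrow> (\<exists>v1 v2 v3 c1 c2 c3 d1 d2 d3. distinct [v1, v2, v3] \<and> X = {v1, v2, v3} \<and>
     distinct [c1, c2, c3] \<and> cut G X = {c1, c2, c3} \<and>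
     v1 \<in> ends G c1 \<and> v2 \<in> ends G c2 \<and> v3 \<in> ends G c3 \<and>
     {e \<in> E. ends G e \<subseteq> X} = {d1, d2, d3} \<and>
     ends G d1 = {v2, v3} \<and> ends G d2 = {v1, v3} \<and> ends G d3 = {v1, v2})"

lemma triangle_subset: "triangle X \<Longrightarrow> X \<subseteq> V"
  unfolding triangle_def
proof (elim exE conjE)
  fix v1 v2 v3 c1 c2 c3
  assume X: "X = {v1, v2, v3}" and c: "cut G X = {c1, c2, c3}"
    and v: "v1 \<in> ends G c1" "v2 \<in> ends G c2" "v3 \<in> ends G c3"
  have "{c1, c2, c3} \<subseteq> E" unfolding c[symmetric] by (auto simp: cut_def)
  then show "X \<subseteq> V" unfolding X using v ends_subset by blast
qed

end

context double_covered_graph begin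

text \<open>If all degrees are at most two, then the vertices where two perfect matchings through a
  common edge differ form a component.\<close>

lemma degree_ge_3:
  assumes con: "connected_graph G" and x: "x \<in> V" "x' \<in> V" "x \<noteq> x'" and t: "tight X"
  shows "card (cut G X) > 2"
proof (rule ccontr)
  assume small: "\<not> card (cut G X) > 2"
  have "E \<noteq> {}"
  proof
    assume "E = {}"
    then have "adjacency G = {}" by (auto simp: adjacency_def)
    moreover have "(x, x') \<in> (adjacency G)\<^sup>*" using con x by (simp add: connected_graph_def)
    ultimately show False using x(3) by simp
  qed
  then obtain e where e: "e \<in> E" by blast
  obtain A B where AB: "A \<noteq> B" and A: "perfect_matching G A" and B: "perfect_matching G B"
    and eAB: "e \<in> A" "e \<in> B" by (rule pm_through[OF e])
  define W where "W = {v \<in> V. edge_at A v \<noteq> edge_at B v}"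
  obtain w where w: "w \<in> V" "edge_at A w \<noteq> edge_at B w"
    using pm_ext[OF A B] AB by blast
  have "V \<subseteq> W"
  proof (rule connected_closed[OF con, of w])
    fix g v assume g: "g \<in> E" and v: "v \<in> W" "v \<in> ends G g"
    have vV: "v \<in> V" and ne: "edge_at A v \<noteq> edge_at B v" using v by (auto simp: W_def)
    have fin: "finite (incident_edges G v)"
      by (rule finite_subset[OF _ finite_E]) (auto simp: incident_edges_def)
    have sub: "{edge_at A v, edge_at B v} \<subseteq> incident_edges G v"
      using edge_at(2)[OF A vV] edge_at(2)[OF B vV] edge_at_edge[OF A vV] edge_at_edge[OF B vV]
      by (simp add: incident_edges_def)
    have "card (incident_edges G v) \<le> card {edge_at A v, edge_at B v}"
      using small card_cut_incident[OF t vV] ne by simp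
    then have "incident_edges G v = {edge_at A v, edge_at B v}"
      using card_seteq[OF fin sub] by simp
    then have gv: "g = edge_at A v \<or> g = edge_at B v"
      using g v(2) by (auto simp: incident_edges_def)
    show "ends G g \<subseteq> W"
    proof
      fix u assume u: "u \<in> ends G g"
      then have uV: "u \<in> V" using ends_subset[OF g] by blast
      \<comment> \<open>\<open>g\<close> belongs to exactly one of the two matchings, so they differ
        at its other end too.\<close>
      have "g \<in> A \<longleftrightarrow> g = edge_at A v" "g \<in> A \<longleftrightarrow> g = edge_at A u"
        "g \<in> B \<longleftrightarrow> g = edge_at B v" "g \<in> B \<longleftrightarrow> g = edge_at B u"
        using edge_at_mem_iff[OF A g v(2)] edge_at_mem_iff[OF A g u]
          edge_at_mem_iff[OF B g v(2)] edge_at_mem_iff[OF B g u] by auto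
      then have "edge_at A u \<noteq> edge_at B u" using gv ne by metis
      then show "u \<in> W" using uV by (simp add: W_def)
    qed
  qed (use w in \<open>simp_all add: W_def\<close>)
  moreover obtain z where z: "z \<in> ends G e" "z \<in> V"
    using ends_pair[OF e] by (metis insertI1)
  moreover have "edge_at A z = edge_at B z"
    using edge_at_eqI[OF A eAB(1) z(1)] edge_at_eqI[OF B eAB(2) z(1)] by simp
  ultimately show False by (auto simp: W_def)
qed

lemma cut_ends:
  assumes "f \<in> cut G X" "v \<in> ends G f" "v \<in> X" "u \<in> ends G f" "u \<notin> X"
  shows "ends G f = {v, u}"
proof -
  have "f \<in> E" using assms(1) by (simp add: cut_def)
  then show ?thesis using card_ends[of f] assms(2-) by (auto simp: card_2_iff)
qed

text \<open>By \<open>side_shape\<close> a third cut edge lies in \<open>card (cut G X) - 2\<close>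
  matchings of this contraction, and that number can only be 1 or 2. The value 1 leaves a triangle;
  the value 2 forces the same shape on the opposite shore.\<close>

lemma side_dichotomy:
  assumes X: "X \<subseteq> V" and t: "tight X" and big: "card X > 1" "card (V - X) > 1" "card (cut G X) > 2"
    and x: "x \<in> X" and y: "y \<in> V - X"
    and f: "f \<in> cut G X" "card (through X y f) = 1"
    and f': "f' \<in> cut G X" "card (through X y f') = 1" and ff': "f \<noteq> f'"
  shows "triangle X \<and> card (cut G X) = 3 \<or> (\<exists>ws es. length ws = 6 \<and> presents G ws es T3_list)"
proof -
  let ?C = "cut G X"
  obtain v1 v2 v3 e12 e23 where v: "distinct [v1, v2, v3]" "X = {v1, v2, v3}"
    and vf: "v1 \<in> ends G f" "v3 \<in> ends G f'"
    and e12: "e12 \<in> E" "ends G e12 = {v1, v2}" and e23: "e23 \<in> E" "ends G e23 = {v2, v3}"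
    and inner: "{e \<in> E. ends G e \<subseteq> X} = {e12, e23} \<union> {e \<in> E. ends G e = {v1, v3}}"
    and cD: "card {e \<in> E. ends G e = {v1, v3}} = card ?C - 2"
    and v2: "\<And>g. g \<in> ?C - {f, f'} \<Longrightarrow> v2 \<in> ends G g"
    and thr: "\<And>g. g \<in> ?C - {f, f'} \<Longrightarrow> card (through X y g) = card ?C - 2"
    by (rule side_shape[OF X x y t big(1,3) f f' ff'], rule that)
  have finC: "finite ?C" by (rule finite_subset[OF _ finite_E]) (auto simp: cut_def)
  have cC: "card (?C - {f, f'}) = card ?C - 2"
    using f f' ff' finC by (simp add: card_Diff_subset)
  then have "card (?C - {f, f'}) > 0" using big(3) by simp
  then obtain g where g: "g \<in> ?C - {f, f'}" by (auto simp: card_gt_0_iff)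
  have "card ?C - 2 = 1 \<or> card ?C - 2 = 2"
    using through_cases[OF X x y t, of g] thr[OF g] g by auto
  then show ?thesis
  proof
    assume r: "card ?C - 2 = 1"
    obtain d where d: "{e \<in> E. ends G e = {v1, v3}} = {d}"
      using cD r by (auto simp: card_1_singleton_iff)
    obtain h where hh: "?C - {f, f'} = {h}"
      by (rule card_1_singletonE[of "?C - {f, f'}"]) (simp only: cC r)
    have "g = h" using g unfolding hh by (rule singletonD)
    have "?C = {f, f'} \<union> (?C - {f, f'})" using f(1) f'(1) by blast
    also have "\<dots> = {f, g, f'}" unfolding hh \<open>g = h\<close> by (simp add: insert_commute)
    finally have Ceq: "?C = {f, g, f'}" .
    have Cdist: "distinct [f, g, f']" using ff' g by auto
    have "d \<in> {e \<in> E. ends G e = {v1, v3}}" using d by simp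
    then have de: "ends G d = {v1, v3}" by simp
    have ie: "{e \<in> E. ends G e \<subseteq> X} = {e23, d, e12}" unfolding inner d by blast
    have "triangle X"
      unfolding triangle_def
      by (rule exI[of _ v1], rule exI[of _ v2], rule exI[of _ v3], rule exI[of _ f],
          rule exI[of _ g], rule exI[of _ f'], rule exI[of _ e23], rule exI[of _ d],
          rule exI[of _ e12]) (intro conjI v vf v2[OF g] e12(2) e23(2) Ceq Cdist de ie)
    moreover have "card ?C = 3" using r big(3) by linarith
    ultimately show ?thesis by blast
  next
    assume r: "card ?C - 2 = 2"
    obtain g g' where g: "?C - {f, f'} = {g, g'}" "g \<noteq> g'"
      by (rule card_2_obtain[of "?C - {f, f'}"]) (simp only: cC r)
    then have gC: "g \<in> ?C - {f, f'}" "g' \<in> ?C - {f, f'}" by simp_all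
    then have gC': "g \<in> ?C" "g' \<in> ?C" by blast+
    obtain d d' where d: "{e \<in> E. ends G e = {v1, v3}} = {d, d'}" "d \<noteq> d'"
      by (rule card_2_obtain[of "{e \<in> E. ends G e = {v1, v3}}"]) (simp only: cD r)
    \<comment> \<open>The two counts at an edge have product 2, so edges with two matchings on this
      side are single on the other; \<open>g\<close> and \<open>g'\<close> play there the part that
      \<open>f\<close> and \<open>f'\<close> play here.\<close>
    have tg: "card (through (V - X) x g) = 1" "card (through (V - X) x g') = 1"
      using thr[OF gC(1)] thr[OF gC(2)] through_cases[OF X x y t gC'(1)]
        through_cases[OF X x y t gC'(2)] r by auto
    have Y: "V - X \<subseteq> V" "x \<in> V - (V - X)" "tight (V - X)" "card (cut G (V - X)) > 2"
      using X x t big by (auto simp: tight_compl cut_compl)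
    have gY: "g \<in> cut G (V - X)" "g' \<in> cut G (V - X)" unfolding cut_compl by (rule gC')+
    obtain u1 u2 u3 e12' e23' where u: "distinct [u1, u2, u3]" "V - X = {u1, u2, u3}"
      and ug: "u1 \<in> ends G g" "u3 \<in> ends G g'"
      and e12': "e12' \<in> E" "ends G e12' = {u1, u2}" and e23': "e23' \<in> E" "ends G e23' = {u2, u3}"
      and inner': "{e \<in> E. ends G e \<subseteq> V - X} = {e12', e23'} \<union> {e \<in> E. ends G e = {u1, u3}}"
      and cD': "card {e \<in> E. ends G e = {u1, u3}} = card (cut G (V - X)) - 2"
      and u2: "\<And>h. h \<in> cut G (V - X) - {g, g'} \<Longrightarrow> u2 \<in> ends G h"
      by (rule side_shape[OF Y(1) y Y(2,3) big(2) Y(4) gY(1) tg(1) gY(2) tg(2) g(2)], rule that)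
    obtain d1 d2 where d': "{e \<in> E. ends G e = {u1, u3}} = {d1, d2}" "d1 \<noteq> d2"
      by (rule card_2_obtain[of "{e \<in> E. ends G e = {u1, u3}}"]) (simp only: cD' cut_compl r)
    have disj: "a \<noteq> b" if "a \<in> {v1, v2, v3}" "b \<in> {u1, u2, u3}" for a b
      using that unfolding v(2)[symmetric] u(2)[symmetric] by blast
    have u2f: "u2 \<in> ends G f" "u2 \<in> ends G f'"
      using u2[of f] u2[of f'] f f' gC unfolding cut_compl by auto
    have vX: "v1 \<in> X" "v2 \<in> X" "v3 \<in> X" using v(2) by auto
    have "u1 \<in> V - X" "u2 \<in> V - X" "u3 \<in> V - X" using u(2) by simp_all
    then have uX: "u1 \<notin> X" "u2 \<notin> X" "u3 \<notin> X" by blast+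
    have en: "ends G f = {v1, u2}" "ends G f' = {v3, u2}" "ends G g = {v2, u1}" "ends G g' = {v2, u3}"
      using cut_ends[OF f(1) vf(1) vX(1) u2f(1) uX(2)] cut_ends[OF f'(1) vf(2) vX(3) u2f(2) uX(2)]
        cut_ends[OF gC'(1) v2[OF gC(1)] vX(2) ug(1) uX(1)]
        cut_ends[OF gC'(2) v2[OF gC(2)] vX(2) ug(2) uX(3)] by auto
    have dm: "d \<in> {e \<in> E. ends G e = {v1, v3}}" "d' \<in> {e \<in> E. ends G e = {v1, v3}}"
      "d1 \<in> {e \<in> E. ends G e = {u1, u3}}" "d2 \<in> {e \<in> E. ends G e = {u1, u3}}"
      using d d' by simp_all
    then have de: "ends G d = {v1, v3}" "ends G d' = {v1, v3}" "ends G d1 = {u1, u3}" "ends G d2 = {u1, u3}"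
      by simp_all
    \<comment> \<open>In the order of \<open>T3_list\<close>: \<open>v2\<close> and
      \<open>u2\<close> correspond to \<open>vp\<close> and \<open>vu\<close>, the doubly joined
      pairs \<open>v1\<close>, \<open>v3\<close> and \<open>u1\<close>, \<open>u3\<close> to
      \<open>vq\<close>, \<open>vr\<close> and \<open>vs\<close>, \<open>vt\<close>.\<close>
    let ?ws = "[v2, u2, v1, v3, u1, u3]"
    let ?es = "[e12, e23, g, g', f, f', e12', e23', d, d', d1, d2]"
    have disj': "v1 \<noteq> u1" "v1 \<noteq> u2" "v1 \<noteq> u3" "v2 \<noteq> u1" "v2 \<noteq> u2" "v2 \<noteq> u3"
      "v3 \<noteq> u1" "v3 \<noteq> u2" "v3 \<noteq> u3" by (rule disj; simp)+
    have dv: "distinct ?ws" using v(1) u(1) disj' by auto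
    have setV: "set ?ws = V"
    proof -
      have "V = X \<union> (V - X)" using X by blast
      also have "\<dots> = set ?ws" unfolding u(2) unfolding v(2) by auto
      finally show ?thesis by simp
    qed
    have "?C = {f, f'} \<union> (?C - {f, f'})" using f(1) f'(1) by blast
    also have "\<dots> = {f, f', g, g'}" unfolding g(1) by auto
    finally have Ceq: "?C = {f, f', g, g'}" .
    have "E = {e \<in> E. ends G e \<subseteq> X} \<union> {e \<in> E. ends G e \<subseteq> V - X} \<union> ?C"
    proof -
      have "ends G e \<subseteq> X \<or> ends G e \<subseteq> V - X \<or> e \<in> ?C" if "e \<in> E" for e
        using that ends_subset[OF that] unfolding cut_iff by blast
      moreover have "?C \<subseteq> E" by (auto simp: cut_def)
      ultimately show ?thesis by blast
    qed
    also have "\<dots> = set ?es"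
      unfolding inner inner' d d' Ceq by auto
    finally have setE: "set ?es = E" by (rule sym)
    \<comment> \<open>Edges with different ends are distinct; only the parallel pairs
      \<open>d\<close>, \<open>d'\<close> and \<open>d1\<close>, \<open>d2\<close> rely on a
      separate argument, so one of each is listed at a time.\<close>
    let ?as = "[e12, e23, g, g', f, f', e12', e23']"
    have "distinct (map (ends G) (?as @ [d, d1]))" "distinct (map (ends G) (?as @ [d', d2]))"
      "ends G d \<noteq> ends G d2" "ends G d' \<noteq> ends G d1"
      using dv by (simp_all add: en de e12(2) e23(2) e12'(2) e23'(2) doubleton_eq_iff)
    then have "distinct (?as @ [d, d1])" "distinct (?as @ [d', d2])" "d \<noteq> d2" "d' \<noteq> d1"
      unfolding distinct_map by blast+
    then have "distinct ?es"
      using d(2) d'(2) by simp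
    then have "presents G ?ws ?es T3_list"
      unfolding presents_def
      using dv setV setE
      by (simp add: T3_list_def en de e12(2) e23(2) e12'(2) e23'(2) insert_commute)
    moreover have "length ?ws = 6" by simp
    ultimately show ?thesis by blast
  qed
qed

theorem tight_cut_dichotomy:
  assumes con: "connected_graph G" and X: "X \<subseteq> V" and t: "tight X"
    and big: "card X > 1" "card (V - X) > 1"
  shows "(triangle X \<or> triangle (V - X)) \<and> card (cut G X) = 3 \<or>
    (\<exists>ws es. length ws = 6 \<and> presents G ws es T3_list)"
proof -
  have "X \<noteq> {}" "V - X \<noteq> {}" using big by force+
  then obtain x y where x: "x \<in> X" and y: "y \<in> V - X" by blast
  have three: "card (cut G X) > 2"
    by (rule degree_ge_3[OF con, of x y]) (use x y X t in auto)
  have finC: "finite (cut G X)" by (rule finite_subset[OF _ finite_E]) (auto simp: cut_def)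
  let ?P = "{f \<in> cut G X. card (through X y f) = 1}"
  let ?Q = "{f \<in> cut G X. card (through (V - X) x f) = 1}"
  have two: "\<exists>f f'. f \<in> S \<and> f' \<in> S \<and> f \<noteq> f'" if "card S > 1" for S :: "'b set"
  proof -
    have "\<not> is_singleton S" "S \<noteq> {}" using that by (auto simp: is_singleton_altdef)
    then show ?thesis by (meson is_singletonI' )
  qed
  have "cut G X \<subseteq> ?P \<union> ?Q" using through_cases[OF X x y t] by auto
  then have "card (cut G X) \<le> card (?P \<union> ?Q)" by (intro card_mono) (use finC in auto)
  also have "\<dots> \<le> card ?P + card ?Q" by (rule card_Un_le)
  finally have "card ?P > 1 \<or> card ?Q > 1" using three by linarith
  then show ?thesis
  proof
    assume "card ?P > 1"
    from two[OF this] obtain f f' where "f \<in> ?P" "f' \<in> ?P" "f \<noteq> f'" by blast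
    then show ?thesis using side_dichotomy[OF X t big three x y] by blast
  next
    assume "card ?Q > 1"
    from two[OF this] obtain f f' where f: "f \<in> ?Q" "f' \<in> ?Q" "f \<noteq> f'" by blast
    have "triangle (V - X) \<and> card (cut G (V - X)) = 3 \<or> (\<exists>ws es. length ws = 6 \<and> presents G ws es T3_list)"
    proof (rule side_dichotomy)
      show "V - X \<subseteq> V" "tight (V - X)" "card (V - X) > 1" "card (V - (V - X)) > 1"
        "card (cut G (V - X)) > 2" "y \<in> V - X" "x \<in> V - (V - X)"
        using X t big three x y double_diff[OF X subset_refl] by (auto simp: tight_compl cut_compl)
    qed (use f in \<open>auto simp: cut_compl\<close>)
    then show ?thesis unfolding cut_compl by blast
  qed
qed

end

subsection \<open>Tutte's theorem\<close>

text \<open>Tutte's theorem depends on adjacency only, so a matching is here an involution along a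
  relation; irreflexivity of the relation is what rules out fixed points.\<close>

definition matchable :: "('a \<times> 'a) set \<Rightarrow> 'a set \<Rightarrow> bool" where
  "matchable A X \<longleftrightarrow> (\<exists>m. \<forall>x\<in>X. m x \<in> X \<and> m (m x) = x \<and> (x, m x) \<in> A)"

definition complete_on :: "('a \<times> 'a) set \<Rightarrow> 'a set \<Rightarrow> bool" where
  "complete_on A X \<longleftrightarrow> (\<forall>x\<in>X. \<forall>y\<in>X. x \<noteq> y \<longrightarrow> (x, y) \<in> A)"

lemma matchableI:
  "(\<And>x. x \<in> X \<Longrightarrow> m x \<in> X \<and> m (m x) = x \<and> (x, m x) \<in> A) \<Longrightarrow> matchable A X"
  unfolding matchable_def by blast

lemma matchable_Un:
  assumes "matchable A X" "matchable A Y" "X \<inter> Y = {}"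
  shows "matchable A (X \<union> Y)"
proof -
  obtain f g where f: "\<And>x. x \<in> X \<Longrightarrow> f x \<in> X \<and> f (f x) = x \<and> (x, f x) \<in> A"
    and g: "\<And>x. x \<in> Y \<Longrightarrow> g x \<in> Y \<and> g (g x) = x \<and> (x, g x) \<in> A"
    using assms(1,2) unfolding matchable_def by blast
  let ?m = "\<lambda>x. if x \<in> X then f x else g x"
  have m: "?m x \<in> X \<union> Y \<and> ?m (?m x) = x \<and> (x, ?m x) \<in> A" if "x \<in> X \<union> Y" for x
  proof (cases "x \<in> X")
    case True
    then show ?thesis using f[of x] by simp
  next
    case False
    then have "x \<in> Y" using that by blast
    then have "g x \<notin> X" using g[of x] assms(3) by blast
    then show ?thesis using False g[OF \<open>x \<in> Y\<close>] by simp
  qed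
  show ?thesis by (rule matchableI[of _ ?m], rule m)
qed

lemma matchable_complete:
  assumes "finite X" "even (card X)" "complete_on A X"
  shows "matchable A X"
  using assms
proof (induction "card X" arbitrary: X rule: less_induct)
  case less
  show ?case
  proof (cases "X = {}")
    case True
    then show ?thesis by (simp add: matchable_def)
  next
    case False
    then obtain x where x: "x \<in> X" by blast
    have "X \<noteq> {x}" using less.prems(2) by auto
    then obtain y where y: "y \<in> X" "y \<noteq> x" using x by blast
    let ?Y = "X - {x, y}"
    have c: "card X = card ?Y + 2"
      using x y less.prems(1) card_Diff_subset[of "{x, y}" X] card_mono[of X "{x, y}"] by simp
    have "matchable A ?Y"
      by (rule less.hyps) (use c less.prems in \<open>auto simp: complete_on_def\<close>)
    moreover have "matchable A {x, y}"
      unfolding matchable_def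
      by (rule exI[of _ "\<lambda>z. if z = x then y else x"])
        (use x y less.prems(3) in \<open>auto simp: complete_on_def\<close>)
    ultimately have "matchable A (?Y \<union> {x, y})" by (rule matchable_Un) blast
    moreover have "?Y \<union> {x, y} = X" using x y by blast
    ultimately show ?thesis by simp
  qed
qed

lemma matchable_Union:
  assumes "finite F" "\<And>X. X \<in> F \<Longrightarrow> matchable A X" "\<And>X Y. X \<in> F \<Longrightarrow> Y \<in> F \<Longrightarrow> X \<noteq> Y \<Longrightarrow> X \<inter> Y = {}"
  shows "matchable A (\<Union>F)"
  using assms
proof (induction F)
  case empty
  then show ?case by (simp add: matchable_def)
next
  case (insert X F)
  have "X \<inter> Y = {}" if "Y \<in> F" for Y
    using insert.prems(2)[of X Y] insert.hyps(2) that by auto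
  then have d: "X \<inter> \<Union>F = {}" by blast
  have "matchable A (\<Union>F)" using insert by simp
  then show ?case using matchable_Un[OF insert.prems(1)[of X] _ d] by simp
qed

text \<open>Lovasz' proof of Tutte's theorem. In an edge-maximal graph without perfect matching,
  adjacency is transitive outside the set S of vertices adjacent to all others: otherwise
  adding either of two suitable edges creates a perfect matching, and the two can be
  recombined along their alternating cycles to one that uses neither edge.\<close>

lemma saturated_transitive:
  assumes fin: "finite V" and A: "A \<subseteq> V \<times> V" "sym A" "irrefl A" and no: "\<not> matchable A V"
    and sat: "\<And>x y. x \<in> V \<Longrightarrow> y \<in> V \<Longrightarrow> x \<noteq> y \<Longrightarrow> (x, y) \<notin> A \<Longrightarrow> matchable (A \<union> {(x, y), (y, x)}) V"
    and abc: "(a, b) \<in> A" "(b, c) \<in> A" "a \<noteq> c" and d: "d \<in> V" "d \<noteq> b" "(b, d) \<notin> A"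
  shows "(a, c) \<in> A"
proof (rule ccontr)
  assume ac: "(a, c) \<notin> A"
  have V: "a \<in> V" "b \<in> V" "c \<in> V" using abc A(1) by blast+
  have ba: "(b, a) \<in> A" "(c, b) \<in> A" using abc A(2) by (meson symD)+
  have ne: "b \<noteq> a" "b \<noteq> c" "d \<noteq> a" "d \<noteq> c"
    using abc ba d A(3) by (auto simp: irrefl_def)
  obtain f where f: "\<And>x. x \<in> V \<Longrightarrow> f x \<in> V \<and> f (f x) = x \<and> (x, f x) \<in> A \<union> {(a, c), (c, a)}"
    using sat[OF V(1,3) abc(3) ac] unfolding matchable_def by blast
  have "d \<noteq> b" by (rule d(2))
  then obtain g where g: "\<And>x. x \<in> V \<Longrightarrow> g x \<in> V \<and> g (g x) = x \<and> (x, g x) \<in> A \<union> {(b, d), (d, b)}"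
    using sat[OF V(2) d(1) _ d(3)] unfolding matchable_def by blast
  have fA: "(x, f x) \<in> A" if "x \<in> V" "x \<noteq> a" "x \<noteq> c" for x using f[OF that(1)] that by auto
  have gA: "(x, g x) \<in> A" if "x \<in> V" "x \<noteq> b" "x \<noteq> d" for x using g[OF that(1)] that by auto
  have f_ne: "f x \<noteq> x" if "x \<in> V" for x
    using f[OF that] A(3) abc(3) by (auto simp: irrefl_def)
  have g_ne: "g x \<noteq> x" if "x \<in> V" for x
    using g[OF that] A(3) d(2) by (auto simp: irrefl_def)
  \<comment> \<open>\<open>f\<close> has to use the added pair, as otherwise it would be a matching
    along \<open>A\<close>; the same holds for \<open>g\<close> below.\<close>
  have fac: "f a = c"
  proof (rule ccontr)
    assume "f a \<noteq> c"
    then have 1: "(a, f a) \<in> A" using f[OF V(1)] abc(3) by auto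
    have "f c \<noteq> a" using \<open>f a \<noteq> c\<close> f[OF V(3)] by auto
    then have "(c, f c) \<in> A" using f[OF V(3)] abc(3) by auto
    then have all: "(x, f x) \<in> A" if "x \<in> V" for x
      using 1 fA[OF that] by (cases "x = a"; cases "x = c") auto
    have "matchable A V" by (rule matchableI[of _ f]) (simp add: f all)
    then show False using no by contradiction
  qed
  have gbd: "g b = d"
  proof (rule ccontr)
    assume "g b \<noteq> d"
    then have 1: "(b, g b) \<in> A" using g[OF V(2)] d(2) by auto
    have "g d \<noteq> b" using \<open>g b \<noteq> d\<close> g[OF d(1)] by auto
    then have "(d, g d) \<in> A" using g[OF d(1)] d(2) by auto
    then have all: "(x, g x) \<in> A" if "x \<in> V" for x
      using 1 gA[OF that] by (cases "x = b"; cases "x = d") auto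
    have "matchable A V" by (rule matchableI[of _ g]) (simp add: g all)
    then show False using no by contradiction
  qed
  have fca: "f c = a" using f[OF V(1)] fac by auto
  have gdb: "g d = b" using g[OF V(2)] gbd by auto
  interpret two_involutions V f g
    by unfold_locales (use fin f g f_ne g_ne in auto)
  \<comment> \<open>The walk from \<open>d\<close> starts with \<open>f\<close> and returns through
    \<open>b\<close> by the added pair of \<open>g\<close>, so the cycle contains both ends of that
    pair.\<close>
  define w where "w = alt f g d"
  obtain n where n: "0 < n" "even n" "w n = d" "inj_on w {..<n}" "g d = w (n - 1)"
    "\<And>x. x \<in> w ` {..<n} \<Longrightarrow> f x \<in> w ` {..<n}" "\<And>x. x \<in> w ` {..<n} \<Longrightarrow> g x \<in> w ` {..<n}"
    "w ` {..<n} \<subseteq> V"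
    using alt_cycle[OF d(1)] unfolding w_def by blast
  let ?W = "w ` {..<n}"
  have w0: "w 0 = d" by (simp add: w_def)
  have wn: "w (n - 1) = b" using n(5) gdb by simp
  have dW: "d \<in> ?W" "b \<in> ?W" using w0 wn n(1) by (metis imageI lessThan_iff, metis diff_less imageI lessThan_iff zero_less_one)
  show False
  proof (cases "\<exists>j<n. w j = a \<or> w j = c")
    case False
    then have acW: "a \<notin> ?W" "c \<notin> ?W" by auto
    \<comment> \<open>The cycle avoids \<open>a\<close> and \<open>c\<close>: with \<open>f\<close>
      on it and \<open>g\<close> off it, neither added pair is used.\<close>
    let ?m = "\<lambda>x. if x \<in> ?W then f x else g x"
    have m: "?m x \<in> V \<and> ?m (?m x) = x \<and> (x, ?m x) \<in> A" if x: "x \<in> V" for x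
    proof (cases "x \<in> ?W")
      case True
      then have "x \<noteq> a" "x \<noteq> c" using acW by blast+
      then show ?thesis using True n(6)[OF True] f[OF x] fA[OF x] by simp
    next
      case xW: False
      then have "x \<noteq> b" "x \<noteq> d" using dW by blast+
      moreover have "g x \<notin> ?W"
      proof
        assume "g x \<in> ?W"
        from n(7)[OF this] have "x \<in> ?W" using g[OF x] by simp
        then show False using xW by contradiction
      qed
      ultimately show ?thesis using xW g[OF x] gA[OF x] by simp
    qed
    have "matchable A V" by (rule matchableI[of _ ?m], rule m)
    then show False using no by contradiction
  next
    case True
    \<comment> \<open>The walk is followed up to the first visit of \<open>a\<close> or
      \<open>c\<close> and cut short there: \<open>f\<close> on the positions before
      \<open>j\<close>, an edge of \<open>A\<close> between \<open>w j\<close> and \<open>b\<close>,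
      and \<open>g\<close> on all other vertices.\<close>
    define j where "j = (LEAST j. j < n \<and> (w j = a \<or> w j = c))"
    have j: "j < n" "w j = a \<or> w j = c"
      using LeastI_ex[OF True] unfolding j_def by blast+
    have least: "w i \<noteq> a \<and> w i \<noteq> c" if "i < j" for i
      using not_less_Least[of i "\<lambda>j. j < n \<and> (w j = a \<or> w j = c)"] that j(1) unfolding j_def by auto
    have j0: "0 < j" using j(2) w0 ne by (cases j) auto
    have fw: "f (w i) = (if even i then w (Suc i) else w (i - 1))" for i
      unfolding w_def by (rule alt_f[OF d(1)])
    have gw: "g (w i) = (if odd i then w (Suc i) else w (i - 1))" if "odd i \<or> i > 0" for i
      unfolding w_def by (rule alt_g[OF d(1) that])
    \<comment> \<open>An odd position is reached by an \<open>f\<close>-step, and \<open>f\<close>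
      exchanges \<open>a\<close> and \<open>c\<close>, so such a visit would not be the
      first.\<close>
    have j_even: "even j"
    proof (rule ccontr)
      assume "odd j"
      then have "w (j - 1) = f (w j)" using fw[of j] by simp
      then have "w (j - 1) = a \<or> w (j - 1) = c" using j(2) fac fca by auto
      then show False using least[of "j - 1"] j0 by simp
    qed
    have jn: "j < n - 1" using j(1) j_even n(2) by presburger
    define P where "P = w ` {..<j}"
    have wV: "w i \<in> V" for i unfolding w_def by (rule alt_in[OF d(1)])
    have w_inj: "w i = w k \<longleftrightarrow> i = k" if "i < n" "k < n" for i k
      using inj_on_eq_iff[OF n(4)] that by simp
    have jP: "w j \<notin> P" "b \<notin> P" "b \<noteq> w j" "d \<in> P"
    proof -
      have notP: "w k \<notin> P" if "j \<le> k" "k < n" for k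
      proof
        assume "w k \<in> P"
        then obtain i where "i < j" "w k = w i" unfolding P_def by blast
        then show False using w_inj[of k i] that by simp
      qed
      show "w j \<notin> P" by (rule notP) (use j(1) in simp_all)
      show "b \<notin> P" unfolding wn[symmetric] by (rule notP) (use jn n(1) in simp_all)
      show "b \<noteq> w j" using j(2) ne by auto
      show "d \<in> P" unfolding P_def using w0 j0 by (metis imageI lessThan_iff)
    qed
    have fP: "f x \<in> P" if xP: "x \<in> P" for x
    proof -
      obtain i where i: "i < j" "x = w i" using xP unfolding P_def by blast
      have "even i \<Longrightarrow> Suc i < j" using i(1) j_even by (metis Suc_lessI even_Suc)
      then show ?thesis unfolding i(2) fw P_def using i(1) by auto
    qed
    define Q where "Q = insert (w j) (insert b P)"
    have gQ: "g x \<in> Q" if "x \<in> Q" for x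
    proof -
      consider "x = b" | i where "i \<le> j" "x = w i"
        using \<open>x \<in> Q\<close> unfolding Q_def P_def by (blast intro: less_imp_le)
      then show ?thesis
      proof cases
        case 1
        then show ?thesis using gbd jP by (simp add: Q_def)
      next
        case 2
        have wQ: "w k \<in> Q" if "k \<le> j" for k
          using that unfolding Q_def P_def by (cases "k = j") auto
        show ?thesis
        proof (cases "i = 0")
          case True
          then show ?thesis using 2 w0 gdb by (simp add: Q_def)
        next
          case False
          have "odd i \<Longrightarrow> Suc i \<le> j" using 2(1) j_even by (metis Suc_leI le_neq_implies_less)
          then show ?thesis unfolding 2(2) using gw[of i] False 2(1) wQ by auto
        qed
      qed
    qed
    let ?m = "\<lambda>x. if x \<in> P then f x else if x = w j then b else if x = b then w j else g x"
    have m: "?m x \<in> V \<and> ?m (?m x) = x \<and> (x, ?m x) \<in> A" if x: "x \<in> V" for x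
    proof -
      consider "x \<in> P" | "x = w j" | "x = b" | "x \<notin> Q" unfolding Q_def by blast
      then show ?thesis
      proof cases
        case 1
        then have "x \<noteq> a" "x \<noteq> c" using least unfolding P_def by auto
        then show ?thesis using 1 fP[OF 1] f[OF x] fA[OF x] by simp
      next
        case 2
        have "(w j, b) \<in> A" using j(2) abc ba by auto
        then show ?thesis using 2 jP V(2) by simp
      next
        case 3
        have "(b, w j) \<in> A" using j(2) abc ba by auto
        then show ?thesis using 3 jP wV by simp
      next
        case 4
        have "g x \<notin> Q"
        proof
          assume "g x \<in> Q"
          from gQ[OF this] have "x \<in> Q" using g[OF x] by simp
          then show False using 4 by contradiction
        qed
        then have gx: "g x \<notin> P" "g x \<noteq> w j" "g x \<noteq> b" by (simp_all add: Q_def)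
        have x': "x \<notin> P" "x \<noteq> w j" "x \<noteq> b" "x \<noteq> d" using 4 jP(4) by (auto simp: Q_def)
        show ?thesis using gx x' g[OF x] gA[OF x x'(3,4)] by simp
      qed
    qed
    have "matchable A V" by (rule matchableI[of _ ?m], rule m)
    then show False using no by contradiction
  qed
qed

text \<open>The members of \<open>F\<close> are the odd classes of a saturated relation containing
  \<open>A\<close>, hence unions of components of \<open>A\<close> outside \<open>S\<close>; what is
  recorded is that \<open>A\<close> leads out of them only to \<open>S\<close>. The surplus of two,
  rather than one, comes from the evenness of \<open>card V\<close>.\<close>

theorem tutte:
  assumes fin: "finite V" and ev: "even (card V)"
    and A: "A \<subseteq> V \<times> V" "sym A" "irrefl A" and no: "\<not> matchable A V"
  obtains S F where "S \<subseteq> V" "finite F" "card F \<ge> card S + 2"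
    "\<And>K. K \<in> F \<Longrightarrow> K \<subseteq> V - S" "\<And>K. K \<in> F \<Longrightarrow> odd (card K)"
    "\<And>K L. K \<in> F \<Longrightarrow> L \<in> F \<Longrightarrow> K \<noteq> L \<Longrightarrow> K \<inter> L = {}"
    "\<And>K x y. K \<in> F \<Longrightarrow> x \<in> K \<Longrightarrow> (x, y) \<in> A \<Longrightarrow> y \<in> K \<union> S"
proof -
  let ?B = "{B. B \<subseteq> V \<times> V \<and> sym B \<and> irrefl B \<and> \<not> matchable B V}"
  have "finite ?B" by (rule finite_subset[of _ "Pow (V \<times> V)"]) (use fin in auto)
  moreover have "A \<in> ?B" using A no by simp
  ultimately obtain B where B: "B \<in> ?B" "A \<subseteq> B" and max: "\<And>C. C \<in> ?B \<Longrightarrow> B \<subseteq> C \<Longrightarrow> B = C"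
    using finite_has_maximal2[of ?B A] by auto
  have B': "B \<subseteq> V \<times> V" "sym B" "irrefl B" "\<not> matchable B V" using B(1) by auto
  have sat: "matchable (B \<union> {(x, y), (y, x)}) V"
    if "x \<in> V" "y \<in> V" "x \<noteq> y" "(x, y) \<notin> B" for x y
  proof (rule ccontr)
    assume *: "\<not> matchable (B \<union> {(x, y), (y, x)}) V"
    have "B \<union> {(x, y), (y, x)} \<in> ?B"
      using * that B' by (auto simp: sym_def irrefl_def)
    from max[OF this] that(4) show False by blast
  qed
  define S where "S = {v \<in> V. \<forall>u\<in>V. u \<noteq> v \<longrightarrow> (v, u) \<in> B}"
  define r where "r = {(x, y). x \<in> V - S \<and> y \<in> V - S \<and> (x = y \<or> (x, y) \<in> B)}"
  have tr: "(x, z) \<in> B" if h: "(x, y) \<in> B" "(y, z) \<in> B" "y \<notin> S" "x \<noteq> z" for x y z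
  proof -
    have "y \<in> V" using h(1) B'(1) by blast
    then obtain u where "u \<in> V" "u \<noteq> y" "(y, u) \<notin> B" using h(3) unfolding S_def by blast
    from saturated_transitive[OF fin B' sat h(1,2,4) this] show ?thesis by simp
  qed
  have eq: "equiv (V - S) r"
  proof (rule equivI)
    show "r \<subseteq> (V - S) \<times> (V - S)" by (auto simp: r_def)
    show "refl_on (V - S) r" by (auto simp: r_def refl_on_def)
    show "sym r" using B'(2) by (auto simp: r_def sym_def)
    show "trans r" unfolding trans_def r_def using tr by blast
  qed
  define Q where "Q = (V - S) // r"
  define F where "F = {K \<in> Q. odd (card K)}"
  have SV: "S \<subseteq> V" by (auto simp: S_def)
  have finS: "finite S" using finite_subset[OF SV fin] .
  have finQ: "finite Q" unfolding Q_def by (rule finite_quotient) (use fin in \<open>auto simp: r_def\<close>)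
  have finF: "finite F" using finQ by (simp add: F_def)
  have Q_sub: "K \<subseteq> V - S" if "K \<in> Q" for K
    using that eq unfolding Q_def by (metis Union_quotient Union_upper)
  have Q_disj: "K \<inter> L = {}" if "K \<in> Q" "L \<in> Q" "K \<noteq> L" for K L
    using quotient_disj[OF eq] that unfolding Q_def by blast
  have Q_un: "\<Union>Q = V - S" unfolding Q_def by (rule Union_quotient[OF eq])
  have Q_class: "(x, y) \<in> r" if "K \<in> Q" "x \<in> K" "y \<in> K" for K x y
    using in_quotient_imp_in_rel[OF eq, of K x y] that unfolding Q_def by blast
  have finK: "finite K" if "K \<in> Q" for K using Q_sub[OF that] fin finite_subset by blast
  have Q_complete: "complete_on B K" if "K \<in> Q" for K
    unfolding complete_on_def using Q_class[OF that] by (auto simp: r_def)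
  have S_adj: "(s, u) \<in> B" "(u, s) \<in> B" if "s \<in> S" "u \<in> V" "u \<noteq> s" for s u
    using that B'(2) unfolding S_def by (auto dest: symD)
  have parity: "even (card S + card F)"
  proof -
    have "card V = card S + card (V - S)"
      using card_Diff_subset[OF finS SV] card_mono[OF fin SV] by simp
    also have "card (V - S) = (\<Sum>K\<in>Q. card K)"
      unfolding Q_un[symmetric] by (rule card_Union_disjoint) (use Q_disj finK in \<open>auto simp: pairwise_def disjnt_def\<close>)
    finally have "even (card S + (\<Sum>K\<in>Q. card K))" using ev by simp
    moreover have "even (\<Sum>K\<in>Q. card K) = even (card F)"
      unfolding F_def by (rule even_sum_iff[OF finQ])
    ultimately show ?thesis by simp
  qed
  have cF: "card F \<ge> card S + 2"
  proof (rule ccontr)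
    assume "\<not> card F \<ge> card S + 2"
    then have "card F \<le> card S" using parity by presburger
    then obtain h where h: "h ` F \<subseteq> S" "inj_on h F"
      using card_le_inj[OF finF finS] by blast
    \<comment> \<open>With at most \<open>card S\<close> odd classes, each takes a private vertex of
      \<open>S\<close>. The enlarged classes, the even classes and the leftover part of
      \<open>S\<close> are all complete and of even size.\<close>
    define H where "H = (\<lambda>K. insert (h K) K) ` F \<union> (Q - F) \<union> {S - h ` F}"
    have FQ: "F \<subseteq> Q" by (auto simp: F_def)
    have hK: "h K \<in> S" "h K \<notin> L" if "K \<in> F" "L \<in> Q" for K L
      using h(1) Q_sub[OF that(2)] that(1) by auto
    have "matchable B (\<Union>H)"
    proof (rule matchable_Union)
      show "finite H" using finF finQ by (simp add: H_def)
    next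
      fix X assume "X \<in> H"
      then consider K where "K \<in> F" "X = insert (h K) K" | "X \<in> Q - F" | "X = S - h ` F"
        unfolding H_def by blast
      then show "matchable B X"
      proof cases
        case 1
        have KQ: "K \<in> Q" using 1 FQ by blast
        have "odd (card K)" using 1 by (simp add: F_def)
        then have "even (card X)" using 1 hK(2)[OF 1(1) KQ] finK[OF KQ] by simp
        moreover have "complete_on B X"
          using Q_complete[OF KQ] S_adj[OF hK(1)[OF 1(1) KQ]] Q_sub[OF KQ] hK(2)[OF 1(1) KQ]
          unfolding 1(2) complete_on_def by blast
        ultimately show ?thesis using 1 finK[OF KQ] by (intro matchable_complete) auto
      next
        case 2
        then show ?thesis using Q_complete[of X] finK[of X]
          by (intro matchable_complete) (auto simp: F_def)
      next
        case 3
        have "card (S - h ` F) = card S - card F"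
          using card_Diff_subset[of "h ` F" S] h finF by (simp add: card_image)
        then have "even (card X)" using parity \<open>card F \<le> card S\<close> 3 by simp
        moreover have "complete_on B X"
          using S_adj(1) SV unfolding 3 complete_on_def by blast
        ultimately show ?thesis using 3 finS by (intro matchable_complete) auto
      qed
    next
      fix X Y assume XY: "X \<in> H" "Y \<in> H" "X \<noteq> Y"
      have kind: "(\<exists>K\<in>F. X = insert (h K) K) \<or> X \<in> Q - F \<or> X = S - h ` F" if "X \<in> H" for X
        using that unfolding H_def by blast
      have FF: "insert (h K) K \<inter> insert (h L) L = {}" if "K \<in> F" "L \<in> F" "K \<noteq> L" for K L
      proof -
        have "h K \<noteq> h L" using that h(2) by (auto simp: inj_on_def)
        moreover have "K \<in> Q" "L \<in> Q" using that FQ by blast+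
        ultimately show ?thesis using hK(2) Q_disj that by auto
      qed
      have FQ': "insert (h K) K \<inter> L = {}" if "K \<in> F" "L \<in> Q - F" for K L
      proof -
        have "K \<in> Q" "L \<in> Q" "K \<noteq> L" using that FQ by blast+
        then show ?thesis using hK(2)[OF that(1)] Q_disj[of K L] by auto
      qed
      have FS: "insert (h K) K \<inter> (S - h ` F) = {}" if "K \<in> F" for K
        using Q_sub[of K] that FQ by blast
      have QS: "L \<inter> (S - h ` F) = {}" if "L \<in> Q - F" for L
        using Q_sub[of L] that by blast
      have QQ: "K \<inter> L = {}" if "K \<in> Q - F" "L \<in> Q - F" "K \<noteq> L" for K L
        using Q_disj that by blast
      show "X \<inter> Y = {}"
        using kind[OF XY(1)]
      proof (elim disjE bexE)
        fix K assume K: "K \<in> F" "X = insert (h K) K"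
        show ?thesis using kind[OF XY(2)] FF[OF K(1)] FQ'[OF K(1)] FS[OF K(1)] XY(3) unfolding K(2)
          by (elim disjE bexE) blast+
      next
        assume X: "X \<in> Q - F"
        show ?thesis using kind[OF XY(2)]
        proof (elim disjE bexE)
          fix L assume "L \<in> F" "Y = insert (h L) L"
          then show ?thesis using FQ'[of L X] X by blast
        next
          assume "Y \<in> Q - F" then show ?thesis using QQ[OF X _ XY(3)] by blast
        next
          assume "Y = S - h ` F" then show ?thesis using QS[OF X] by blast
        qed
      next
        assume X: "X = S - h ` F"
        show ?thesis using kind[OF XY(2)]
        proof (elim disjE bexE)
          fix L assume "L \<in> F" "Y = insert (h L) L"
          then show ?thesis using FS[of L] X by blast
        next
          assume "Y \<in> Q - F" then show ?thesis using QS[of Y] X by blast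
        next
          assume "Y = S - h ` F" then show ?thesis using XY(3) X by simp
        qed
      qed
    qed
    moreover have "\<Union>H = V"
    proof -
      have "\<Union>H = (\<Union>F \<union> \<Union>(Q - F)) \<union> (h ` F \<union> (S - h ` F))" unfolding H_def by blast
      also have "\<Union>F \<union> \<Union>(Q - F) = \<Union>Q" using FQ by blast
      also have "h ` F \<union> (S - h ` F) = S" using h(1) by blast
      finally show ?thesis using Q_un SV by blast
    qed
    ultimately show False using B'(4) by simp
  qed
  have leave: "y \<in> K \<union> S" if "K \<in> F" "x \<in> K" "(x, y) \<in> A" for K x y
  proof (cases "y \<in> S")
    case False
    have KQ: "K \<in> Q" using that by (simp add: F_def)
    have "(x, y) \<in> B" "y \<in> V" using that(3) B(2) B'(1) by blast+
    then have "(x, y) \<in> r" using False Q_sub[OF KQ] that(2) by (auto simp: r_def)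
    then have "y \<in> K"
      using in_quotient_imp_closed[OF eq, of K x y] KQ that(2) unfolding Q_def by blast
    then show ?thesis by blast
  qed simp
  show thesis
  proof (rule that[OF SV finF cF])
    fix K assume K: "K \<in> F"
    then show "K \<subseteq> V - S" using Q_sub[of K] by (simp add: F_def)
    show "odd (card K)" using K by (simp add: F_def)
  next
    fix K L assume "K \<in> F" "L \<in> F" "K \<noteq> L"
    then show "K \<inter> L = {}" by (intro Q_disj) (simp_all add: F_def)
  next
    fix K x y assume "K \<in> F" "x \<in> K" "(x, y) \<in> A"
    then show "y \<in> K \<union> S" by (rule leave)
  qed
qed

subsection \<open>Contracting triangles\<close>

context loopless_graph begin

text \<open>Once \<open>c\<close> covers one vertex of the triangle, the other two can be matched
  within it in exactly one way. Writing that side as \<open>K - ends G c\<close> spares later case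
  distinctions over the three vertices.\<close>

lemma triangle_opposite:
  assumes "triangle K" "c \<in> cut G K"
  obtains d where "d \<in> E" "ends G d = K - ends G c"
    "\<And>e. e \<in> E \<Longrightarrow> ends G e \<subseteq> K - ends G c \<Longrightarrow> e = d"
proof -
  obtain v1 v2 v3 c1 c2 c3 d1 d2 d3 where v: "distinct [v1, v2, v3]" "K = {v1, v2, v3}"
    and C: "cut G K = {c1, c2, c3}"
    and vc: "v1 \<in> ends G c1" "v2 \<in> ends G c2" "v3 \<in> ends G c3"
    and inner: "{e \<in> E. ends G e \<subseteq> K} = {d1, d2, d3}"
    and d: "ends G d1 = {v2, v3}" "ends G d2 = {v1, v3}" "ends G d3 = {v1, v2}"
    using assms(1) unfolding triangle_def by (elim exE conjE) (rule that)
  have one: "ends G c' \<inter> K = {x}" if "c' \<in> cut G K" "x \<in> ends G c'" "x \<in> K" for c' x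
  proof -
    have "card (ends G c' \<inter> K) = 1" using that(1) by (simp add: cut_def)
    then obtain z where z: "ends G c' \<inter> K = {z}" by (rule card_1_singletonE)
    have "x \<in> {z}" using that(2,3) unfolding z[symmetric] by blast
    then show ?thesis using z by simp
  qed
  have Ed: "d1 \<in> {e \<in> E. ends G e \<subseteq> K}" "d2 \<in> {e \<in> E. ends G e \<subseteq> K}" "d3 \<in> {e \<in> E. ends G e \<subseteq> K}"
    unfolding inner by simp_all
  have c123: "c1 \<in> cut G K" "c2 \<in> cut G K" "c3 \<in> cut G K" unfolding C by simp_all
  have vK: "v1 \<in> K" "v2 \<in> K" "v3 \<in> K" using v(2) by simp_all
  have off: "K - ends G c' = K - (ends G c' \<inter> K)" for c' by blast
  have e1: "K - ends G c1 = {v2, v3}"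
    unfolding off[of c1] one[OF c123(1) vc(1) vK(1)] unfolding v(2) using v(1) by auto
  have e2: "K - ends G c2 = {v1, v3}"
    unfolding off[of c2] one[OF c123(2) vc(2) vK(2)] unfolding v(2) using v(1) by auto
  have e3: "K - ends G c3 = {v1, v2}"
    unfolding off[of c3] one[OF c123(3) vc(3) vK(3)] unfolding v(2) using v(1) by auto
  have in3: "e = d1 \<or> e = d2 \<or> e = d3" if "e \<in> E" "ends G e \<subseteq> K" for e
  proof -
    have "e \<in> {d1, d2, d3}" unfolding inner[symmetric] using that by simp
    then show ?thesis by simp
  qed
  have res: "d' \<in> E \<and> ends G d' = K - ends G c \<and>
      (\<forall>e. e \<in> E \<longrightarrow> ends G e \<subseteq> K - ends G c \<longrightarrow> e = d')"
    if eq: "K - ends G c = ends G d'" and dd: "d' \<in> {d1, d2, d3}" for d'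
  proof -
    have "d' \<in> E" using dd Ed by auto
    moreover have "e = d'" if "e \<in> E" "ends G e \<subseteq> ends G d'" for e
    proof -
      have "ends G d' \<subseteq> K" using eq by blast
      then have "e = d1 \<or> e = d2 \<or> e = d3" using in3 that by blast
      then show ?thesis using that(2) dd d v(1) by auto
    qed
    ultimately show ?thesis using eq by simp
  qed
  have "c = c1 \<or> c = c2 \<or> c = c3" using assms(2) unfolding C by simp
  then have "\<exists>d'. d' \<in> E \<and> ends G d' = K - ends G c \<and>
      (\<forall>e. e \<in> E \<longrightarrow> ends G e \<subseteq> K - ends G c \<longrightarrow> e = d')"
  proof (elim disjE)
    assume "c = c1" then show ?thesis using res[of d1] e1 d(1) by auto
  next
    assume "c = c2" then show ?thesis using res[of d2] e2 d(2) by auto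
  next
    assume "c = c3" then show ?thesis using res[of d3] e3 d(3) by auto
  qed
  then show thesis using that by blast
qed

lemma tight_singleton:
  assumes "v \<in> V"
  shows "tight {v}" "cut G {v} = incident_edges G v"
proof -
  show c: "cut G {v} = incident_edges G v"
  proof (rule set_eqI)
    fix e show "e \<in> cut G {v} \<longleftrightarrow> e \<in> incident_edges G v"
    proof (cases "e \<in> E")
      case True
      then have "\<not> ends G e \<subseteq> {v}" using card_ends[OF True] card_mono[of "{v}" "ends G e"] by auto
      then show ?thesis using True by (auto simp: cut_iff incident_edges_def)
    qed (simp add: cut_def incident_edges_def)
  qed
  show "tight {v}"
    unfolding tight_def c
  proof (intro allI impI)
    fix M assume M: "perfect_matching G M"
    have "incident_edges G v \<inter> M = {edge_at M v}"
    proof (intro equalityI subsetI)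
      fix e assume "e \<in> incident_edges G v \<inter> M"
      then show "e \<in> {edge_at M v}"
        using edge_at_eqI[OF M, of e v] by (simp add: incident_edges_def)
    next
      fix e assume "e \<in> {edge_at M v}"
      then show "e \<in> incident_edges G v \<inter> M"
        using edge_at[OF M assms] edge_at_edge[OF M assms] by (simp add: incident_edges_def)
    qed
    then show "card (incident_edges G v \<inter> M) = 1" by simp
  qed
qed

end

context double_covered_graph begin

text \<open>Contracting triangles preserves the number of perfect matchings through an edge: a perfect
  matching of the contracted graph extends by the side opposite to the vertex of the triangle
  that is already covered.\<close>

lemma double_covered_contraction:
  fixes p :: "'a \<Rightarrow> 'c"
  assumes fib: "\<And>v. v \<in> V \<Longrightarrow> tight {u \<in> V. p u = p v} \<and>
      ({u \<in> V. p u = p v} = {v} \<or> triangle {u \<in> V. p u = p v})"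
  shows "double_covered_graph (quotient_graph p G)"
    and "\<And>v. v \<in> V \<Longrightarrow> incident_edges (quotient_graph p G) (p v) = cut G {u \<in> V. p u = p v}"
proof -
  let ?H = "quotient_graph p G"
  let ?K = "\<lambda>v. {u \<in> V. p u = p v}"
  interpret H: loopless_graph ?H by (rule loopless_quotient)
  have VH: "verts ?H = p ` V" and endsH: "ends ?H = (\<lambda>e. p ` ends G e)"
    by (simp_all add: quotient_graph_def)
  have EH: "e \<in> edges ?H \<longleftrightarrow> e \<in> E \<and> (\<forall>x y. ends G e = {x, y} \<longrightarrow> p x \<noteq> p y)" for e
  proof (cases "e \<in> E")
    case True
    obtain x y where "ends G e = {x, y}" "x \<noteq> y" "x \<in> V" "y \<in> V" by (rule ends_pair[OF True])
    then show ?thesis using True by (auto simp: quotient_graph_def doubleton_eq_iff card_insert_if)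
  qed (simp add: quotient_graph_def)
  show inc: "incident_edges ?H (p v) = cut G (?K v)" if v: "v \<in> V" for v
  proof (rule set_eqI)
    fix e show "e \<in> incident_edges ?H (p v) \<longleftrightarrow> e \<in> cut G (?K v)"
    proof (cases "e \<in> E")
      case True
      obtain x y where xy: "ends G e = {x, y}" "x \<noteq> y" "x \<in> V" "y \<in> V" by (rule ends_pair[OF True])
      have "e \<in> edges ?H \<longleftrightarrow> p x \<noteq> p y"
        unfolding EH using True xy(1) by (auto simp: doubleton_eq_iff)
      moreover have "p v \<in> ends ?H e \<longleftrightarrow> p x = p v \<or> p y = p v"
        unfolding endsH xy(1) by auto
      moreover have "ends G e \<inter> ?K v \<noteq> {} \<longleftrightarrow> p x = p v \<or> p y = p v"
        unfolding xy(1) using xy(3,4) by auto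
      moreover have "ends G e \<subseteq> ?K v \<longleftrightarrow> p x = p v \<and> p y = p v"
        unfolding xy(1) using xy(3,4) by auto
      ultimately show ?thesis
        using True by (simp add: incident_edges_def cut_iff) metis
    qed (simp add: cut_def incident_edges_def EH)
  qed
  have restrict: "perfect_matching ?H (M \<inter> edges ?H)" if M: "perfect_matching G M" for M
    unfolding perfect_matching_def
  proof (intro conjI ballI)
    fix w assume "w \<in> verts ?H"
    then obtain v where v: "v \<in> V" "w = p v" unfolding VH by blast
    have "card (cut G (?K v) \<inter> M) = 1" using fib[OF v(1)] M unfolding tight_def by blast
    then obtain c where c: "cut G (?K v) \<inter> M = {c}" by (rule card_1_singletonE)
    have "e \<in> M \<inter> edges ?H \<and> w \<in> ends ?H e \<longleftrightarrow> e = c" for e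
    proof -
      have "e \<in> M \<inter> edges ?H \<and> w \<in> ends ?H e \<longleftrightarrow> e \<in> incident_edges ?H (p v) \<inter> M"
        unfolding v(2) by (auto simp: incident_edges_def)
      also have "\<dots> \<longleftrightarrow> e \<in> {c}" unfolding inc[OF v(1)] c ..
      finally show ?thesis by simp
    qed
    then show "\<exists>!e. e \<in> M \<inter> edges ?H \<and> w \<in> ends ?H e" by simp
  qed simp
  have opp: "\<exists>d. d \<in> E \<and> ends G d = ?K v - ends G c \<and>
      (\<forall>e. e \<in> E \<longrightarrow> ends G e \<subseteq> ?K v - ends G c \<longrightarrow> e = d)"
    if v: "v \<in> V" and c: "c \<in> cut G (?K v)" and vc: "v \<notin> ends G c" for v c
  proof -
    have "?K v \<noteq> {v}"
    proof
      assume "?K v = {v}"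
      then have "c \<in> cut G {v}" using c by simp
      then show False using vc by (simp add: cut_iff)
    qed
    then have tri: "triangle (?K v)" using fib[OF v] by blast
    show ?thesis by (rule triangle_opposite[OF tri c]) blast
  qed
  \<comment> \<open>An edge lost in the contraction lies inside a triangle and avoids the matched
    cut edge \<open>c\<close> of that triangle, so it is the side opposite to the end of
    \<open>c\<close>.\<close>
  have inner: "edge_at M v \<in> edges ?H \<or> (\<exists>c. c \<in> M \<inter> edges ?H \<and> c \<in> cut G (?K v) \<and> v \<notin> ends G c \<and>
      ends G (edge_at M v) \<subseteq> ?K v - ends G c)"
    if M: "perfect_matching G M" and v: "v \<in> V" for M v
  proof (rule disjCI)
    let ?e = "edge_at M v"
    assume no: "\<not> (\<exists>c. c \<in> M \<inter> edges ?H \<and> c \<in> cut G (?K v) \<and> v \<notin> ends G c \<and> ends G ?e \<subseteq> ?K v - ends G c)"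
    show "?e \<in> edges ?H"
    proof (rule ccontr)
      assume e: "?e \<notin> edges ?H"
      have eE: "?e \<in> E" and eM: "?e \<in> M" and ve: "v \<in> ends G ?e"
        using edge_at[OF M v] edge_at_edge[OF M v] by simp_all
      have eK: "ends G ?e \<subseteq> ?K v"
      proof (rule ccontr)
        assume "\<not> ends G ?e \<subseteq> ?K v"
        then have "?e \<in> cut G (?K v)" using eE ve v by (auto simp: cut_iff)
        then show False using e unfolding inc[OF v, symmetric] by (simp add: incident_edges_def)
      qed
      have "card (cut G (?K v) \<inter> M) = 1" using fib[OF v] M unfolding tight_def by blast
      then obtain c where "cut G (?K v) \<inter> M = {c}" by (rule card_1_singletonE)
      then have c: "c \<in> cut G (?K v)" "c \<in> M" by blast+
      have cH: "c \<in> edges ?H" using c(1) unfolding inc[OF v, symmetric] by (simp add: incident_edges_def)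
      then have ce: "c \<noteq> ?e" using e by blast
      have dis: "x \<notin> ends G c" if "x \<in> ends G ?e" for x
        using edge_at_eqI[OF M c(2), of x] edge_at_eqI[OF M eM that] ce by auto
      then show False using no c cH eK ve by blast
    qed
  qed
  have inj: "M = M'"
    if M: "perfect_matching G M" and M': "perfect_matching G M'" and eq: "M \<inter> edges ?H = M' \<inter> edges ?H"
    for M M'
  proof (rule pm_ext[OF M M'])
    fix v assume v: "v \<in> V"
    have ve: "v \<in> ends G (edge_at M v)" "v \<in> ends G (edge_at M' v)"
      by (rule edge_at(2)[OF M v], rule edge_at(2)[OF M' v])
    show "edge_at M v = edge_at M' v"
      using inner[OF M v]
    proof
      assume "edge_at M v \<in> edges ?H"
      then have "edge_at M v \<in> M'" using edge_at(1)[OF M v] eq by blast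
      then show ?thesis using edge_at_eqI[OF M' _ ve(1)] by simp
    next
      assume "\<exists>c. c \<in> M \<inter> edges ?H \<and> c \<in> cut G (?K v) \<and> v \<notin> ends G c \<and> ends G (edge_at M v) \<subseteq> ?K v - ends G c"
      then obtain c where c: "c \<in> M \<inter> edges ?H" "c \<in> cut G (?K v)" "v \<notin> ends G c"
        "ends G (edge_at M v) \<subseteq> ?K v - ends G c" by blast
      obtain d where d: "\<And>e. e \<in> E \<Longrightarrow> ends G e \<subseteq> ?K v - ends G c \<Longrightarrow> e = d"
        using opp[OF v c(2,3)] by blast
      have 1: "edge_at M v = d" by (rule d[OF edge_at_edge[OF M v] c(4)])
      show ?thesis
        using inner[OF M' v]
      proof
        assume "edge_at M' v \<in> edges ?H"
        then have "edge_at M' v \<in> M" using edge_at(1)[OF M' v] eq by blast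
        then show ?thesis using edge_at_eqI[OF M _ ve(2)] by simp
      next
        assume "\<exists>c. c \<in> M' \<inter> edges ?H \<and> c \<in> cut G (?K v) \<and> v \<notin> ends G c \<and> ends G (edge_at M' v) \<subseteq> ?K v - ends G c"
        then obtain c' where c': "c' \<in> M' \<inter> edges ?H" "c' \<in> cut G (?K v)"
          "ends G (edge_at M' v) \<subseteq> ?K v - ends G c'" by blast
        have "card (cut G (?K v) \<inter> M) = 1" using fib[OF v] M unfolding tight_def by blast
        then obtain z where z: "cut G (?K v) \<inter> M = {z}" by (rule card_1_singletonE)
        have "c \<in> {z}" "c' \<in> {z}" unfolding z[symmetric] using c c' eq by blast+
        then have "c' = c" by simp
        then have "edge_at M' v = d" using d[OF edge_at_edge[OF M' v]] c'(3) by simp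
        then show ?thesis using 1 by simp
      qed
    qed
  qed
  have lift: "\<exists>M. perfect_matching G M \<and> M \<inter> edges ?H = N" if N: "perfect_matching ?H N" for N
  proof -
    define c where "c v = H.edge_at N (p v)" for v
    \<comment> \<open>The choice depends on the fibre and on \<open>c v\<close> only, so the two
      vertices that \<open>c v\<close> misses choose the same side.\<close>
    define m where "m v = (if v \<in> ends G (c v) then c v else SOME d. d \<in> E \<and> ends G d = ?K v - ends G (c v))" for v
    have c: "c v \<in> N" "c v \<in> edges ?H" "c v \<in> E" "c v \<in> cut G (?K v)" "p v \<in> ends ?H (c v)" if v: "v \<in> V" for v
    proof -
      have pv: "p v \<in> verts ?H" unfolding VH using v by blast
      show 1: "c v \<in> N" "p v \<in> ends ?H (c v)" "c v \<in> edges ?H"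
        unfolding c_def using H.edge_at[OF N pv] H.edge_at_edge[OF N pv] by simp_all
      then show "c v \<in> cut G (?K v)" unfolding inc[OF v, symmetric] by (simp add: incident_edges_def)
      then show "c v \<in> E" by (simp add: cut_def)
    qed
    have m_out: "m v \<in> E \<and> ends G (m v) = ?K v - ends G (c v)" if "v \<in> V" "v \<notin> ends G (c v)" for v
    proof -
      have "\<exists>d. d \<in> E \<and> ends G d = ?K v - ends G (c v)"
        using opp[OF that(1) c(4)[OF that(1)] that(2)] by blast
      from someI_ex[OF this] show ?thesis using that(2) by (simp add: m_def)
    qed
    have m1: "m v \<in> E" "v \<in> ends G (m v)" if "v \<in> V" for v
      using m_out[OF that] c(3)[OF that] that by (cases "v \<in> ends G (c v)"; simp add: m_def)+
    have m2: "m u = m v" if v: "v \<in> V" and u: "u \<in> ends G (m v)" for v u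
    proof (cases "v \<in> ends G (c v)")
      case True
      then have mv: "m v = c v" by (simp add: m_def)
      then have "p u \<in> ends ?H (c v)" using u unfolding endsH by simp
      then have "c u = c v" unfolding c_def[of u] by (rule H.edge_at_eqI[OF N c(1)[OF v]])
      then show ?thesis using u mv by (simp add: m_def)
    next
      case False
      then have uK: "u \<in> V" "p u = p v" "u \<notin> ends G (c v)" using m_out[OF v False] u by auto
      then have "c u = c v" by (simp add: c_def)
      then show ?thesis using uK False by (simp add: m_def)
    qed
    let ?M = "m ` V"
    have M: "perfect_matching G ?M" by (rule pm_of_fun(1)[OF m1 m2])
    have "?M \<inter> edges ?H = N"
    proof (intro equalityI subsetI)
      fix e assume e: "e \<in> ?M \<inter> edges ?H"
      then obtain v where v: "v \<in> V" "e = m v" by blast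
      show "e \<in> N"
      proof (cases "v \<in> ends G (c v)")
        case True
        then show ?thesis using v c(1) by (simp add: m_def)
      next
        case False
        have eE: "e \<in> E" using e EH by blast
        obtain x y where xy: "ends G e = {x, y}" "x \<noteq> y" "x \<in> V" "y \<in> V"
          by (rule ends_pair[OF eE])
        have "{x, y} \<subseteq> ?K v" using m_out[OF v(1) False] v(2) xy(1) by blast
        then have "p x = p y" by simp
        then show ?thesis using e xy(1) EH by blast
      qed
    next
      fix e assume e: "e \<in> N"
      then have eH: "e \<in> edges ?H" using H.pm_subset[OF N] by blast
      then have eE: "e \<in> E" using EH by blast
      obtain x y where xy: "ends G e = {x, y}" "x \<noteq> y" "x \<in> V" "y \<in> V" by (rule ends_pair[OF eE])
      have "p x \<in> ends ?H e" unfolding endsH xy(1) by simp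
      then have "c x = e" unfolding c_def by (rule H.edge_at_eqI[OF N e])
      then have "m x = e" using xy(1) by (simp add: m_def)
      then show "e \<in> ?M \<inter> edges ?H" using xy(3) eH by blast
    qed
    then show ?thesis using M by blast
  qed
  show "double_covered_graph ?H"
  proof
    fix e assume e: "e \<in> edges ?H"
    have "bij_betw (\<lambda>M. M \<inter> edges ?H) {M. perfect_matching G M \<and> e \<in> M} {N. perfect_matching ?H N \<and> e \<in> N}"
      unfolding bij_betw_def
    proof
      show "inj_on (\<lambda>M. M \<inter> edges ?H) {M. perfect_matching G M \<and> e \<in> M}"
        by (rule inj_onI) (use inj in blast)
      show "(\<lambda>M. M \<inter> edges ?H) ` {M. perfect_matching G M \<and> e \<in> M} = {N. perfect_matching ?H N \<and> e \<in> N}"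
      proof (intro equalityI subsetI)
        fix N assume "N \<in> (\<lambda>M. M \<inter> edges ?H) ` {M. perfect_matching G M \<and> e \<in> M}"
        then show "N \<in> {N. perfect_matching ?H N \<and> e \<in> N}" using restrict e by auto
      next
        fix N assume N: "N \<in> {N. perfect_matching ?H N \<and> e \<in> N}"
        then obtain M where M: "perfect_matching G M" "M \<inter> edges ?H = N" using lift by blast
        then have "e \<in> M" using N by blast
        then show "N \<in> (\<lambda>M. M \<inter> edges ?H) ` {M. perfect_matching G M \<and> e \<in> M}" using M by blast
      qed
    qed
    moreover have "e \<in> E" using e EH by blast
    ultimately show "card {N. perfect_matching ?H N \<and> e \<in> N} = 2"
      using double[of e] bij_betw_same_card by metis
  qed
qed

text \<open>If e and e' are parallel, then exchanging them in the two perfect matchings through e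
  gives four perfect matchings; at a vertex where the two perfect matchings through the third edge
  at their end differ, this forces four different edges.\<close>

lemma cubic_no_parallel:
  assumes cubic: "\<And>v. v \<in> V \<Longrightarrow> card (incident_edges G v) = 3"
    and e: "e \<in> E" "e' \<in> E" "ends G e = ends G e'"
  shows "e = e'"
proof (rule ccontr)
  assume ne: "e \<noteq> e'"
  obtain u w where uw: "ends G e = {u, w}" "u \<noteq> w" "u \<in> V" "w \<in> V" by (rule ends_pair[OF e(1)])
  have third: "\<exists>g. incident_edges G x = {e, e', g} \<and> g \<noteq> e \<and> g \<noteq> e'" if x: "x \<in> {u, w}" for x
  proof -
    have xV: "x \<in> V" using x uw by blast
    have fin: "finite (incident_edges G x)"
      by (rule finite_subset[OF _ finite_E]) (auto simp: incident_edges_def)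
    have sub: "{e, e'} \<subseteq> incident_edges G x" using x uw e by (auto simp: incident_edges_def)
    have "card (incident_edges G x - {e, e'}) = 1"
      using cubic[OF xV] card_Diff_subset[OF _ sub] ne by simp
    then obtain g where g: "incident_edges G x - {e, e'} = {g}" by (rule card_1_singletonE)
    have "incident_edges G x = {e, e'} \<union> (incident_edges G x - {e, e'})" using sub by blast
    also have "\<dots> = {e, e', g}" unfolding g by auto
    finally have "incident_edges G x = {e, e', g}" .
    moreover have "g \<in> incident_edges G x - {e, e'}" unfolding g by simp
    ultimately show ?thesis by blast
  qed
  obtain g where g: "incident_edges G u = {e, e', g}" "g \<noteq> e" "g \<noteq> e'" using third[of u] by blast
  obtain h where h: "incident_edges G w = {e, e', h}" "h \<noteq> e" "h \<noteq> e'" using third[of w] by blast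
  have "g \<in> incident_edges G u" unfolding g(1) by simp
  then have gE: "g \<in> E" "u \<in> ends G g" by (auto simp: incident_edges_def)
  obtain N N' where NN': "N \<noteq> N'" and N: "perfect_matching G N" "g \<in> N"
    and N': "perfect_matching G N'" "g \<in> N'" by (rule pm_through[OF gE(1)])
  obtain P Q where PQ: "P \<noteq> Q" and P: "perfect_matching G P" "e \<in> P"
    and Q: "perfect_matching G Q" "e \<in> Q" by (rule pm_through[OF e(1)])
  have only: "f = edge_at R x" if "perfect_matching G R" "f \<in> R" "x \<in> ends G f" for R f x
    using edge_at_eqI[OF that] by simp
  have not_e: "e \<notin> R \<and> e' \<notin> R" if "perfect_matching G R" "g \<in> R" for R
    using only[OF that(1) that(2) gE(2)] only[OF that(1), of e u] only[OF that(1), of e' u] uw(1) e(3) g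
    by auto
  have not_e': "e' \<notin> R" if "perfect_matching G R" "e \<in> R" for R
    using only[OF that(1), of e u] only[OF that(1), of e' u] that(2) uw(1) e(3) ne by auto
  \<comment> \<open>The matching with \<open>e\<close> exchanged for \<open>e'\<close>; it agrees
    with \<open>R\<close> away from \<open>u\<close> and \<open>w\<close>.\<close>
  define sw where "sw R = (\<lambda>v. if edge_at R v = e then e' else edge_at R v) ` V" for R
  have sw: "perfect_matching G (sw R)" "e' \<in> sw R" "e \<notin> sw R"
    "\<And>v. v \<in> V \<Longrightarrow> v \<notin> {u, w} \<Longrightarrow> edge_at R v \<in> sw R"
    if R: "perfect_matching G R" "e \<in> R" for R
  proof -
    let ?m = "\<lambda>v. if edge_at R v = e then e' else edge_at R v"
    have at: "edge_at R v = e \<longleftrightarrow> v \<in> {u, w}" if "v \<in> V" for v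
      using edge_at(2)[OF R(1) that] edge_at_eqI[OF R, of v] uw(1) by auto
    have 1: "?m v \<in> E" if "v \<in> V" for v using edge_at_edge[OF R(1) that] e(2) by simp
    have 2: "v \<in> ends G (?m v)" if "v \<in> V" for v
      using edge_at(2)[OF R(1) that] e(3) by (cases "edge_at R v = e") auto
    have 3: "?m x = ?m v" if v: "v \<in> V" and x: "x \<in> ends G (?m v)" for v x
    proof (cases "edge_at R v = e")
      case True
      then have "x \<in> {u, w}" using x uw(1) e(3) by simp
      then have "edge_at R x = e" using edge_at_eqI[OF R, of x] uw(1) by simp
      then show ?thesis using True by simp
    next
      case False
      then have "edge_at R x = edge_at R v"
        using x edge_at_eqI[OF R(1) edge_at(1)[OF R(1) v], of x] by simp
      then show ?thesis by simp
    qed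
    show "perfect_matching G (sw R)" unfolding sw_def by (rule pm_of_fun(1)[OF 1 2 3])
    have "?m u = e'" using at[OF uw(3)] by simp
    then show "e' \<in> sw R" unfolding sw_def by (rule image_eqI[OF sym uw(3)])
    show "e \<notin> sw R" unfolding sw_def using ne by auto
    show "edge_at R v \<in> sw R" if "v \<in> V" "v \<notin> {u, w}" for v
      unfolding sw_def using at[OF that(1)] that by (intro image_eqI[of _ _ v]) auto
  qed
  \<comment> \<open>\<open>z\<close> is neither \<open>u\<close>, which both matchings cover by
    \<open>g\<close>, nor \<open>w\<close>, which both cover by its third edge \<open>h\<close>.
    Hence exchanging \<open>e\<close> and \<open>e'\<close> does not affect the edge used at
    \<open>z\<close>.\<close>
  obtain z where z: "z \<in> V" "edge_at N z \<noteq> edge_at N' z"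
    using pm_ext[OF N(1) N'(1)] NN' by blast
  have zu: "z \<noteq> u"
    using z(2) only[OF N(1) N(2) gE(2)] only[OF N'(1) N'(2) gE(2)] by auto
  have zw: "z \<noteq> w"
  proof
    assume zw: "z = w"
    have "edge_at R w = h" if R: "perfect_matching G R" "g \<in> R" for R
    proof -
      have "edge_at R w \<in> incident_edges G w"
        using edge_at(2)[OF R(1) uw(4)] edge_at_edge[OF R(1) uw(4)] by (simp add: incident_edges_def)
      moreover have "edge_at R w \<noteq> e" "edge_at R w \<noteq> e'"
        using not_e[OF R] edge_at(1)[OF R(1) uw(4)] by auto
      ultimately show ?thesis unfolding h(1) by simp
    qed
    then show False using z(2) N N' zw by simp
  qed
  have zz: "z \<notin> {u, w}" using zu zw by simp
  have inc: "edge_at R z \<in> incident_edges G z" if "perfect_matching G R" for R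
    using edge_at(2)[OF that z(1)] edge_at_edge[OF that z(1)] by (simp add: incident_edges_def)
  \<comment> \<open>The edge of \<open>R\<close> at \<open>z\<close> also belongs to
    \<open>sw R\<close>, so no further perfect matching may use it.\<close>
  have differ: "edge_at L z \<noteq> edge_at R z"
    if R: "perfect_matching G R" "e \<in> R" and L: "perfect_matching G L" "L \<noteq> R" "e' \<notin> L" for L R
  proof
    assume eq: "edge_at L z = edge_at R z"
    have "R = sw R \<or> R = L \<or> sw R = L"
      by (rule three_pms[OF edge_at_edge[OF R(1) z(1)] R(1) sw(1)[OF R] L(1)])
        (use edge_at(1)[OF R(1) z(1)] sw(4)[OF R z(1) zz] edge_at(1)[OF L(1) z(1)] eq in simp_all)
    moreover have "R \<noteq> sw R" using R(2) sw(3)[OF R] by auto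
    moreover have "sw R \<noteq> L" using L(3) sw(2)[OF R] by auto
    ultimately show False using L(2) by auto
  qed
  have "N \<noteq> P" "N \<noteq> Q" "N' \<noteq> P" "N' \<noteq> Q"
    using not_e[OF N] not_e[OF N'] P Q by auto
  then have "distinct [edge_at N z, edge_at N' z, edge_at P z, edge_at Q z]"
    using z(2) differ[OF P N(1)] differ[OF Q N(1)] differ[OF P N'(1)] differ[OF Q N'(1)]
      differ[OF Q P(1) PQ] not_e[OF N] not_e[OF N'] not_e'[OF P] by auto
  then have "card {edge_at N z, edge_at N' z, edge_at P z, edge_at Q z} = 4" by simp
  moreover have "card {edge_at N z, edge_at N' z, edge_at P z, edge_at Q z} \<le> card (incident_edges G z)"
  proof (rule card_mono)
    show "finite (incident_edges G z)"
      by (rule finite_subset[OF _ finite_E]) (auto simp: incident_edges_def)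
  qed (use inc N N' P Q in simp)
  ultimately show False using cubic[OF z(1)] by simp
qed

subsection \<open>Bipartite cubic graphs\<close>

lemma finite_incident: "finite (incident_edges G v)"
  by (rule finite_subset[OF _ finite_E]) (auto simp: incident_edges_def)

lemma edge_at_incident: "perfect_matching G M \<Longrightarrow> v \<in> V \<Longrightarrow> edge_at M v \<in> incident_edges G v"
  using edge_at(2) edge_at_edge by (simp add: incident_edges_def)

lemma even_card_V: "perfect_matching G M \<Longrightarrow> even (card V)"
  by (rule even_card_closed[OF finite_V, of "partner M"]) (simp_all add: partner)

lemma pm_of_matchable:
  assumes "D \<subseteq> E" and m: "matchable {(x, y). x \<in> V \<and> y \<in> V \<and> (\<exists>e\<in>D. ends G e = {x, y})} V"
  obtains M where "perfect_matching G M" "M \<subseteq> D"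
proof -
  obtain m where m: "\<And>x. x \<in> V \<Longrightarrow> m x \<in> V \<and> m (m x) = x \<and> (\<exists>e\<in>D. ends G e = {x, m x})"
    using m unfolding matchable_def by blast
  \<comment> \<open>The choice is made for the unordered pair, hence is the same at \<open>x\<close>
    and at \<open>m x\<close>.\<close>
  define c where "c x = (SOME e. e \<in> D \<and> ends G e = {x, m x})" for x
  have c: "c x \<in> D" "ends G (c x) = {x, m x}" if "x \<in> V" for x
  proof -
    have "\<exists>e. e \<in> D \<and> ends G e = {x, m x}" using m[OF that] by blast
    from someI_ex[OF this] show "c x \<in> D" "ends G (c x) = {x, m x}" by (simp_all add: c_def)
  qed
  have const: "c u = c x" if x: "x \<in> V" and u: "u \<in> ends G (c x)" for x u
  proof -
    consider "u = x" | "u = m x" using u c(2)[OF x] by auto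
    then show ?thesis
    proof cases
      case 2
      have "{m x, m (m x)} = {x, m x}" using m[OF x] by auto
      then show ?thesis unfolding 2 c_def by simp
    qed simp
  qed
  have 1: "c x \<in> E" if "x \<in> V" for x using c(1)[OF that] assms(1) by blast
  have 2: "x \<in> ends G (c x)" if "x \<in> V" for x using c(2)[OF that] by simp
  have "perfect_matching G (c ` V)" by (rule pm_of_fun(1)[OF 1 2 const])
  moreover have "c ` V \<subseteq> D" using c(1) by blast
  ultimately show thesis by (rule that)
qed

context
  fixes A B
  assumes cubic: "\<And>v. v \<in> V \<Longrightarrow> card (incident_edges G v) = 3"
    and AB: "A \<union> B = V" "A \<inter> B = {}"
    and bip: "\<And>e x y. e \<in> E \<Longrightarrow> ends G e = {x, y} \<Longrightarrow> x \<in> A \<longleftrightarrow> y \<in> B"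
begin

lemma bip_ends:
  assumes "e \<in> E"
  obtains x y where "ends G e = {x, y}" "x \<in> A" "y \<in> B"
proof -
  obtain x y where xy: "ends G e = {x, y}" "x \<noteq> y" "x \<in> V" "y \<in> V" by (rule ends_pair[OF assms])
  show thesis
  proof (cases "x \<in> A")
    case True
    then show ?thesis using that[of x y] xy bip[OF assms xy(1)] by simp
  next
    case False
    then have "x \<in> B" using xy AB by blast
    moreover have yx: "ends G e = {y, x}" using xy(1) by (simp add: insert_commute)
    ultimately show ?thesis using that[OF yx] bip[OF assms yx] by simp
  qed
qed

text \<open>Deleting \<open>P\<close> leaves a 2-regular bipartite graph. If it had no perfect
  matching, each of the more than \<open>card S\<close> odd sets of a Tutte barrier would send two
  edges of its own to \<open>S\<close>, where only twice \<open>card S\<close> edges are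
  available.\<close>

lemma disjoint_pm:
  assumes P: "perfect_matching G P"
  obtains P' where "perfect_matching G P'" "P \<inter> P' = {}"
proof -
  define D where "D = E - P"
  define R where "R = {(x, y). x \<in> V \<and> y \<in> V \<and> (\<exists>e\<in>D. ends G e = {x, y})}"
  have "matchable R V"
  proof (rule ccontr)
    assume no: "\<not> matchable R V"
    have R: "R \<subseteq> V \<times> V" "sym R" "irrefl R"
    proof -
      show "R \<subseteq> V \<times> V" by (auto simp: R_def)
      show "sym R" unfolding sym_def R_def by (auto simp: insert_commute)
      show "irrefl R"
      proof (rule irreflI)
        fix x show "(x, x) \<notin> R"
        proof
          assume "(x, x) \<in> R"
          then obtain e where "e \<in> E" "ends G e = {x, x}" by (auto simp: R_def D_def)
          then show False using card_ends[of e] by simp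
        qed
      qed
    qed
    obtain S F where SV: "S \<subseteq> V" and F: "finite F" "card F \<ge> card S + 2"
      and K: "\<And>K. K \<in> F \<Longrightarrow> K \<subseteq> V - S" "\<And>K. K \<in> F \<Longrightarrow> odd (card K)"
      and disj: "\<And>K L. K \<in> F \<Longrightarrow> L \<in> F \<Longrightarrow> K \<noteq> L \<Longrightarrow> K \<inter> L = {}"
      and leave: "\<And>K x y. K \<in> F \<Longrightarrow> x \<in> K \<Longrightarrow> (x, y) \<in> R \<Longrightarrow> y \<in> K \<union> S"
      by (rule tutte[OF finite_V even_card_V[OF P] R no], rule that)
    define I where "I U = {e \<in> D. ends G e \<inter> U \<noteq> {}}" for U
    have finD: "finite D" using finite_E by (simp add: D_def)
    have I_UN: "I U = (\<Union>u\<in>U. incident_edges G u - P)" for U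
      by (auto simp: I_def D_def incident_edges_def)
    have two: "card (incident_edges G u - P) = 2" if u: "u \<in> V" for u
    proof -
      have "incident_edges G u - P = incident_edges G u - {edge_at P u}"
      proof (rule set_eqI)
        fix e show "e \<in> incident_edges G u - P \<longleftrightarrow> e \<in> incident_edges G u - {edge_at P u}"
          using edge_at_eqI[OF P, of e u] edge_at(1)[OF P u] by (auto simp: incident_edges_def)
      qed
      then show ?thesis
        using cubic[OF u] edge_at_incident[OF P u] finite_incident by simp
    qed
    have I_card: "card (I U) = 2 * card U" if U: "U \<subseteq> A \<or> U \<subseteq> B" for U
    proof -
      have UV: "U \<subseteq> V" using U AB by blast
      have "card (I U) = (\<Sum>u\<in>U. card (incident_edges G u - P))"
        unfolding I_UN
      proof (rule card_UN_disjoint)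
        show "finite U" using UV finite_V finite_subset by blast
        show "\<forall>i\<in>U. finite (incident_edges G i - P)" using finite_incident by simp
        show "\<forall>i\<in>U. \<forall>j\<in>U. i \<noteq> j \<longrightarrow> (incident_edges G i - P) \<inter> (incident_edges G j - P) = {}"
        proof (intro ballI impI, rule ccontr)
          fix i j assume ij: "i \<in> U" "j \<in> U" "i \<noteq> j"
            and ne: "(incident_edges G i - P) \<inter> (incident_edges G j - P) \<noteq> {}"
          then obtain e where e: "e \<in> E" "i \<in> ends G e" "j \<in> ends G e"
            by (auto simp: incident_edges_def)
          obtain x y where xy: "ends G e = {x, y}" "x \<in> A" "y \<in> B" by (rule bip_ends[OF e(1)])
          have "i \<in> {x, y}" "j \<in> {x, y}" using e(2,3) unfolding xy(1) .
          then have "x \<in> U \<and> y \<in> U" using ij by auto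
          then show False using U AB(2) xy(2,3) by blast
        qed
      qed
      also have "\<dots> = (\<Sum>u\<in>U. 2)" by (rule sum.cong) (use two UV in auto)
      finally show ?thesis by simp
    qed
    \<comment> \<open>An odd \<open>L\<close> splits unevenly between \<open>A\<close> and
      \<open>B\<close>. The edges at either part number twice its size, so the two counts differ by
      at least 2, and an edge counted on one side only leaves \<open>L\<close>.\<close>
    have "2 \<le> card (D \<inter> cut G L)" if L: "L \<in> F" for L
    proof (rule ccontr)
      assume small: "\<not> 2 \<le> card (D \<inter> cut G L)"
      let ?a = "I (L \<inter> A)" and ?b = "I (L \<inter> B)"
      have fin: "finite ?a" "finite ?b" using finD by (simp_all add: I_def)
      have LV: "L \<subseteq> V" using K(1)[OF L] by blast
      have sub: "(?a - ?b) \<union> (?b - ?a) \<subseteq> D \<inter> cut G L"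
      proof
        fix e assume e: "e \<in> (?a - ?b) \<union> (?b - ?a)"
        then have eD: "e \<in> D" by (auto simp: I_def)
        then have eE: "e \<in> E" by (simp add: D_def)
        obtain x y where xy: "ends G e = {x, y}" "x \<in> A" "y \<in> B" by (rule bip_ends[OF eE])
        have "x \<in> L \<longleftrightarrow> y \<notin> L" using e eD xy AB(2) unfolding I_def by auto
        then show "e \<in> D \<inter> cut G L" using eD eE xy(1) by (auto simp: cut_iff)
      qed
      have "card (?a - ?b) + card (?b - ?a) = card ((?a - ?b) \<union> (?b - ?a))"
        by (rule card_Un_disjoint[symmetric]) (use fin in auto)
      also have "\<dots> \<le> card (D \<inter> cut G L)" by (rule card_mono[OF _ sub]) (use finD in simp)
      finally have le1: "card (?a - ?b) + card (?b - ?a) \<le> 1" using small by simp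
      have "card ?a = card (?a - ?b) + card (?a \<inter> ?b)" "card ?b = card (?b - ?a) + card (?a \<inter> ?b)"
        using card_Int_Diff[OF fin(1), of ?b] card_Int_Diff[OF fin(2), of ?a]
        by (simp_all add: Int_commute)
      moreover have "card ?a = 2 * card (L \<inter> A)" "card ?b = 2 * card (L \<inter> B)"
        by (rule I_card; blast)+
      ultimately have "card (L \<inter> A) = card (L \<inter> B)" using le1 by presburger
      moreover have "card L = card (L \<inter> A) + card (L \<inter> B)"
      proof -
        have finL: "finite L" using LV finite_V finite_subset by blast
        have "L = (L \<inter> A) \<union> (L \<inter> B)" using LV AB(1) by blast
        then have "card L = card ((L \<inter> A) \<union> (L \<inter> B))" by simp
        also have "\<dots> = card (L \<inter> A) + card (L \<inter> B)"
          by (rule card_Un_disjoint) (use finL AB(2) in auto)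
        finally show ?thesis .
      qed
      ultimately show False using K(2)[OF L] by simp
    qed
    then have "2 * card F \<le> (\<Sum>L\<in>F. card (D \<inter> cut G L))"
      using sum_mono[of F "\<lambda>_. 2" "\<lambda>L. card (D \<inter> cut G L)"] by simp
    also have "\<dots> = card (\<Union>L\<in>F. D \<inter> cut G L)"
    proof (rule card_UN_disjoint[symmetric, OF F(1)])
      show "\<forall>i\<in>F. finite (D \<inter> cut G i)" using finD by simp
      have far: "y \<in> S" if "L \<in> F" "e \<in> D" "ends G e = {x, y}" "x \<in> L" "y \<notin> L" for L e x y
      proof -
        have "e \<in> E" using that(2) by (simp add: D_def)
        then have "(x, y) \<in> R" using ends_subset[of e] that by (auto simp: R_def)
        then show ?thesis using leave[OF that(1,4)] that(5) by blast
      qed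
      show "\<forall>i\<in>F. \<forall>j\<in>F. i \<noteq> j \<longrightarrow> (D \<inter> cut G i) \<inter> (D \<inter> cut G j) = {}"
      proof (intro ballI impI, rule ccontr)
        fix i j assume ij: "i \<in> F" "j \<in> F" "i \<noteq> j" and "(D \<inter> cut G i) \<inter> (D \<inter> cut G j) \<noteq> {}"
        then obtain e where e: "e \<in> D" "e \<in> cut G i" "e \<in> cut G j" by blast
        then obtain x where x: "x \<in> ends G e" "x \<in> i" by (auto simp: cut_iff)
        have eE: "e \<in> E" using e(1) by (simp add: D_def)
        have xy: "ends G e = {x, other_end e x}" by (rule ends_other_end(1)[OF eE x(1)])
        have "other_end e x \<notin> i" using e(2) x xy by (auto simp: cut_iff)
        then have "other_end e x \<in> S" using far[OF ij(1) e(1) xy x(2)] by simp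
        then show False using e(3) xy x(2) K(1)[OF ij(2)] disj[OF ij] by (auto simp: cut_iff)
      qed
    qed
    also have "\<dots> \<le> card (I S)"
    proof (rule card_mono)
      show "finite (I S)" using finD by (simp add: I_def)
      show "(\<Union>L\<in>F. D \<inter> cut G L) \<subseteq> I S"
      proof
        fix e assume "e \<in> (\<Union>L\<in>F. D \<inter> cut G L)"
        then obtain L where L: "L \<in> F" "e \<in> D" "e \<in> cut G L" by blast
        then obtain x where x: "x \<in> ends G e" "x \<in> L" by (auto simp: cut_iff)
        have eE: "e \<in> E" using L(2) by (simp add: D_def)
        note xy = ends_other_end[OF eE x(1)]
        have "other_end e x \<notin> L" using L(3) x xy(1) by (auto simp: cut_iff)
        moreover have "(x, other_end e x) \<in> R"
          using xy L(2) ends_subset[OF eE] x(1) by (auto simp: R_def)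
        ultimately have "other_end e x \<in> S" using leave[OF L(1) x(2)] by blast
        then show "e \<in> I S" using L(2) xy(1) by (auto simp: I_def)
      qed
    qed
    also have "\<dots> \<le> (\<Sum>u\<in>S. card (incident_edges G u - P))"
      unfolding I_UN by (rule card_UN_le) (use SV finite_V finite_subset in blast)
    also have "\<dots> = (\<Sum>u\<in>S. 2)" by (rule sum.cong) (use two SV in auto)
    also have "\<dots> = 2 * card S" by simp
    finally show False using F(2) by simp
  qed
  then obtain P' where "perfect_matching G P'" "P' \<subseteq> D"
    unfolding R_def by (rule pm_of_matchable[rotated]) (auto simp: D_def)
  then show thesis by (intro that[of P']) (auto simp: D_def)
qed

text \<open>Two disjoint perfect matchings form a Hamiltonian cycle, since otherwise they generate four
  perfect matchings covering their union twice, and the third edges at the vertices would lie in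
  one perfect matching only. Each of these third edges is a chord of the cycle and completes
  to a perfect matching of its own; but there are just six perfect matchings.\<close>

lemma bipartite_cubic_bound: "card A \<le> 3"
proof (cases "A = {}")
  case False
  then obtain v where vA: "v \<in> A" by blast
  then have v: "v \<in> V" using AB by blast
  have "incident_edges G v \<noteq> {}" using cubic[OF v] by auto
  then obtain e0 where "e0 \<in> E" by (auto simp: incident_edges_def)
  then obtain P where P: "perfect_matching G P" by (rule pm_through)
  obtain P' where P': "perfect_matching G P'" and PP': "P \<inter> P' = {}" by (rule disjoint_pm[OF P])
  have third: "\<exists>t. incident_edges G z - {edge_at P z, edge_at P' z} = {t}" if z: "z \<in> V" for z
  proof -
    have ne: "edge_at P z \<noteq> edge_at P' z" using edge_at(1)[OF P z] edge_at(1)[OF P' z] PP' by auto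
    have "card (incident_edges G z - {edge_at P z, edge_at P' z}) = 1"
      using card_Diff_subset[of "{edge_at P z, edge_at P' z}" "incident_edges G z"]
        edge_at_incident[OF P z] edge_at_incident[OF P' z] cubic[OF z] ne by simp
    then show ?thesis by (simp add: card_1_singleton_iff)
  qed
  then obtain t where t: "\<And>z. z \<in> V \<Longrightarrow> incident_edges G z - {edge_at P z, edge_at P' z} = {t z}"
    by metis
  have tI: "t z \<in> incident_edges G z" "t z \<notin> P" "t z \<notin> P'" if z: "z \<in> V" for z
  proof -
    have "t z \<in> incident_edges G z - {edge_at P z, edge_at P' z}" unfolding t[OF z] by simp
    then show "t z \<in> incident_edges G z" "t z \<notin> P" "t z \<notin> P'"
      using edge_at_eqI[OF P, of "t z" z] edge_at_eqI[OF P', of "t z" z]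
      by (auto simp: incident_edges_def)
  qed
  have t_eq: "e = t z" if z: "z \<in> V" and e: "e \<in> incident_edges G z" "e \<notin> P" "e \<notin> P'" for e z
  proof -
    have "e \<in> incident_edges G z - {edge_at P z, edge_at P' z}"
      using e edge_at(1)[OF P z] edge_at(1)[OF P' z] by auto
    then show ?thesis unfolding t[OF z] by simp
  qed
  define a where "a = alt (partner P) (partner P') v"
  interpret two_involutions V "partner P" "partner P'" by (rule two_involutions_partners[OF P P'])
  obtain n where n: "0 < n" "even n" "a n = v" "inj_on a {..<n}" "partner P' v = a (n - 1)"
    "\<And>w. w \<in> a ` {..<n} \<Longrightarrow> partner P w \<in> a ` {..<n}"
    "\<And>w. w \<in> a ` {..<n} \<Longrightarrow> partner P' w \<in> a ` {..<n}" "a ` {..<n} \<subseteq> V"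
    using alt_cycle[OF v] unfolding a_def by blast
  have a0: "a 0 = v" by (simp add: a_def)
  have V_eq: "a ` {..<n} = V"
  proof (rule ccontr)
    let ?W = "a ` {..<n}"
    assume "?W \<noteq> V"
    then obtain x where x: "x \<in> V" "x \<notin> ?W" using n(8) by blast
    have cl: "partner P ` ?W \<subseteq> ?W" "partner P' ` ?W \<subseteq> ?W" using n(6,7) by blast+
    have vW: "v \<in> ?W" using a0 n(1) by (metis imageI lessThan_iff)
    \<comment> \<open>Exchanging \<open>P\<close> and \<open>P'\<close> on the cycle or off it gives
      two more perfect matchings inside their union, so each edge of the union already lies in two
      of these four.\<close>
    define Q1 where "Q1 = (\<lambda>x. if x \<in> ?W then edge_at P x else edge_at P' x) ` V"
    define Q2 where "Q2 = (\<lambda>x. if x \<in> ?W then edge_at P' x else edge_at P x) ` V"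
    note q1 = pm_patch[OF P P' cl, folded Q1_def] and q2 = pm_patch[OF P' P cl(2,1), folded Q2_def]
    have sub: "Q1 \<subseteq> P \<union> P'" "Q2 \<subseteq> P \<union> P'"
      using edge_at(1)[OF P] edge_at(1)[OF P'] by (auto simp: Q1_def Q2_def)
    have ne: "edge_at P z \<noteq> edge_at P' z" if "z \<in> V" for z
      using edge_at(1)[OF P that] edge_at(1)[OF P' that] PP' by auto
    have d: "P \<noteq> Q1" "P \<noteq> Q2" "P' \<noteq> Q1" "P' \<noteq> Q2"
    proof -
      show "P \<noteq> Q1" using q1(2)[OF x(1)] x(2) ne[OF x(1)] by auto
      show "P \<noteq> Q2" using q2(2)[OF v] vW ne[OF v] by auto
      show "P' \<noteq> Q1" using q1(2)[OF v] vW ne[OF v] by auto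
      show "P' \<noteq> Q2" using q2(2)[OF x(1)] x(2) ne[OF x(1)] by auto
    qed
    have gE: "t v \<in> E" using tI(1)[OF v] by (simp add: incident_edges_def)
    obtain R1 R2 where R12: "R1 \<noteq> R2" and R1: "perfect_matching G R1" "t v \<in> R1"
      and R2: "perfect_matching G R2" "t v \<in> R2" by (rule pm_through[OF gE])
    \<comment> \<open>A matching containing \<open>t v\<close> differs from those four, so it has to
      avoid the edges of \<open>P\<close> and \<open>P'\<close> everywhere; this determines it
      completely.\<close>
    have "edge_at R z = t z" if R: "perfect_matching G R" "t v \<in> R" and z: "z \<in> V" for R z
    proof -
      let ?e = "edge_at R z"
      have eE: "?e \<in> E" and eR: "?e \<in> R" and ze: "z \<in> ends G ?e"
        using edge_at[OF R(1) z] edge_at_edge[OF R(1) z] by simp_all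
      have RR: "R \<noteq> P" "R \<noteq> P'" "R \<noteq> Q1" "R \<noteq> Q2" using R(2) tI(2,3)[OF v] sub by auto
      have nP: "?e \<notin> P"
      proof
        assume eP: "?e \<in> P"
        then have "edge_at P z = ?e" using edge_at_eqI[OF P eP ze] by simp
        then have "?e \<in> Q1 \<or> ?e \<in> Q2"
          using q1(2)[OF z] q2(2)[OF z] edge_at(1)[OF q1(1) z] edge_at(1)[OF q2(1) z]
          by (cases "z \<in> ?W") auto
        then show False
        proof
          assume "?e \<in> Q1"
          from three_pms[OF eE R(1) P q1(1) eR eP this] show False using RR d by simp
        next
          assume "?e \<in> Q2"
          from three_pms[OF eE R(1) P q2(1) eR eP this] show False using RR d by simp
        qed
      qed
      have nP': "?e \<notin> P'"
      proof
        assume eP: "?e \<in> P'"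
        then have "edge_at P' z = ?e" using edge_at_eqI[OF P' eP ze] by simp
        then have "?e \<in> Q1 \<or> ?e \<in> Q2"
          using q1(2)[OF z] q2(2)[OF z] edge_at(1)[OF q1(1) z] edge_at(1)[OF q2(1) z]
          by (cases "z \<in> ?W") auto
        then show False
        proof
          assume "?e \<in> Q1"
          from three_pms[OF eE R(1) P' q1(1) eR eP this] show False using RR d by simp
        next
          assume "?e \<in> Q2"
          from three_pms[OF eE R(1) P' q2(1) eR eP this] show False using RR d by simp
        qed
      qed
      show ?thesis by (rule t_eq[OF z edge_at_incident[OF R(1) z] nP nP'])
    qed
    then have "R1 = R2" by (intro pm_ext[OF R1(1) R2(1)]) (use R1 R2 in simp)
    then show False using R12 by simp
  qed
  have aV: "a i \<in> V" for i unfolding a_def by (rule alt_in[OF v])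
  have a_side: "a i \<in> A \<longleftrightarrow> even i" for i
  proof (induction i)
    case 0
    then show ?case using vA a0 by simp
  next
    case (Suc i)
    define M where "M = (if even i then P else P')"
    have M: "perfect_matching G M" using P P' by (simp add: M_def)
    have "a (Suc i) = partner M (a i)" by (simp add: a_def M_def)
    then have "ends G (edge_at M (a i)) = {a i, a (Suc i)}" using partner(1)[OF M aV] by simp
    from bip[OF edge_at_edge[OF M aV] this] have "a i \<in> A \<longleftrightarrow> a (Suc i) \<in> B" .
    moreover have "a (Suc i) \<in> A \<longleftrightarrow> a (Suc i) \<notin> B" using aV[of "Suc i"] AB by blast
    ultimately show ?case using Suc.IH by simp
  qed
  obtain h where h: "n = 2 * h" using n(2) by (elim evenE)
  \<comment> \<open>The third edge at an even position ends at an odd one, since the positions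
    alternate between \<open>A\<close> and \<open>B\<close>. A single chord of odd length satisfies
    the parity condition of \<open>hamiltonian_switch\<close>.\<close>
  have "\<exists>Q. perfect_matching G Q \<and> t (a (2 * k)) \<in> Q \<and> (\<forall>f\<in>Q. f = t (a (2 * k)) \<or> f \<in> P \<or> f \<in> P')"
    if k: "k < h" for k
  proof -
    let ?e = "t (a (2 * k))"
    have kn: "2 * k < n" using k h by simp
    have e: "?e \<in> E" "a (2 * k) \<in> ends G ?e" using tI(1)[OF aV] by (auto simp: incident_edges_def)
    define y where "y = other_end ?e (a (2 * k))"
    have y: "ends G ?e = {a (2 * k), y}" "y \<in> V"
      unfolding y_def by (rule ends_other_end[OF e])+
    obtain l where l: "l < n" "y = a l" using y(2) V_eq by blast
    have "y \<in> B" using bip[OF e(1) y(1)] a_side by simp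
    then have "odd l" using a_side[of l] l(2) AB by auto
    define i j where "i = min (2 * k) l" and "j = max (2 * k) l"
    have ij: "i < j" "j < n" "even i \<noteq> even j" "{i, j} = {2 * k, l}"
    proof -
      have "2 * k \<noteq> l" using \<open>odd l\<close> by auto
      then show "i < j" "j < n" "even i \<noteq> even j" "{i, j} = {2 * k, l}"
        using kn l(1) \<open>odd l\<close> by (auto simp: i_def j_def min_def max_def)
    qed
    have en: "ends G ?e = {a i, a j}"
    proof -
      have "{a i, a j} = a ` {2 * k, l}" using ij(4) by (metis image_insert image_empty)
      then show ?thesis using y(1) l(2) by simp
    qed
    obtain Q where Q: "perfect_matching G Q"
      and eQ: "\<And>p. p < n \<Longrightarrow> edge_at Q (a p) = (if p \<in> {i, j} then ?e
        else if even i = even (rank {i, j} p) then edge_at P (a p) else edge_at P' (a p))"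
    proof (rule hamiltonian_switch[OF P P' v a_def n(1-5) V_eq])
      have "i < n" using ij(1,2) by linarith
      then show "{i, j} \<subseteq> {..<n}" using ij(2) by simp
      show "even (card {i, j})" using ij(1) by simp
      show "even p = (even i = even (rank {i, j} p))" if "p \<in> {i, j}" for p
        using that rank_2[OF ij(1)] ij(3) by auto
      show "?e \<in> E \<and> (\<exists>q\<in>{i, j}. ends G ?e = {a p, a q} \<and> ?e = ?e)" if "p \<in> {i, j}" for p
        using that e(1) en by auto
    qed (rule that)
    have "edge_at Q (a i) = ?e" using eQ[of i] ij(1,2) by simp
    then have "?e \<in> Q" using edge_at(1)[OF Q aV[of i]] by simp
    moreover have "f = ?e \<or> f \<in> P \<or> f \<in> P'" if f: "f \<in> Q" for f
    proof -
      have "f \<in> edge_at Q ` V" using f pm_eq_image[OF Q] by simp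
      then obtain x where x: "x \<in> V" "f = edge_at Q x" by (rule imageE)
      then have "x \<in> a ` {..<n}" using V_eq by simp
      then obtain p where "p < n" "x = a p" by blast
      then have p: "p < n" "f = edge_at Q (a p)" using x by simp_all
      show ?thesis
        unfolding p(2) eQ[OF p(1)] using edge_at(1)[OF P aV] edge_at(1)[OF P' aV] by simp
    qed
    ultimately show ?thesis using Q by blast
  qed
  then have "\<forall>k\<in>{..<h}. \<exists>Q. perfect_matching G Q \<and> t (a (2 * k)) \<in> Q \<and>
    (\<forall>f\<in>Q. f = t (a (2 * k)) \<or> f \<in> P \<or> f \<in> P')" by simp
  from bchoice[OF this] obtain N where N: "\<And>k. k < h \<Longrightarrow> perfect_matching G (N k)"
    "\<And>k. k < h \<Longrightarrow> t (a (2 * k)) \<in> N k"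
    "\<And>k f. k < h \<Longrightarrow> f \<in> N k \<Longrightarrow> f = t (a (2 * k)) \<or> f \<in> P \<or> f \<in> P'" by auto
  have t_inj: "t (a (2 * k)) \<noteq> t (a (2 * k'))" if kk: "k < h" "k' < h" "k \<noteq> k'" for k k'
  proof
    assume eq: "t (a (2 * k)) = t (a (2 * k'))"
    let ?e = "t (a (2 * k))"
    have e: "?e \<in> E" "a (2 * k) \<in> ends G ?e" "a (2 * k') \<in> ends G ?e"
      using tI(1)[OF aV[of "2 * k"]] tI(1)[OF aV[of "2 * k'"]] eq by (auto simp: incident_edges_def)
    obtain x y where xy: "ends G ?e = {x, y}" "x \<in> A" "y \<in> B" by (rule bip_ends[OF e(1)])
    have "a (2 * k) \<in> A" "a (2 * k') \<in> A" using a_side by simp_all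
    then have "a (2 * k) = a (2 * k')" using e xy AB(2) by auto
    then show False using inj_on_eq_iff[OF n(4), of "2 * k" "2 * k'"] kk h by simp
  qed
  define T where "T = t ` V"
  have T: "perfect_matching G T"
    unfolding T_def
  proof (rule pm_of_fun(1))
    show "t z \<in> E" "z \<in> ends G (t z)" if "z \<in> V" for z
      using tI(1)[OF that] by (simp_all add: incident_edges_def)
    show "t u = t z" if z: "z \<in> V" and u: "u \<in> ends G (t z)" for z u
    proof -
      have E: "t z \<in> E" using tI(1)[OF z] by (simp add: incident_edges_def)
      then have uV: "u \<in> V" using u ends_subset by blast
      have "t z \<in> incident_edges G u" using E u by (simp add: incident_edges_def)
      from t_eq[OF uV this tI(2,3)[OF z]] show ?thesis by simp
    qed
  qed
  have hA: "card A \<le> h"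
  proof -
    have "A \<subseteq> (\<lambda>k. a (2 * k)) ` {..<h}"
    proof
      fix x assume x: "x \<in> A"
      then obtain i where i: "i < n" "x = a i" using AB V_eq by blast
      then have "even i" using x a_side by simp
      then obtain k where "i = 2 * k" by (elim evenE)
      then show "x \<in> (\<lambda>k. a (2 * k)) ` {..<h}" using i h by auto
    qed
    then have "card A \<le> card ((\<lambda>k. a (2 * k)) ` {..<h})" by (intro card_mono) auto
    also have "\<dots> \<le> h" using card_image_le[of "{..<h}" "\<lambda>k. a (2 * k)"] by simp
    finally show ?thesis .
  qed
  have "h \<le> 3"
  proof (rule ccontr)
    assume h4: "\<not> h \<le> 3"
    have N_inj: "inj_on N {..<h}"
    proof (rule inj_onI)
      fix k k' assume kk: "k \<in> {..<h}" "k' \<in> {..<h}" "N k = N k'"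
      show "k = k'"
      proof (rule ccontr)
        assume "k \<noteq> k'"
        have "t (a (2 * k)) \<in> N k'" using N(2)[of k] kk by simp
        then show False
          using N(3)[of k' "t (a (2 * k))"] t_inj[of k k'] tI(2,3)[OF aV[of "2 * k"]] kk \<open>k \<noteq> k'\<close> by simp
      qed
    qed
    have PN: "P \<noteq> N k" "P' \<noteq> N k" "T \<noteq> N k" if k: "k < h" for k
    proof -
      show "P \<noteq> N k" "P' \<noteq> N k" using N(2)[OF k] tI(2,3)[OF aV[of "2 * k"]] by auto
      \<comment> \<open>Any index other than \<open>k\<close> will do: \<open>T\<close> contains all
        the third edges, \<open>N k\<close> only one of them.\<close>
      define k' where "k' = (if k = 0 then 1 else 0 :: nat)"
      have k': "k' < h" "k' \<noteq> k" using h4 by (auto simp: k'_def)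
      have "t (a (2 * k')) \<in> T" using aV by (simp add: T_def)
      moreover have "t (a (2 * k')) \<notin> N k"
        using N(3)[OF k, of "t (a (2 * k'))"] t_inj[OF k'(1) k k'(2)] tI(2,3)[OF aV[of "2 * k'"]] by auto
      ultimately show "T \<noteq> N k" by auto
    qed
    have tT: "t v \<in> T" using v by (simp add: T_def)
    have dPT: "P \<noteq> T" "P' \<noteq> T" using tT tI(2,3)[OF v] by auto
    have "P \<noteq> P'" using PP' edge_at(1)[OF P v] by auto
    then have c3: "card {P, P', T} = 3" using dPT by simp
    have "card ({P, P', T} \<union> N ` {..<h}) = 3 + h"
      using card_Un_disjoint[of "{P, P', T}" "N ` {..<h}"] PN c3 card_image[OF N_inj] by auto
    moreover have "card ({P, P', T} \<union> N ` {..<h}) \<le> card PM"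
      by (rule card_mono[OF finite_PM]) (use P P' T N(1) in auto)
    moreover have "card PM = 6" using card_PM_incident[OF v] cubic[OF v] by simp
    ultimately show False using h4 by simp
  qed
  then show ?thesis using hA by simp
qed simp

end

end

subsection \<open>Barriers\<close>

lemma matchable_mono: "matchable A X \<Longrightarrow> A \<subseteq> B \<Longrightarrow> matchable B X"
  unfolding matchable_def by blast

lemma matchable_pair:
  assumes "(x, y) \<in> A" "(y, x) \<in> A"
  shows "matchable A {x, y}"
  by (rule matchableI[of _ "\<lambda>z. if z = x then y else x"]) (use assms in auto)

context loopless_graph begin

lemma cut_Int_end:
  assumes "c \<in> cut G K" "x \<in> ends G c" "x \<in> K"
  shows "ends G c \<inter> K = {x}"
proof -
  have "card (ends G c \<inter> K) = 1" using assms(1) by (simp add: cut_def)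
  then obtain z where z: "ends G c \<inter> K = {z}" by (rule card_1_singletonE)
  have "x \<in> {z}" using assms(2,3) unfolding z[symmetric] by blast
  then show ?thesis using z by simp
qed

lemma triangle_card: "triangle K \<Longrightarrow> card K = 3"
  unfolding triangle_def by (elim exE conjE) simp

text \<open>The three cut edges leave at three different vertices, so a vertex of the triangle
  identifies its cut edge.\<close>

lemma triangle_cut_unique:
  assumes "triangle K" "c \<in> cut G K" "c' \<in> cut G K" "x \<in> K" "x \<in> ends G c" "x \<in> ends G c'"
  shows "c = c'"
proof -
  obtain v1 v2 v3 c1 c2 c3 where v: "distinct [v1, v2, v3]" "K = {v1, v2, v3}"
    and C: "cut G K = {c1, c2, c3}" and vc: "v1 \<in> ends G c1" "v2 \<in> ends G c2" "v3 \<in> ends G c3"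
    using assms(1) unfolding triangle_def by (elim exE conjE) (rule that)
  have vK: "v1 \<in> K" "v2 \<in> K" "v3 \<in> K" using v(2) by simp_all
  have cC: "c1 \<in> cut G K" "c2 \<in> cut G K" "c3 \<in> cut G K" using C by simp_all
  have vi: "(b = c1 \<and> x = v1) \<or> (b = c2 \<and> x = v2) \<or> (b = c3 \<and> x = v3)"
    if b: "b \<in> cut G K" "x \<in> ends G b" for b
  proof -
    have x: "x \<in> ends G b \<inter> K" using b(2) assms(4) by simp
    have "b = c1 \<or> b = c2 \<or> b = c3" using b(1) unfolding C by simp
    then show ?thesis
    proof (elim disjE)
      assume "b = c1" then show ?thesis using x cut_Int_end[OF cC(1) vc(1) vK(1)] by simp
    next
      assume "b = c2" then show ?thesis using x cut_Int_end[OF cC(2) vc(2) vK(2)] by simp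
    next
      assume "b = c3" then show ?thesis using x cut_Int_end[OF cC(3) vc(3) vK(3)] by simp
    qed
  qed
  show ?thesis using vi[OF assms(2,5)] vi[OF assms(3,6)] v(1) by auto
qed

end

context double_covered_graph begin

text \<open>Contracting \<open>X\<close> alone keeps the graph cubic and double covered, and two cut
  edges to the same \<open>y\<close> would become parallel.\<close>

lemma triangle_neighbours_distinct:
  assumes cubic: "\<And>v. v \<in> V \<Longrightarrow> card (incident_edges G v) = 3"
    and X: "triangle X" "tight X"
    and c: "c \<in> cut G X" "c' \<in> cut G X" "ends G c = {v, y}" "ends G c' = {v', y}" "v \<in> X" "v' \<in> X" "y \<notin> X"
  shows "c = c'"
proof -
  have XV: "X \<subseteq> V" by (rule triangle_subset[OF X(1)])
  let ?p = "\<lambda>u. if u \<in> X then v else u"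
  have fib: "{u \<in> V. ?p u = ?p w} = (if w \<in> X then X else {w})" if "w \<in> V" for w
    using c(5) XV that by auto
  have 1: "tight {u \<in> V. ?p u = ?p w} \<and> ({u \<in> V. ?p u = ?p w} = {w} \<or> triangle {u \<in> V. ?p u = ?p w})"
    if "w \<in> V" for w
    unfolding fib[OF that] using X tight_singleton(1)[OF that] by simp
  interpret H: double_covered_graph "quotient_graph ?p G"
    by (rule double_covered_contraction(1)[OF 1])
  have cub: "card (incident_edges (quotient_graph ?p G) w) = 3" if w: "w \<in> H.V" for w
  proof -
    obtain u where u: "u \<in> V" "w = ?p u" using w by (auto simp: quotient_graph_def)
    have "incident_edges (quotient_graph ?p G) w = cut G {x \<in> V. ?p x = ?p u}"
      unfolding u(2) by (rule double_covered_contraction(2)[OF 1 u(1)])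
    moreover have "card (cut G {x \<in> V. ?p x = ?p u}) = card (incident_edges G u)"
      by (rule card_cut_incident) (use 1[OF u(1)] u(1) in simp_all)
    ultimately show ?thesis using cubic[OF u(1)] by simp
  qed
  have vy: "v \<noteq> y" using c(5,7) by auto
  have im: "?p ` ends G c = {v, y}" "?p ` ends G c' = {v, y}" using c(3-7) by auto
  have "c \<in> E" "c' \<in> E" using c(1,2) by (simp_all add: cut_def)
  then have "c \<in> H.E" "c' \<in> H.E"
    using im vy by (simp_all add: quotient_graph_def)
  moreover have "ends (quotient_graph ?p G) c = ends (quotient_graph ?p G) c'"
    using im by (simp add: quotient_graph_def)
  ultimately show ?thesis using H.cubic_no_parallel[OF cub, of c c'] by blast
qed

text \<open>By tightness, G has no perfect matching through all three edges leaving the triangle, so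
  Tutte's theorem applies to the rest of G.\<close>

lemma triangle_barrier:
  assumes cubic: "\<And>v. v \<in> V \<Longrightarrow> card (incident_edges G v) = 3"
    and X: "triangle X" "tight X" and ex: "perfect_matching G M0"
  obtains S F where "S \<subseteq> V" "finite F" "card S \<ge> 3" "card F \<ge> card S"
    "\<And>K. K \<in> F \<Longrightarrow> K \<subseteq> V - S" "\<And>K. K \<in> F \<Longrightarrow> odd (card K)"
    "\<And>K L. K \<in> F \<Longrightarrow> L \<in> F \<Longrightarrow> K \<noteq> L \<Longrightarrow> K \<inter> L = {}"
    "\<And>K e x y. K \<in> F \<Longrightarrow> e \<in> E \<Longrightarrow> ends G e = {x, y} \<Longrightarrow> x \<in> K \<Longrightarrow> y \<in> K \<union> S"
proof -
  have XV: "X \<subseteq> V" by (rule triangle_subset[OF X(1)])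
  obtain v1 v2 v3 c1 c2 c3 where v: "distinct [v1, v2, v3]" "X = {v1, v2, v3}"
    and C: "distinct [c1, c2, c3]" "cut G X = {c1, c2, c3}"
    and vc: "v1 \<in> ends G c1" "v2 \<in> ends G c2" "v3 \<in> ends G c3"
    using X(1) unfolding triangle_def by (elim exE conjE) (rule that)
  have vX: "v1 \<in> X" "v2 \<in> X" "v3 \<in> X" using v(2) by simp_all
  have cC: "c1 \<in> cut G X" "c2 \<in> cut G X" "c3 \<in> cut G X" using C by simp_all
  have cE: "c1 \<in> E" "c2 \<in> E" "c3 \<in> E" using cC by (simp_all add: cut_def)
  define y1 y2 y3 where "y1 = other_end c1 v1" and "y2 = other_end c2 v2" and "y3 = other_end c3 v3"
  have ce: "ends G c1 = {v1, y1}" "ends G c2 = {v2, y2}" "ends G c3 = {v3, y3}"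
    and yne: "y1 \<noteq> v1" "y2 \<noteq> v2" "y3 \<noteq> v3" and yV: "y1 \<in> V" "y2 \<in> V" "y3 \<in> V"
    unfolding y1_def y2_def y3_def
    using ends_other_end[OF cE(1) vc(1)] ends_other_end[OF cE(2) vc(2)] ends_other_end[OF cE(3) vc(3)]
    by simp_all
  have yX: "y1 \<notin> X" "y2 \<notin> X" "y3 \<notin> X"
    using cut_Int_end[OF cC(1) vc(1) vX(1)] cut_Int_end[OF cC(2) vc(2) vX(2)]
      cut_Int_end[OF cC(3) vc(3) vX(3)] ce yne by auto
  have yd: "y1 \<noteq> y2" "y1 \<noteq> y3" "y2 \<noteq> y3"
  proof -
    show "y1 \<noteq> y2"
      using triangle_neighbours_distinct[OF cubic X cC(1,2) ce(1) _ vX(1,2) yX(1)] ce(2) C(1) by auto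
    show "y1 \<noteq> y3"
      using triangle_neighbours_distinct[OF cubic X cC(1,3) ce(1) _ vX(1,3) yX(1)] ce(3) C(1) by auto
    show "y2 \<noteq> y3"
      using triangle_neighbours_distinct[OF cubic X cC(2,3) ce(2) _ vX(2,3) yX(2)] ce(3) C(1) by auto
  qed
  define Y where "Y = {y1, y2, y3}"
  have cardY: "card Y = 3" using yd by (simp add: Y_def)
  have cardX: "card X = 3" by (rule triangle_card[OF X(1)])
  have YX: "Y \<inter> X = {}" "Y \<subseteq> V" using yX yV by (auto simp: Y_def)
  define U where "U = V - X - Y"
  have finU: "finite U" "finite X" "finite Y" using finite_V XV finite_subset by (auto simp: U_def Y_def)
  have Vsplit: "V = U \<union> (X \<union> Y)" using XV YX by (auto simp: U_def)
  have "card V = card U + card (X \<union> Y)"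
    unfolding Vsplit by (subst card_Un_disjoint) (use finU in \<open>auto simp: U_def\<close>)
  moreover have "card (X \<union> Y) = 6"
    using card_Un_disjoint[OF finU(2,3)] YX cardX cardY by (simp add: Int_commute)
  ultimately have evU: "even (card U)" using even_card_V[OF ex] by simp
  define R where "R = {(x, y). x \<in> U \<and> y \<in> U \<and> (\<exists>e\<in>E. ends G e = {x, y})}"
  have eX: "y \<in> X \<union> Y" if e: "e \<in> E" "ends G e = {x, y}" "x \<in> X" for e x y
  proof (cases "y \<in> X")
    case False
    then have "e \<in> cut G X" using e by (auto simp: cut_iff)
    then have "e = c1 \<or> e = c2 \<or> e = c3" unfolding C by simp
    then have "{x, y} = {v1, y1} \<or> {x, y} = {v2, y2} \<or> {x, y} = {v3, y3}" using ce e(2) by auto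
    then show ?thesis using False vX by (auto simp: Y_def doubleton_eq_iff)
  qed simp
  have no: "\<not> matchable R U"
  proof
    assume m: "matchable R U"
    let ?D = "{c1, c2, c3} \<union> {e \<in> E. ends G e \<subseteq> U}"
    let ?A = "{(x, y). x \<in> V \<and> y \<in> V \<and> (\<exists>e\<in>?D. ends G e = {x, y})}"
    have "R \<subseteq> ?A" unfolding R_def U_def by auto
    then have mU: "matchable ?A U" by (rule matchable_mono[OF m])
    have pairs: "(v1, y1) \<in> ?A" "(y1, v1) \<in> ?A" "(v2, y2) \<in> ?A" "(y2, v2) \<in> ?A" "(v3, y3) \<in> ?A" "(y3, v3) \<in> ?A"
      using ce vX XV yV by (auto simp: insert_commute)
    have ne: "v1 \<noteq> y2" "v1 \<noteq> y3" "v2 \<noteq> y1" "v2 \<noteq> y3" "v3 \<noteq> y1" "v3 \<noteq> y2" using vX yX by auto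
    have "matchable ?A ({v1, y1} \<union> {v2, y2})"
      by (rule matchable_Un[OF matchable_pair[OF pairs(1,2)] matchable_pair[OF pairs(3,4)]])
        (use v(1) yd ne in auto)
    then have "matchable ?A (({v1, y1} \<union> {v2, y2}) \<union> {v3, y3})"
      by (rule matchable_Un[OF _ matchable_pair[OF pairs(5,6)]]) (use v(1) yd ne in auto)
    then have "matchable ?A (U \<union> (({v1, y1} \<union> {v2, y2}) \<union> {v3, y3}))"
      by (rule matchable_Un[OF mU]) (use vX in \<open>auto simp: U_def Y_def\<close>)
    moreover have "U \<union> (({v1, y1} \<union> {v2, y2}) \<union> {v3, y3}) = V"
      unfolding Vsplit v(2) Y_def by auto
    ultimately have mV: "matchable ?A V" by simp
    have "?D \<subseteq> E" using cE by auto
    then obtain M where M: "perfect_matching G M" "M \<subseteq> ?D" by (rule pm_of_matchable[OF _ mV])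
    have vV: "v1 \<in> V" "v2 \<in> V" using vX XV by blast+
    have vU: "v1 \<notin> U" "v2 \<notin> U" using vX by (auto simp: U_def)
    have "edge_at M v1 \<in> ?D" "v1 \<in> ends G (edge_at M v1)" "edge_at M v2 \<in> ?D" "v2 \<in> ends G (edge_at M v2)"
      using edge_at[OF M(1) vV(1)] edge_at[OF M(1) vV(2)] M(2) by blast+
    then have "edge_at M v1 = c1" "edge_at M v2 = c2"
      using vU ce ne v(1) by auto
    then have "{c1, c2} \<subseteq> cut G X \<inter> M" using edge_at(1)[OF M(1) vV(1)] edge_at(1)[OF M(1) vV(2)] cC by auto
    moreover have "card (cut G X \<inter> M) = 1" using X(2) M(1) by (simp add: tight_def)
    ultimately have "card {c1, c2} \<le> 1"
      using card_mono[of "cut G X \<inter> M" "{c1, c2}"] by (simp add: card_ge_0_finite)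
    then show False using C(1) by simp
  qed
  have R: "R \<subseteq> U \<times> U" "sym R" "irrefl R"
  proof -
    show "R \<subseteq> U \<times> U" by (auto simp: R_def)
    show "sym R" unfolding sym_def R_def by (auto simp: insert_commute)
    show "irrefl R"
    proof (rule irreflI)
      fix x show "(x, x) \<notin> R"
      proof
        assume "(x, x) \<in> R"
        then obtain e where "e \<in> E" "ends G e = {x, x}" by (auto simp: R_def)
        then show False using card_ends[of e] by simp
      qed
    qed
  qed
  obtain S F where S: "S \<subseteq> U" and F: "finite F" "card F \<ge> card S + 2"
    and K: "\<And>K. K \<in> F \<Longrightarrow> K \<subseteq> U - S" "\<And>K. K \<in> F \<Longrightarrow> odd (card K)"
    and disj: "\<And>K L. K \<in> F \<Longrightarrow> L \<in> F \<Longrightarrow> K \<noteq> L \<Longrightarrow> K \<inter> L = {}"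
    and leave: "\<And>K x y. K \<in> F \<Longrightarrow> x \<in> K \<Longrightarrow> (x, y) \<in> R \<Longrightarrow> y \<in> K \<union> S"
    by (rule tutte[OF finU(1) evU R no], rule that)
  have UX: "U \<inter> X = {}" "U \<inter> Y = {}" "U \<subseteq> V" by (auto simp: U_def)
  have XF: "X \<notin> F" using K(1)[of X] UX vX(1) by blast
  have finS: "finite S" using S finU(1) finite_subset by blast
  have cS: "card (S \<union> Y) = card S + 3"
    using card_Un_disjoint[OF finS finU(3)] S UX cardY by (metis disjoint_iff subsetD)
  \<comment> \<open>\<open>Y\<close> adds 3 to the barrier and \<open>X\<close> adds one component;
    Tutte's surplus of two makes up for the rest, so there are still at least as many components as
    barrier vertices.\<close>
  show thesis
  proof (rule that[of "S \<union> Y" "insert X F"])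
    show "S \<union> Y \<subseteq> V" using S UX YX by blast
    show "finite (insert X F)" using F by simp
    show "card (S \<union> Y) \<ge> 3" using cS by simp
    show "card (insert X F) \<ge> card (S \<union> Y)" using cS F XF by simp
  next
    fix K' assume K': "K' \<in> insert X F"
    show "K' \<subseteq> V - (S \<union> Y)"
      using K(1)[of K'] K' S UX YX XV by blast
    show "odd (card K')" using K(2)[of K'] K' cardX by auto
  next
    fix K' L assume "K' \<in> insert X F" "L \<in> insert X F" "K' \<noteq> L"
    then show "K' \<inter> L = {}" using disj[of K' L] K(1)[of K'] K(1)[of L] UX by blast
  next
    fix K' e x y assume K': "K' \<in> insert X F" and e: "e \<in> E" "ends G e = {x, y}" and x: "x \<in> K'"
    show "y \<in> K' \<union> (S \<union> Y)"
    proof (cases "K' = X")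
      case True
      then show ?thesis using eX[OF e] x by blast
    next
      case False
      then have KF: "K' \<in> F" using K' by blast
      then have xU: "x \<in> U" using K(1) x by blast
      have yx: "ends G e = {y, x}" using e(2) by (simp add: insert_commute)
      have "y \<notin> X" using eX[OF e(1) yx] xU UX by blast
      moreover have "y \<in> V" using ends_subset[OF e(1)] e(2) by blast
      ultimately have "y \<in> Y \<or> y \<in> U" by (auto simp: U_def)
      then show ?thesis
      proof
        assume "y \<in> U"
        then have "(x, y) \<in> R" using xU e by (auto simp: R_def)
        then show ?thesis using leave[OF KF x] by blast
      qed simp
    qed
  qed
qed

text \<open>Every perfect matching matches each odd component to a vertex of the barrier, and there
  are at least as many components as vertices of the barrier.\<close>

lemma barrier_tight:
  assumes con: "connected_graph G" and ex: "perfect_matching G M0"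
    and S: "S \<subseteq> V" "card S > 0" and F: "finite F" "card F \<ge> card S"
    and K: "\<And>K. K \<in> F \<Longrightarrow> K \<subseteq> V - S" "\<And>K. K \<in> F \<Longrightarrow> odd (card K)"
    and disj: "\<And>K L. K \<in> F \<Longrightarrow> L \<in> F \<Longrightarrow> K \<noteq> L \<Longrightarrow> K \<inter> L = {}"
    and leave: "\<And>K e x y. K \<in> F \<Longrightarrow> e \<in> E \<Longrightarrow> ends G e = {x, y} \<Longrightarrow> x \<in> K \<Longrightarrow> y \<in> K \<union> S"
  shows "card F = card S" "V = S \<union> \<Union>F" "\<And>K. K \<in> F \<Longrightarrow> tight K"
    "\<And>e x y. e \<in> E \<Longrightarrow> ends G e = {x, y} \<Longrightarrow> x \<in> S \<Longrightarrow> \<exists>K\<in>F. y \<in> K"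
proof -
  have finS: "finite S" using S finite_V finite_subset by blast
  \<comment> \<open>Each odd component has a vertex \<open>k L\<close> matched into
    \<open>S\<close>. These partners are distinct, so by the sizes they exhaust \<open>S\<close>:
    every barrier vertex is the partner of exactly one \<open>k L\<close>.\<close>
  have main: "\<exists>k. bij_betw (\<lambda>L. partner M (k L)) F S \<and> (\<forall>L\<in>F. k L \<in> L)"
    if M: "perfect_matching G M" for M
  proof -
    have "\<exists>x. x \<in> L \<and> partner M x \<in> S" if L: "L \<in> F" for L
    proof (rule ccontr)
      assume no: "\<not> (\<exists>x. x \<in> L \<and> partner M x \<in> S)"
      have LV: "x \<in> V" if "x \<in> L" for x using K(1)[OF L] that by blast
      have cl: "partner M x \<in> L" if "x \<in> L" for x
        using leave[OF L edge_at_edge[OF M LV[OF that]] partner(1)[OF M LV[OF that]] that] no that by blast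
      have finL: "finite L" using K(1)[OF L] finite_V finite_subset by blast
      have "even (card L)"
        by (rule even_card_closed[OF finL cl]) (use partner(2,5)[OF M LV] in simp_all)
      then show False using K(2)[OF L] by simp
    qed
    then have "\<forall>L\<in>F. \<exists>x. x \<in> L \<and> partner M x \<in> S" by simp
    from bchoice[OF this] obtain k where k: "\<And>L. L \<in> F \<Longrightarrow> k L \<in> L" "\<And>L. L \<in> F \<Longrightarrow> partner M (k L) \<in> S"
      by blast
    let ?h = "\<lambda>L. partner M (k L)"
    have inj: "inj_on ?h F"
    proof (rule inj_onI)
      fix L L' assume L: "L \<in> F" "L' \<in> F" "?h L = ?h L'"
      have "k L \<in> V" "k L' \<in> V" using k(1) K(1) L(1,2) by blast+
      then have "k L = k L'" using partner(5)[OF M] L(3) by metis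
      then show "L = L'" using disj[OF L(1,2)] k(1)[OF L(1)] k(1)[OF L(2)] by auto
    qed
    have sub: "?h ` F \<subseteq> S" using k(2) by blast
    have "?h ` F = S"
      by (rule card_seteq[OF finS sub]) (use F(2) card_image[OF inj] in simp)
    then show ?thesis using inj k(1) unfolding bij_betw_def by blast
  qed
  show cF: "card F = card S"
    using main[OF ex] bij_betw_same_card by blast
  have S_out: "\<exists>L\<in>F. partner M s \<in> L \<and> (\<forall>L'\<in>F. \<forall>x\<in>L'. partner M x = s \<longrightarrow> L' = L)"
    if M: "perfect_matching G M" and s: "s \<in> S" for M s
  proof -
    obtain k where k: "bij_betw (\<lambda>L. partner M (k L)) F S" "\<And>L. L \<in> F \<Longrightarrow> k L \<in> L"
      using main[OF M] by blast
    have "s \<in> (\<lambda>L. partner M (k L)) ` F" using k(1) s by (simp add: bij_betw_def)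
    then obtain L where L: "L \<in> F" "s = partner M (k L)" by blast
    have kV: "k L \<in> V" using k(2)[OF L(1)] K(1)[OF L(1)] by blast
    have ps: "partner M s = k L" using partner(5)[OF M kV] L(2) by simp
    have uniq: "L' = L" if "L' \<in> F" "x \<in> L'" "partner M x = s" for L' x
    proof -
      have "x \<in> V" using K(1) that by blast
      then have "x = k L" using partner(5)[OF M, of x] that(3) ps by simp
      then show ?thesis using disj[OF that(1) L(1)] that(2) k(2)[OF L(1)] by auto
    qed
    have "partner M s \<in> L" using ps k(2)[OF L(1)] by simp
    then show ?thesis using uniq L(1) by blast
  qed
  \<comment> \<open>Every edge lies in some perfect matching, and that matching joins vertices of
    \<open>S\<close> to components only.\<close>
  show out: "\<exists>K\<in>F. y \<in> K" if e: "e \<in> E" "ends G e = {x, y}" "x \<in> S" for e x y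
  proof -
    obtain M where M: "perfect_matching G M" "e \<in> M" by (rule pm_through[OF e(1)])
    have "partner M x = y" by (rule partner_eqI[OF M e(2)])
    then show ?thesis using S_out[OF M(1) e(3)] by blast
  qed
  show "tight K" if KF: "K \<in> F" for K
    unfolding tight_def
  proof (intro allI impI)
    fix M assume M: "perfect_matching G M"
    obtain k where k: "bij_betw (\<lambda>L. partner M (k L)) F S" "\<And>L. L \<in> F \<Longrightarrow> k L \<in> L"
      using main[OF M] by blast
    have kV: "k K \<in> V" using k(2)[OF KF] K(1)[OF KF] by blast
    have pS: "partner M (k K) \<in> S" using k(1) KF by (auto simp: bij_betw_def)
    have "cut G K \<inter> M = {edge_at M (k K)}"
    proof (intro equalityI subsetI)
      fix e assume e: "e \<in> cut G K \<inter> M"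
      then obtain x where x: "x \<in> ends G e" "x \<in> K" by (auto simp: cut_iff)
      have eE: "e \<in> E" "e \<in> M" using e by (simp_all add: cut_def)
      have xV: "x \<in> V" using x K(1)[OF KF] by blast
      have ex: "edge_at M x = e" by (rule edge_at_eqI[OF M eE(2) x(1)])
      have exy: "ends G e = {x, partner M x}" using partner(1)[OF M xV] ex by simp
      have "partner M x \<notin> K" using e exy x(2) by (auto simp: cut_iff)
      then have "partner M x \<in> S" using leave[OF KF eE(1) exy x(2)] by blast
      moreover have "(\<lambda>L. partner M (k L)) ` F = S" using k(1) by (simp add: bij_betw_def)
      ultimately have "partner M x \<in> (\<lambda>L. partner M (k L)) ` F" by simp
      then obtain L where L: "L \<in> F" "partner M x = partner M (k L)" by blast
      have "k L \<in> V" using k(2)[OF L(1)] K(1)[OF L(1)] by blast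
      then have "x = k L" using partner(5)[OF M] xV L(2) by metis
      then have "L = K" using disj[OF L(1) KF] k(2)[OF L(1)] x(2) by auto
      then show "e \<in> {edge_at M (k K)}" using ex \<open>x = k L\<close> by simp
    next
      fix e assume "e \<in> {edge_at M (k K)}"
      then have e: "e = edge_at M (k K)" by simp
      have "partner M (k K) \<notin> K" using pS K(1)[OF KF] by blast
      then show "e \<in> cut G K \<inter> M"
        unfolding e using partner(1)[OF M kV] edge_at(1)[OF M kV] edge_at_edge[OF M kV] k(2)[OF KF]
        by (simp add: cut_iff)
    qed
    then show "card (cut G K \<inter> M) = 1" by simp
  qed
  \<comment> \<open>Neither the components nor, by \<open>out\<close>, the barrier have an edge to
    the outside, so connectedness leaves no other vertices.\<close>
  show "V = S \<union> \<Union>F"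
  proof
    obtain s where s: "s \<in> S" using S(2) by (auto simp: card_gt_0_iff)
    show "V \<subseteq> S \<union> \<Union>F"
    proof (rule connected_closed[OF con, of s])
      fix e v assume e: "e \<in> E" "v \<in> S \<union> \<Union>F" "v \<in> ends G e"
      have xy: "ends G e = {v, other_end e v}" by (rule ends_other_end(1)[OF e(1,3)])
      have "other_end e v \<in> S \<union> \<Union>F"
      proof (cases "v \<in> S")
        case True
        then show ?thesis using out[OF e(1) xy] by blast
      next
        case False
        then obtain L where L: "L \<in> F" "v \<in> L" using e(2) by blast
        show ?thesis using leave[OF L(1) e(1) xy L(2)] L(1) by blast
      qed
      then show "ends G e \<subseteq> S \<union> \<Union>F" using xy e(2) by simp
    qed (use s S in auto)
    show "S \<union> \<Union>F \<subseteq> V" using S K(1) by blast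
  qed
qed

text \<open>Contracting the components of the barrier gives a bipartite cubic graph with three
  vertices on each side and no parallel edges, hence K33. The number of triangles among the
  components decides which list fits; without any triangle \<open>G\<close> would be bipartite. A
  presentation by \<open>T3_list\<close> is excluded as the other outcome of the dichotomy.\<close>

lemma cubic_presents:
  assumes con: "connected_graph G" and nb: "\<not> bipartite G"
    and cubic: "\<And>v. v \<in> V \<Longrightarrow> card (incident_edges G v) = 3"
    and X: "triangle X" "tight X" and ex: "perfect_matching G M0"
    and noT3: "\<not> (\<exists>ws es. length ws = 6 \<and> presents G ws es T3_list)"
  shows "\<exists>ws es. length ws = 8 \<and> presents G ws es T4_list \<or>
    length ws = 10 \<and> presents G ws es T5_list \<or> length ws = 12 \<and> presents G ws es T6_list"
proof -
  obtain S F where SV: "S \<subseteq> V" and F: "finite F" and S3: "card S \<ge> 3" and FS: "card F \<ge> card S"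
    and K: "\<And>K. K \<in> F \<Longrightarrow> K \<subseteq> V - S" "\<And>K. K \<in> F \<Longrightarrow> odd (card K)"
    and disj: "\<And>K L. K \<in> F \<Longrightarrow> L \<in> F \<Longrightarrow> K \<noteq> L \<Longrightarrow> K \<inter> L = {}"
    and leave: "\<And>K e x y. K \<in> F \<Longrightarrow> e \<in> E \<Longrightarrow> ends G e = {x, y} \<Longrightarrow> x \<in> K \<Longrightarrow> y \<in> K \<union> S"
    by (rule triangle_barrier[OF cubic X ex], assumption, rule that)
  have S0: "card S > 0" using S3 by simp
  note barrier = con ex SV S0 F FS K disj leave
  have cF: "card F = card S" by (rule barrier_tight(1)[OF barrier])
  have V_eq: "V = S \<union> \<Union>F" by (rule barrier_tight(2)[OF barrier])
  have tightK: "tight L" if L: "L \<in> F" for L by (rule barrier_tight(3)[OF barrier L])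
  have out: "\<exists>L\<in>F. y \<in> L" if e: "e \<in> E" "ends G e = {x, y}" "x \<in> S" for e x y
    by (rule barrier_tight(4)[OF barrier e])
  have KV: "L \<subseteq> V" "L \<inter> S = {}" if "L \<in> F" for L using K(1)[OF that] by blast+
  have finK: "finite L" if L: "L \<in> F" for L using KV(1)[OF L] finite_V finite_subset by blast
  \<comment> \<open>The complement of \<open>L\<close> contains at least three barrier vertices and
    a vertex of another component, so the triangle in the dichotomy can only be
    \<open>L\<close>.\<close>
  have kind: "card L = 1 \<or> triangle L" if L: "L \<in> F" for L
  proof (cases "card L > 1")
    case True
    have "\<not> F \<subseteq> {L}" using cF S3 card_mono[of "{L}" F] by auto
    then obtain L' where L': "L' \<in> F" "L' \<noteq> L" by blast
    have "L' \<noteq> {}" using K(2)[OF L'(1)] by auto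
    then obtain x where x: "x \<in> L'" by blast
    have xS: "x \<notin> S" "x \<notin> L" "x \<in> V" using x L' KV[OF L'(1)] disj[OF L'(1) L L'(2)] by blast+
    have finS: "finite S" using SV finite_V finite_subset by blast
    have "insert x S \<subseteq> V - L" using xS SV KV(2)[OF L] by blast
    then have "card (insert x S) \<le> card (V - L)" by (rule card_mono[rotated]) (simp add: finite_V)
    then have c4: "card (V - L) \<ge> 4" using xS(1) finS S3 by simp
    then have "card (V - L) > 1" by simp
    from tight_cut_dichotomy[OF con KV(1)[OF L] tightK[OF L] True this] noT3
    have "triangle L \<or> triangle (V - L)" by blast
    then show ?thesis using triangle_card[of "V - L"] c4 by auto
  next
    case False
    then show ?thesis using K(2)[OF L] by (cases "card L") auto
  qed
  \<comment> \<open>Sets serve as names in the quotient: a component stands for itself, a barrier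
    vertex for its singleton. These cannot clash, as components are disjoint from
    \<open>S\<close>.\<close>
  define p where "p v = (if v \<in> S then {v} else (THE L. L \<in> F \<and> v \<in> L))" for v
  have pS: "p v = {v}" if "v \<in> S" for v using that by (simp add: p_def)
  have pK: "p v = L" if "L \<in> F" "v \<in> L" for v L
  proof -
    have "v \<notin> S" using that KV(2) by blast
    moreover have "(THE L. L \<in> F \<and> v \<in> L) = L"
      by (rule the_equality) (use that disj in blast)+
    ultimately show ?thesis by (simp add: p_def)
  qed
  have SF: "{s} \<notin> F" if "s \<in> S" for s using that KV(2)[of "{s}"] by blast
  have Vcases: "v \<in> S \<or> (\<exists>L\<in>F. v \<in> L)" if "v \<in> V" for v using that V_eq by blast
  have fibS: "{u \<in> V. p u = p v} = {v}" if v: "v \<in> S" for v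
  proof (intro equalityI subsetI)
    fix u assume "u \<in> {u \<in> V. p u = p v}"
    then have u: "u \<in> V" "p u = {v}" using pS[OF v] by auto
    show "u \<in> {v}"
    proof (cases "u \<in> S")
      case True
      then show ?thesis using u pS by simp
    next
      case False
      then obtain L where L: "L \<in> F" "u \<in> L" using Vcases[OF u(1)] by blast
      then have "{v} \<in> F" using pK[OF L] u(2) by simp
      then show ?thesis using SF[OF v] by blast
    qed
  qed (use v SV in auto)
  have fibK: "{u \<in> V. p u = p v} = L" if L: "L \<in> F" "v \<in> L" for v L
  proof (intro equalityI subsetI)
    fix u assume "u \<in> {u \<in> V. p u = p v}"
    then have u: "u \<in> V" "p u = L" using pK[OF L] by auto
    show "u \<in> L"
    proof (cases "u \<in> S")
      case True
      then show ?thesis using u(2) pS by auto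
    next
      case False
      then obtain L' where L': "L' \<in> F" "u \<in> L'" using Vcases[OF u(1)] by blast
      then show ?thesis using pK[OF L'] u(2) by simp
    qed
  next
    fix u assume u: "u \<in> L"
    then show "u \<in> {u \<in> V. p u = p v}" using pK[OF L] pK[OF L(1) u] KV(1)[OF L(1)] by auto
  qed
  have fib: "tight {u \<in> V. p u = p v} \<and> ({u \<in> V. p u = p v} = {v} \<or> triangle {u \<in> V. p u = p v})"
    if v: "v \<in> V" for v
    using Vcases[OF v]
  proof
    assume "v \<in> S"
    then show ?thesis using fibS tight_singleton(1)[OF v] by simp
  next
    assume "\<exists>L\<in>F. v \<in> L"
    then obtain L where L: "L \<in> F" "v \<in> L" by blast
    have "L = {v} \<or> triangle L"
      using kind[OF L(1)]
    proof
      assume "card L = 1"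
      then obtain x where "L = {x}" by (rule card_1_singletonE)
      then show ?thesis using L(2) by simp
    qed simp
    then show ?thesis unfolding fibK[OF L] using tightK[OF L(1)] by blast
  qed
  let ?H = "quotient_graph p G"
  interpret H: double_covered_graph ?H by (rule double_covered_contraction(1)[OF fib])
  have Hcubic: "card (incident_edges ?H w) = 3" if w: "w \<in> verts ?H" for w
  proof -
    obtain u where u: "u \<in> V" "w = p u" using w by (auto simp: quotient_graph_def)
    have "incident_edges ?H w = cut G {x \<in> V. p x = p u}"
      unfolding u(2) by (rule double_covered_contraction(2)[OF fib u(1)])
    moreover have "card (cut G {x \<in> V. p x = p u}) = card (incident_edges G u)"
      by (rule card_cut_incident) (use fib[OF u(1)] u(1) in simp_all)
    ultimately show ?thesis using cubic[OF u(1)] by simp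
  qed
  let ?B = "(\<lambda>s. {s}) ` S"
  have HV: "F \<union> ?B = verts ?H"
  proof -
    have pL: "p ` L = {L}" if L: "L \<in> F" for L
    proof -
      have "L \<noteq> {}" using K(2)[OF L] by auto
      then show ?thesis using pK[OF L] by auto
    qed
    have "p ` \<Union>F = (\<Union>L\<in>F. p ` L)" by blast
    also have "\<dots> = (\<Union>L\<in>F. {L})" by (rule SUP_cong[OF refl pL])
    also have "\<dots> = F" by blast
    finally have pF: "p ` \<Union>F = F" .
    have pB: "p ` S = ?B" by (rule image_cong[OF refl pS])
    have VH: "verts ?H = p ` S \<union> p ` \<Union>F"
      unfolding image_Un[symmetric] V_eq[symmetric] by (simp add: quotient_graph_def)
    show ?thesis unfolding VH pF pB by (rule Un_commute)
  qed
  have FB: "F \<inter> ?B = {}" using SF by blast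
  have Hbip: "x \<in> F \<longleftrightarrow> y \<in> ?B" if e: "e \<in> edges ?H" "ends ?H e = {x, y}" for e x y
  proof -
    have eE: "e \<in> E" "card (p ` ends G e) = 2" using e(1) by (simp_all add: quotient_graph_def)
    obtain a b where ab: "ends G e = {a, b}" "a \<noteq> b" "a \<in> V" "b \<in> V" by (rule ends_pair[OF eE(1)])
    have ne: "p a \<noteq> p b" using eE(2) ab(1) by auto
    have eq: "{x, y} = {p a, p b}" using e(2) ab(1) by (simp add: quotient_graph_def)
    have "(p a \<in> F \<and> p b \<in> ?B) \<or> (p a \<in> ?B \<and> p b \<in> F)"
    proof (cases "a \<in> S")
      case True
      then obtain L where "L \<in> F" "b \<in> L" using out[OF eE(1) ab(1)] by blast
      then show ?thesis using True pS pK by auto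
    next
      case False
      then obtain L where L: "L \<in> F" "a \<in> L" using Vcases[OF ab(3)] by blast
      have "b \<notin> L" using ne pK[OF L] pK[OF L(1)] by auto
      then have "b \<in> S" using leave[OF L(1) eE(1) ab(1) L(2)] by blast
      then show ?thesis using L pS pK by auto
    qed
    then show ?thesis using eq FB by (auto simp: doubleton_eq_iff)
  qed
  \<comment> \<open>\<open>F\<close> is one side of the bipartite quotient, and the barrier has at
    least three vertices; with \<open>card F = card S\<close> both sizes are fixed.\<close>
  have "card F \<le> 3"
  proof (rule H.bipartite_cubic_bound[of F ?B])
    show "card (incident_edges ?H w) = 3" if "w \<in> verts ?H" for w by (rule Hcubic[OF that])
    show "x \<in> F \<longleftrightarrow> y \<in> ?B" if "e \<in> edges ?H" "ends ?H e = {x, y}" for e x y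
      by (rule Hbip[OF that])
  qed (rule HV, rule FB)
  then have c3: "card F = 3" "card S = 3" using cF S3 by simp_all
  have noparallel: "e = e'"
    if L: "L \<in> F" and s: "s \<in> S" and e: "e \<in> E" "e' \<in> E" "ends G e = {x, s}" "ends G e' = {x', s}" "x \<in> L" "x' \<in> L"
    for L s e e' x x'
  proof -
    have im: "p ` ends G e = {L, {s}}" "p ` ends G e' = {L, {s}}"
      using e pK[OF L] pS[OF s] by simp_all
    have "L \<noteq> {s}" using SF[OF s] L by auto
    then have "e \<in> edges ?H" "e' \<in> edges ?H" using im e(1,2) by (simp_all add: quotient_graph_def)
    moreover have "ends ?H e = ends ?H e'" using im by (simp add: quotient_graph_def)
    ultimately show ?thesis using H.cubic_no_parallel[OF Hcubic, of e e'] by blast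
  qed
  have cut3: "card (cut G L) = 3" if L: "L \<in> F" for L
  proof -
    have "L \<noteq> {}" using K(2)[OF L] by auto
    then obtain x where x: "x \<in> L" by blast
    then have xV: "x \<in> V" using KV(1)[OF L] by blast
    show ?thesis using card_cut_incident[OF tightK[OF L] xV] cubic[OF xV] by simp
  qed
  have cut_form: "\<exists>x s. ends G c = {x, s} \<and> x \<in> L \<and> s \<in> S" if L: "L \<in> F" and c: "c \<in> cut G L" for L c
  proof -
    have cE: "c \<in> E" using c by (simp add: cut_def)
    obtain x where x: "x \<in> ends G c" "x \<in> L" using c by (auto simp: cut_iff)
    note xy = ends_other_end(1)[OF cE x(1)]
    have "other_end c x \<notin> L" using c x xy by (auto simp: cut_iff)
    then have "other_end c x \<in> S" using leave[OF L cE xy x(2)] by blast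
    then show ?thesis using xy x(2) by blast
  qed
  have finS: "finite S" using SV finite_V finite_subset by blast
  \<comment> \<open>The three edges leaving \<open>L\<close> have different ends in
    \<open>S\<close>, and \<open>S\<close> has only three vertices.\<close>
  have surj: "\<exists>c. c \<in> cut G L \<and> s \<in> ends G c" if L: "L \<in> F" and s: "s \<in> S" for L s
  proof -
    have "\<forall>c\<in>cut G L. \<exists>s. s \<in> S \<and> (\<exists>x\<in>L. ends G c = {x, s})" using cut_form[OF L] by blast
    from bchoice[OF this] obtain g where g: "\<And>c. c \<in> cut G L \<Longrightarrow> g c \<in> S"
      "\<And>c. c \<in> cut G L \<Longrightarrow> \<exists>x\<in>L. ends G c = {x, g c}" by blast
    have "inj_on g (cut G L)"
    proof (rule inj_onI)
      fix c c' assume c: "c \<in> cut G L" "c' \<in> cut G L" "g c = g c'"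
      obtain x where x: "x \<in> L" "ends G c = {x, g c}" using g(2)[OF c(1)] by blast
      obtain x' where x': "x' \<in> L" "ends G c' = {x', g c'}" using g(2)[OF c(2)] by blast
      have "c \<in> E" "c' \<in> E" using c(1,2) by (simp_all add: cut_def)
      then show "c = c'" using noparallel[OF L g(1)[OF c(1)], of c c' x x'] x x' c(3) by simp
    qed
    then have "card (g ` cut G L) = card S" using card_image cut3[OF L] c3 by metis
    moreover have "g ` cut G L \<subseteq> S" using g(1) by blast
    ultimately have "g ` cut G L = S" using finS by (simp add: card_subset_eq)
    then obtain c where c: "c \<in> cut G L" "s = g c" using s by blast
    then show ?thesis using g(2)[OF c(1)] by auto
  qed
  \<comment> \<open>\<open>h L s\<close> is the edge from \<open>L\<close> to \<open>s\<close>, and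
    \<open>a L s\<close> is its end in \<open>L\<close>. For a triangle these ends are its three
    vertices; for a single vertex they all coincide.\<close>
  define h where "h L s = (SOME c. c \<in> cut G L \<and> s \<in> ends G c)" for L s
  define a where "a L s = other_end (h L s) s" for L s
  have h: "h L s \<in> cut G L" "h L s \<in> E" "ends G (h L s) = {a L s, s}" "a L s \<in> L"
    if L: "L \<in> F" and s: "s \<in> S" for L s
  proof -
    show hc: "h L s \<in> cut G L"
      unfolding h_def using someI_ex[OF surj[OF L s]] by blast
    have hs: "s \<in> ends G (h L s)"
      unfolding h_def using someI_ex[OF surj[OF L s]] by blast
    show hE: "h L s \<in> E" using hc by (simp add: cut_def)
    have e: "ends G (h L s) = {s, a L s}" unfolding a_def by (rule ends_other_end(1)[OF hE hs])
    then show "ends G (h L s) = {a L s, s}" by (simp add: insert_commute)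
    show "a L s \<in> L" using hc e s KV(2)[OF L] by (auto simp: cut_iff)
  qed
  have h_end: "s = s'" if "L \<in> F" "s \<in> S" "s' \<in> S" "s' \<in> ends G (h L s)" for L s s'
    using that h(3,4)[OF that(1,2)] KV(2)[OF that(1)] by auto
  have h_inj: "h L s = h L s' \<longleftrightarrow> s = s'" if L: "L \<in> F" and s: "s \<in> S" "s' \<in> S" for L s s'
    using h_end[OF L s(1) s(2)] h(3)[OF L s(2)] by auto
  have h_surj: "\<exists>s\<in>S. c = h L s" if L: "L \<in> F" and c: "c \<in> cut G L" for L c
  proof -
    obtain x s where xs: "ends G c = {x, s}" "x \<in> L" "s \<in> S" using cut_form[OF L c] by blast
    have "c \<in> E" using c by (simp add: cut_def)
    then have "c = h L s" using noparallel[OF L xs(3) _ h(2)[OF L xs(3)] xs(1) h(3)[OF L xs(3)] xs(2) h(4)[OF L xs(3)]] by simp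
    then show ?thesis using xs(3) by blast
  qed
  obtain b0 b1 b2 where b: "S = {b0, b1, b2}" "b0 \<noteq> b1" "b1 \<noteq> b2" "b0 \<noteq> b2"
    using c3(2) unfolding card_3_iff by blast
  have bS: "b0 \<in> S" "b1 \<in> S" "b2 \<in> S" using b(1) by simp_all
  define hs where "hs L = [h L b0, h L b1, h L b2]" for L
  have hs: "distinct (hs L)" "set (hs L) = cut G L" if L: "L \<in> F" for L
  proof -
    show "distinct (hs L)"
      unfolding hs_def using h_inj[OF L] bS b(2-4) by simp
    have "set (hs L) \<subseteq> cut G L" unfolding hs_def using h(1)[OF L] bS by simp
    moreover have "cut G L \<subseteq> set (hs L)"
    proof
      fix c assume "c \<in> cut G L"
      then obtain s where "s \<in> S" "c = h L s" using h_surj[OF L] by blast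
      then show "c \<in> set (hs L)" unfolding hs_def b(1) by auto
    qed
    ultimately show "set (hs L) = cut G L" by blast
  qed
  have tri: "distinct [a L b0, a L b1, a L b2] \<and> {a L b0, a L b1, a L b2} = L \<and>
     (\<exists>d0 d1 d2. ends G d0 = {a L b1, a L b2} \<and> ends G d1 = {a L b0, a L b2} \<and> ends G d2 = {a L b0, a L b1} \<and>
        distinct [d0, d1, d2] \<and> {e \<in> E. ends G e \<subseteq> L} = {d0, d1, d2})"
    if L: "L \<in> F" and t: "triangle L" for L
  proof -
    have inj: "a L s = a L s' \<longleftrightarrow> s = s'" if s: "s \<in> S" "s' \<in> S" for s s'
    proof
      assume eq: "a L s = a L s'"
      have "h L s = h L s'"
        by (rule triangle_cut_unique[OF t h(1)[OF L s(1)] h(1)[OF L s(2)] h(4)[OF L s(1)]])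
          (use h(3)[OF L s(1)] h(3)[OF L s(2)] eq in simp_all)
      then show "s = s'" using h_inj[OF L s] by simp
    qed simp
    have d: "distinct [a L b0, a L b1, a L b2]" using inj bS b(2-4) by simp
    have sub: "{a L b0, a L b1, a L b2} \<subseteq> L" using h(4)[OF L] bS by simp
    have Leq: "{a L b0, a L b1, a L b2} = L"
      by (rule card_subset_eq[OF finK[OF L] sub]) (use d triangle_card[OF t] in simp)
    have off: "L - ends G (h L s) = L - {a L s}" if s: "s \<in> S" for s
      using h(3)[OF L s] KV(2)[OF L] s by auto
    have opp: "\<exists>d. d \<in> E \<and> ends G d = L - {a L s} \<and> (\<forall>e. e \<in> E \<longrightarrow> ends G e \<subseteq> L - {a L s} \<longrightarrow> e = d)"
      if s: "s \<in> S" for s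
      using triangle_opposite[OF t h(1)[OF L s]] unfolding off[OF s] by metis
    obtain d0 where D0: "d0 \<in> E" "ends G d0 = L - {a L b0}" "\<And>e. e \<in> E \<Longrightarrow> ends G e \<subseteq> L - {a L b0} \<Longrightarrow> e = d0"
      using opp[OF bS(1)] by blast
    obtain d1 where D1: "d1 \<in> E" "ends G d1 = L - {a L b1}" "\<And>e. e \<in> E \<Longrightarrow> ends G e \<subseteq> L - {a L b1} \<Longrightarrow> e = d1"
      using opp[OF bS(2)] by blast
    obtain d2 where D2: "d2 \<in> E" "ends G d2 = L - {a L b2}" "\<And>e. e \<in> E \<Longrightarrow> ends G e \<subseteq> L - {a L b2} \<Longrightarrow> e = d2"
      using opp[OF bS(3)] by blast
    have "{a L b0, a L b1, a L b2} - {a L b0} = {a L b1, a L b2}"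
      "{a L b0, a L b1, a L b2} - {a L b1} = {a L b0, a L b2}"
      "{a L b0, a L b1, a L b2} - {a L b2} = {a L b0, a L b1}"
      using d by auto
    note off3 = this[unfolded Leq]
    have de: "ends G d0 = {a L b1, a L b2}" "ends G d1 = {a L b0, a L b2}" "ends G d2 = {a L b0, a L b1}"
      unfolding D0(2) D1(2) D2(2) by (rule off3)+
    have dd: "distinct [d0, d1, d2]"
    proof -
      have "distinct (map (ends G) [d0, d1, d2])" using de d by (auto simp: doubleton_eq_iff)
      then show ?thesis unfolding distinct_map by blast
    qed
    have inner: "{e \<in> E. ends G e \<subseteq> L} = {d0, d1, d2}"
    proof (intro equalityI subsetI)
      fix e assume e: "e \<in> {e \<in> E. ends G e \<subseteq> L}"
      then have eE: "e \<in> E" "ends G e \<subseteq> L" by simp_all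
      have "\<not> L \<subseteq> ends G e"
      proof
        assume "L \<subseteq> ends G e"
        then have "ends G e = L" using eE(2) by blast
        then show False using card_ends[OF eE(1)] triangle_card[OF t] by simp
      qed
      then obtain x where x: "x \<in> L" "x \<notin> ends G e" by blast
      have "x \<in> {a L b0, a L b1, a L b2}" unfolding Leq by (rule x(1))
      then have "x = a L b0 \<or> x = a L b1 \<or> x = a L b2" by simp
      moreover have "ends G e \<subseteq> L - {x}" using eE(2) x(2) by blast
      ultimately show "e \<in> {d0, d1, d2}" using D0(3) D1(3) D2(3) eE(1) by blast
    next
      fix e assume "e \<in> {d0, d1, d2}"
      then show "e \<in> {e \<in> E. ends G e \<subseteq> L}" using D0(1,2) D1(1,2) D2(1,2) by auto
    qed
    have "\<exists>d0 d1 d2. ends G d0 = {a L b1, a L b2} \<and> ends G d1 = {a L b0, a L b2} \<and> ends G d2 = {a L b0, a L b1} \<and>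
        distinct [d0, d1, d2] \<and> {e \<in> E. ends G e \<subseteq> L} = {d0, d1, d2}"
      by (intro exI[of _ d0] exI[of _ d1] exI[of _ d2] conjI de dd inner)
    then show ?thesis by (rule conjI[OF d conjI[OF Leq]])
  qed
  \<comment> \<open>The sides are ordered by their opposite vertices, as in the incidence
    lists.\<close>
  define R where "R L d0 d1 d2 \<longleftrightarrow>
     ends G d0 = {a L b1, a L b2} \<and> ends G d1 = {a L b0, a L b2} \<and> ends G d2 = {a L b0, a L b1} \<and>
     distinct [d0, d1, d2] \<and> {e \<in> E. ends G e \<subseteq> L} = {d0, d1, d2}" for L d0 d1 d2
  define D where "D L = (SOME D. \<exists>d0 d1 d2. D = [d0, d1, d2] \<and> R L d0 d1 d2)" for L
  have D: "\<exists>d0 d1 d2. D L = [d0, d1, d2] \<and> R L d0 d1 d2" if L: "L \<in> F" "triangle L" for L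
  proof -
    have "\<exists>d0 d1 d2. R L d0 d1 d2"
      unfolding R_def by (rule tri[OF L, THEN conjunct2, THEN conjunct2])
    then have "\<exists>D d0 d1 d2. D = [d0, d1, d2] \<and> R L d0 d1 d2" by blast
    from someI_ex[OF this] show ?thesis unfolding D_def .
  qed
  define vl where "vl L = (if triangle L then [a L b0, a L b1, a L b2] else [a L b0])" for L
  define dl where "dl L = (if triangle L then D L else [])" for L
  have single: "{a L b0} = L \<and> a L b1 = a L b0 \<and> a L b2 = a L b0" if L: "L \<in> F" "\<not> triangle L" for L
  proof -
    have "card L = 1" using kind[OF L(1)] L(2) by blast
    then obtain x where x: "L = {x}" by (rule card_1_singletonE)
    have "a L b0 \<in> {x}" "a L b1 \<in> {x}" "a L b2 \<in> {x}" using h(4)[OF L(1)] bS x by blast+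
    then show ?thesis using x by simp
  qed
  have vl: "distinct (vl L)" "set (vl L) = L" if L: "L \<in> F" for L
    using tri[OF L] single[OF L] unfolding vl_def by auto
  have dl: "distinct (dl L)" "set (dl L) = {e \<in> E. ends G e \<subseteq> L}" if L: "L \<in> F" for L
  proof -
    have "distinct (dl L) \<and> set (dl L) = {e \<in> E. ends G e \<subseteq> L}"
    proof (cases "triangle L")
      case True
      from D[OF L True] obtain d0 d1 d2 where "D L = [d0, d1, d2]" "R L d0 d1 d2" by blast
      then show ?thesis unfolding dl_def R_def using True by simp
    next
      case False
      have "\<not> ends G e \<subseteq> L" if e: "e \<in> E" for e
      proof
        assume "ends G e \<subseteq> L"
        then have "card (ends G e) \<le> card L" by (rule card_mono[OF finK[OF L]])
        then show False using card_ends[OF e] kind[OF L] False by simp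
      qed
      then show ?thesis unfolding dl_def using False by simp
    qed
    then show "distinct (dl L)" "set (dl L) = {e \<in> E. ends G e \<subseteq> L}" by blast+
  qed
  \<comment> \<open>Triangles come before single vertices, the order in which
    \<open>T4_list\<close>, \<open>T5_list\<close> and \<open>T6_list\<close> number the vertices
    replacing the members of A; after this only the number of triangles matters.\<close>
  obtain K0 K1 K2 where K3: "F = {K0, K1, K2}" "K0 \<noteq> K1" "K1 \<noteq> K2" "K0 \<noteq> K2"
    and ord: "triangle K1 \<Longrightarrow> triangle K0" "triangle K2 \<Longrightarrow> triangle K1"
  proof -
    obtain A B C where F3: "F = {A, B, C}" "A \<noteq> B" "B \<noteq> C" "A \<noteq> C"
      using c3(1) unfolding card_3_iff by blast
    note perms = that[of A B C] that[of A C B] that[of B A C] that[of B C A] that[of C A B] that[of C B A]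
    have eqs: "F = {A, C, B}" "F = {B, A, C}" "F = {B, C, A}" "F = {C, A, B}" "F = {C, B, A}"
      using F3(1) by auto
    show thesis
      by (cases "triangle A"; cases "triangle B"; cases "triangle C")
        (use perms F3 eqs in \<open>blast dest: sym\<close>)+
  qed
  have KF: "K0 \<in> F" "K1 \<in> F" "K2 \<in> F" using K3(1) by simp_all
  let ?ws = "[b0, b1, b2] @ vl K0 @ vl K1 @ vl K2"
  let ?es = "hs K0 @ hs K1 @ hs K2 @ dl K0 @ dl K1 @ dl K2"
  have dK: "K0 \<inter> K1 = {}" "K1 \<inter> K2 = {}" "K0 \<inter> K2 = {}"
    using disj[OF KF(1,2) K3(2)] disj[OF KF(2,3) K3(3)] disj[OF KF(1,3) K3(4)] by simp_all
  have dws: "distinct ?ws"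
  proof -
    have bd: "distinct [b0, b1, b2]" using b(2-4) by simp
    have bset: "set [b0, b1, b2] = S" unfolding b(1) by simp
    have SK: "S \<inter> L = {}" if "L \<in> F" for L using KV(2)[OF that] by (simp only: Int_commute)
    show ?thesis
      unfolding distinct_append set_append bset vl(2)[OF KF(1)] vl(2)[OF KF(2)] vl(2)[OF KF(3)]
      using bd vl(1)[OF KF(1)] vl(1)[OF KF(2)] vl(1)[OF KF(3)] dK SK[OF KF(1)] SK[OF KF(2)] SK[OF KF(3)]
      by (simp only: Int_Un_distrib Un_empty_right Un_empty_left simp_thms)
  qed
  have setV: "set ?ws = V"
    unfolding set_append vl(2)[OF KF(1)] vl(2)[OF KF(2)] vl(2)[OF KF(3)] V_eq unfolding K3(1) b(1)
    by auto
  have cc: "cut G L \<inter> cut G L' = {}" if L: "L \<in> F" "L' \<in> F" "L \<noteq> L'" for L L'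
  proof (rule ccontr)
    assume "cut G L \<inter> cut G L' \<noteq> {}"
    then obtain c where c: "c \<in> cut G L" "c \<in> cut G L'" by blast
    obtain x s where "ends G c = {x, s}" "x \<in> L" "s \<in> S" using cut_form[OF L(1) c(1)] by blast
    moreover obtain x' s' where "ends G c = {x', s'}" "x' \<in> L'" "s' \<in> S" using cut_form[OF L(2) c(2)] by blast
    ultimately show False using disj[OF L] KV(2)[OF L(1)] KV(2)[OF L(2)] by (auto simp: doubleton_eq_iff)
  qed
  have ci: "cut G L \<inter> {e \<in> E. ends G e \<subseteq> L'} = {}" if L: "L \<in> F" "L' \<in> F" for L L'
    using cut_form[OF L(1)] KV(2)[OF L(2)] by blast
  have ii: "{e \<in> E. ends G e \<subseteq> L} \<inter> {e \<in> E. ends G e \<subseteq> L'} = {}" if L: "L \<in> F" "L' \<in> F" "L \<noteq> L'" for L L'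
  proof (rule ccontr)
    assume "{e \<in> E. ends G e \<subseteq> L} \<inter> {e \<in> E. ends G e \<subseteq> L'} \<noteq> {}"
    then obtain e where e: "e \<in> E" "ends G e \<subseteq> L" "ends G e \<subseteq> L'" by blast
    then have "ends G e = {}" using disj[OF L] by blast
    then show False using card_ends[OF e(1)] by simp
  qed
  have des: "distinct ?es"
    unfolding distinct_append set_append hs(2)[OF KF(1)] hs(2)[OF KF(2)] hs(2)[OF KF(3)]
      dl(2)[OF KF(1)] dl(2)[OF KF(2)] dl(2)[OF KF(3)]
    using hs(1)[OF KF(1)] hs(1)[OF KF(2)] hs(1)[OF KF(3)] dl(1)[OF KF(1)] dl(1)[OF KF(2)] dl(1)[OF KF(3)]
      cc[OF KF(1,2) K3(2)] cc[OF KF(1,3) K3(4)] cc[OF KF(2,3) K3(3)]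
      ci[OF KF(1) KF(1)] ci[OF KF(1) KF(2)] ci[OF KF(1) KF(3)] ci[OF KF(2) KF(1)] ci[OF KF(2) KF(2)]
      ci[OF KF(2) KF(3)] ci[OF KF(3) KF(1)] ci[OF KF(3) KF(2)] ci[OF KF(3) KF(3)]
      ii[OF KF(1,2) K3(2)] ii[OF KF(1,3) K3(4)] ii[OF KF(2,3) K3(3)]
    by (simp only: Int_Un_distrib Un_empty_right Un_empty_left simp_thms)
  have Ecov: "\<exists>L\<in>F. e \<in> cut G L \<or> ends G e \<subseteq> L" if e: "e \<in> E" for e
  proof -
    obtain x y where xy: "ends G e = {x, y}" "x \<noteq> y" "x \<in> V" "y \<in> V" by (rule ends_pair[OF e])
    have "\<exists>L\<in>F. ends G e \<inter> L \<noteq> {}"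
    proof (cases "x \<in> S")
      case True
      then show ?thesis using out[OF e xy(1)] xy(1) by blast
    next
      case False
      then show ?thesis using Vcases[OF xy(3)] xy(1) by blast
    qed
    then show ?thesis using e by (auto simp: cut_iff)
  qed
  have setE: "set ?es = E"
  proof
    show "set ?es \<subseteq> E"
      unfolding set_append hs(2)[OF KF(1)] hs(2)[OF KF(2)] hs(2)[OF KF(3)]
        dl(2)[OF KF(1)] dl(2)[OF KF(2)] dl(2)[OF KF(3)] by (auto simp: cut_def)
    show "E \<subseteq> set ?es"
      unfolding set_append hs(2)[OF KF(1)] hs(2)[OF KF(2)] hs(2)[OF KF(3)]
        dl(2)[OF KF(1)] dl(2)[OF KF(2)] dl(2)[OF KF(3)] using Ecov unfolding K3(1) by blast
  qed
  have he: "ends G (h L b0) = {a L b0, b0}" "ends G (h L b1) = {a L b1, b1}" "ends G (h L b2) = {a L b2, b2}"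
    if "L \<in> F" for L using h(3)[OF that] bS by simp_all
  note he0 = he[OF KF(1)] and he1 = he[OF KF(2)] and he2 = he[OF KF(3)]
  have t0: "triangle K0"
  proof (rule ccontr)
    assume n0: "\<not> triangle K0"
    then have none: "\<not> triangle L" if "L \<in> F" for L using ord that unfolding K3(1) by blast
    have "bipartite G"
      unfolding bipartite_def
    proof (intro exI conjI ballI)
      show "S \<union> \<Union>F = V" using V_eq by simp
      show "S \<inter> \<Union>F = {}" using KV(2) by blast
      fix e assume e: "e \<in> E"
      obtain L where L: "L \<in> F" "e \<in> cut G L \<or> ends G e \<subseteq> L" using Ecov[OF e] by blast
      have "\<not> ends G e \<subseteq> L"
      proof
        assume "ends G e \<subseteq> L"
        then have "e \<in> set (dl L)" using dl(2)[OF L(1)] e by simp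
        then show False using none[OF L(1)] by (simp add: dl_def)
      qed
      then obtain x s where "ends G e = {x, s}" "x \<in> L" "s \<in> S" using cut_form[OF L(1)] L(2) by blast
      then show "\<exists>a\<in>S. \<exists>b\<in>\<Union>F. ends G e = {a, b}" using L(1) by (metis UnionI insert_commute)
    qed
    then show False using nb by contradiction
  qed
  obtain d0 d1 d2 where D0': "D K0 = [d0, d1, d2]" "R K0 d0 d1 d2"
      using D[OF KF(1) t0] by blast
    note D0 = D0'(1) D0'(2)[unfolded R_def, THEN conjunct1]
      D0'(2)[unfolded R_def, THEN conjunct2, THEN conjunct1]
      D0'(2)[unfolded R_def, THEN conjunct2, THEN conjunct2, THEN conjunct1]
  show ?thesis
  proof (cases "triangle K1")
    case False
    then have f2: "\<not> triangle K2" using ord by blast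
    note s1 = single[OF KF(2) False] and s2 = single[OF KF(3) f2]
    have "presents G ?ws ?es T4_list"
      unfolding presents_def
    proof (intro conjI dws setV des setE)
      show "list_all2 (\<lambda>e (i, j). i < length ?ws \<and> j < length ?ws \<and> ends G e = {?ws ! i, ?ws ! j}) ?es T4_list"
        using t0 False f2 he0 he1 he2 s1 s2 D0
        by (simp add: vl_def dl_def hs_def T4_list_def)
    qed
    moreover have "length ?ws = 8" using t0 False f2 by (simp add: vl_def)
    ultimately show ?thesis by blast
  next
    case t1: True
    obtain d0' d1' d2' where D1': "D K1 = [d0', d1', d2']" "R K1 d0' d1' d2'"
      using D[OF KF(2) t1] by blast
    note D1 = D1'(1) D1'(2)[unfolded R_def, THEN conjunct1]
      D1'(2)[unfolded R_def, THEN conjunct2, THEN conjunct1]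
      D1'(2)[unfolded R_def, THEN conjunct2, THEN conjunct2, THEN conjunct1]
    show ?thesis
    proof (cases "triangle K2")
      case False
      note s2 = single[OF KF(3) False]
      have "presents G ?ws ?es T5_list"
        unfolding presents_def
      proof (intro conjI dws setV des setE)
        show "list_all2 (\<lambda>e (i, j). i < length ?ws \<and> j < length ?ws \<and> ends G e = {?ws ! i, ?ws ! j}) ?es T5_list"
          using t0 t1 False he0 he1 he2 s2 D0 D1
          by (simp add: vl_def dl_def hs_def T5_list_def)
      qed
      moreover have "length ?ws = 10" using t0 t1 False by (simp add: vl_def)
      ultimately show ?thesis by blast
    next
      case t2: True
      obtain d0'' d1'' d2'' where D2': "D K2 = [d0'', d1'', d2'']" "R K2 d0'' d1'' d2''"
      using D[OF KF(3) t2] by blast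
    note D2 = D2'(1) D2'(2)[unfolded R_def, THEN conjunct1]
      D2'(2)[unfolded R_def, THEN conjunct2, THEN conjunct1]
      D2'(2)[unfolded R_def, THEN conjunct2, THEN conjunct2, THEN conjunct1]
      have "presents G ?ws ?es T6_list"
        unfolding presents_def
      proof (intro conjI dws setV des setE)
        show "list_all2 (\<lambda>e (i, j). i < length ?ws \<and> j < length ?ws \<and> ends G e = {?ws ! i, ?ws ! j}) ?es T6_list"
          using t0 t1 t2 he0 he1 he2 D0 D1 D2
          by (simp add: vl_def dl_def hs_def T6_list_def)
      qed
      moreover have "length ?ws = 12" using t0 t1 t2 by (simp add: vl_def)
      ultimately show ?thesis by blast
    qed
  qed
qed

end

subsection \<open>The classification\<close>

lemma isomorphic_of_presents:
  assumes "presents G ws es ds" "length ws = n" "\<exists>ws' es'. length ws' = n \<and> presents H ws' es' ds"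
  shows "isomorphic G H"
  using assms presents_isomorphic by metis

text \<open>Connectedness is taken from \<open>G\<close>, so only the matching counts have to be
  read off from the list.\<close>

lemma double_covered_of_isomorphic:
  assumes G: "finite_loopless G" "connected_graph G" and iso: "isomorphic G H"
    and H: "\<exists>ws es. length ws = n \<and> presents H ws es ds" and dc: "double_covered_list ds n"
  shows "matching_double_covered G"
proof -
  obtain ws es where H': "presents H ws es ds" "length ws = n" using H by blast
  obtain ws' es' where G': "presents G ws' es' ds" "length ws' = length ws"
    by (rule presents_pullback[OF iso G(1) H'(1)])
  have "double_covered_list ds (length ws')" using dc G'(2) H'(2) by simp
  from presents_double_covered[OF G'(1) G(1) this] show ?thesis
    using G(2) by (simp add: matching_double_covered_def)
qed

lemma presents_T3': "\<exists>ws es. length ws = 6 \<and> presents T3 ws es T3_list"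
  using presents_T3 by (intro exI[of _ "[vp, vu, vq, vr, vs, vt]"]) simp

theorem corollary1p12:
  fixes G :: "('v, 'e) multigraph"
  assumes "finite_loopless G"
    and "matching_covered G"
    and "\<not> bipartite G"
    and "\<exists>C. tight_cut G C \<and> \<not> trivial_cut G C"
  shows "matching_double_covered G \<longleftrightarrow>
    isomorphic G T3 \<or> isomorphic G T4 \<or> isomorphic G T5 \<or> isomorphic G T6"
proof -
  interpret loopless_graph G by unfold_locales (rule assms(1))
  have con: "connected_graph G" using assms(2) by (simp add: matching_covered_def)
  show ?thesis
  proof
    assume mdc: "matching_double_covered G"
    interpret double_covered_graph G
      by unfold_locales (use mdc in \<open>simp add: matching_double_covered_def\<close>)
    obtain C where C: "tight_cut G C" "\<not> trivial_cut G C" using assms(4) by blast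
    obtain X where X: "X \<subseteq> V" "odd (card X)" "C = cut G X" and t: "tight X"
      using C(1) unfolding tight_cut_def tight_def by blast
    \<comment> \<open>An edgeless graph counts as bipartite. Hence there is an edge and with it a
      perfect matching, which makes \<open>card V\<close> even and both shores of the cut odd; a
      nontrivial cut then has more than one vertex on each side.\<close>
    have "E \<noteq> {}"
    proof
      assume "E = {}"
      then have "bipartite G" unfolding bipartite_def by (intro exI[of _ V] exI[of _ "{}"]) simp
      then show False using assms(3) by contradiction
    qed
    then obtain e where "e \<in> E" by blast
    then obtain M where M: "perfect_matching G M" by (rule pm_through)
    have c1: "card X \<noteq> 1" "card (V - X) \<noteq> 1"
      using C(2) X unfolding trivial_cut_def by blast+
    have "card V = card X + card (V - X)"
      using card_Diff_subset[OF finite_subset[OF X(1) finite_V] X(1)] card_mono[OF finite_V X(1)] by simp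
    then have "odd (card (V - X))" using even_card_V[OF M] X(2) by (metis even_add)
    then have big: "card X > 1" "card (V - X) > 1"
      using X(2) c1 by (metis One_nat_def Suc_lessI even_zero gr0I)+
    show "isomorphic G T3 \<or> isomorphic G T4 \<or> isomorphic G T5 \<or> isomorphic G T6"
    proof (cases "\<exists>ws es. length ws = 6 \<and> presents G ws es T3_list")
      case True
      then show ?thesis using isomorphic_of_presents[OF _ _ presents_T3'] by blast
    next
      case noT3: False
      then have tri: "triangle X \<or> triangle (V - X)" and c3: "card (cut G X) = 3"
        using tight_cut_dichotomy[OF con X(1) t big] by blast+
      have cubic: "card (incident_edges G v) = 3" if "v \<in> V" for v
        using card_cut_incident[OF t that] c3 by simp
      have "\<exists>Y. triangle Y \<and> tight Y" using tri t tight_compl[of X] by blast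
      then obtain Y where Y: "triangle Y" "tight Y" by blast
      have "\<exists>ws es. length ws = 8 \<and> presents G ws es T4_list \<or>
          length ws = 10 \<and> presents G ws es T5_list \<or> length ws = 12 \<and> presents G ws es T6_list"
        by (rule cubic_presents[OF con assms(3) cubic Y M noT3])
      then show ?thesis
        using isomorphic_of_presents[OF _ _ presents_T4] isomorphic_of_presents[OF _ _ presents_T5]
          isomorphic_of_presents[OF _ _ presents_T6] by blast
    qed
  next
    assume "isomorphic G T3 \<or> isomorphic G T4 \<or> isomorphic G T5 \<or> isomorphic G T6"
    then show "matching_double_covered G"
      using double_covered_of_isomorphic[OF assms(1) con _ presents_T3' double_covered_T3]
        double_covered_of_isomorphic[OF assms(1) con _ presents_T4 double_covered_T4]
        double_covered_of_isomorphic[OF assms(1) con _ presents_T5 double_covered_T5]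
        double_covered_of_isomorphic[OF assms(1) con _ presents_T6 double_covered_T6] by blast
  qed
qed

end
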